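(* Let $f$ be an inner function with $f(0)=0$ which is not a rotation. Let $\{a_{n}\}_{n\ge1}$ be a sequence of complex numbers with $\sum_{n=1}^\infty |a_{n}|^{2}<\infty$ but $\sum_{n=1}^\infty |a_{n}|=\infty$. Then $F=\sum^{\infty}_{n=1}a_{n}f^{n}\in \overline{\mathbb{H}^{\infty}(\mathbb{D})}$. Moreover $$ F(\xi)=\lim_{r\to 1}F(r\xi)=\sum^{\infty}_{n=1}a_{n}f^{n}(\xi) $$ at almost every $\xi\in \partial\mathbb{D}$, but $\sup\{|F(\xi)|:\xi\in I\}=\infty$ for any arc $I\subset \partial\mathbb{D}$.
   Context: $\mathbb{D}$ is the open unit disc and $\partial\mathbb{D}$ the unit circle; $m$ is normalized Lebesgue measure on $\partial\mathbb{D}$. An inner function is an analytic mapping $f:\mathbb{D}\to\mathbb{D}$ whose radial limits have modulus one at almost every point of $\partial\mathbb{D}$. A rotation is a map $z\mapsto \lambda z$ with $|\lambda|=1$. $f^{n}$ denotes the $n$-th iterate of $f$ (not the power), and for almost every $\xi\in\partial\mathbb{D}$, $f^{n}(\xi)=\lim_{r\to1^-}f^{n}(r\xi)$. When $\sum|a_n|^2<\infty$, the series $\sum a_nf^n$ converges in the Hardy space $\mathbb{H}^2(\mathbb{D})$ (hence uniformly on compact subsets of $\mathbb{D}$), and $F$ denotes its sum. $F(\xi)$ is the non-tangential limit of $F$ at $\xi\in\partial\mathbb{D}$, which exists for almost every $\xi$; the supremum over $\xi\in I$ is over the points of $I$ where it exists. Arcs are nondegenerate (positive length). $\mathbb{H}^\infty(\mathbb{D})$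 is the algebra of bounded analytic functions in $\mathbb{D}$. $\mathrm{BMOA}(\mathbb{D})$ is the space of analytic functions $G$ in $\mathbb{D}$ (with non-tangential boundary values $G(\xi)$) such that $$\|G\|^{2}_{\mathrm{BMOA}(\mathbb{D})}=\sup_{z\in \mathbb{D}} \int_{\partial\mathbb{D}} |G(\xi)-G(z)|^{2} P(z,\xi)\,dm(\xi)<\infty,\qquad P(z,\xi)=(1-|z|^{2})|\xi-z|^{-2},$$ and $\overline{\mathbb{H}^{\infty}(\mathbb{D})}$ is the closure of $\mathbb{H}^\infty(\mathbb{D})$ in $\mathrm{BMOA}(\mathbb{D})$ with respect to $\|\cdot\|_{\mathrm{BMOA}(\mathbb{D})}$. *)

theory Defs
  imports "HOL-Complex_Analysis.Complex_Analysis"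
begin

text \<open>All function spaces on the open unit disc are represented by total functions
  \<^typ>\<open>complex \<Rightarrow> complex\<close>; their values outside the disc are irrelevant.\<close>

abbreviation unit_disc :: "complex set" where
  "unit_disc \<equiv> ball 0 1"

abbreviation unit_circle :: "complex set" where
  "unit_circle \<equiv> sphere 0 1"

definition circle_measure :: "complex measure" where
  "circle_measure =
     distr (uniform_measure lborel {0..<2 * pi}) (restrict_space borel unit_circle) cis"

lemma cis_measurable_circle:
  "cis \<in> uniform_measure lborel {0..<2 * pi} \<rightarrow>\<^sub>M restrict_space borel unit_circle"
proof (rule measurable_restrict_space2)
  have "cis \<in> borel_measurable borel"
    by (intro borel_measurable_continuous_onI continuous_intros)
  then show "cis \<in> borel_measurable (uniform_measure lborel {0..<2 * pi})"
    by simp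
qed auto

lemma space_circle_measure: "space circle_measure = unit_circle"
  by (simp add: circle_measure_def space_restrict_space)

lemma emeasure_circle_measure_space: "emeasure circle_measure unit_circle = 1"
proof -
  have "emeasure circle_measure unit_circle =
      emeasure (uniform_measure lborel {0..<2 * pi}) UNIV"
    unfolding circle_measure_def
    by (subst emeasure_distr[OF cis_measurable_circle])
       (auto simp: sets_restrict_space vimage_def intro!: image_eqI[where x = UNIV])
  also have "\<dots> = 1"
    by (subst emeasure_uniform_measure)
       (auto simp: ennreal_divide_self)
  finally show ?thesis .
qed

definition has_radial_limit :: "(complex \<Rightarrow> complex) \<Rightarrow> complex \<Rightarrow> complex \<Rightarrow> bool" where
  "has_radial_limit G \<xi> w \<longleftrightarrow> ((\<lambda>r. G (complex_of_real r * \<xi>)) \<longlongrightarrow> w) (at_left 1)"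

definition radial_limit :: "(complex \<Rightarrow> complex) \<Rightarrow> complex \<Rightarrow> complex" where
  "radial_limit G \<xi> = (THE w. has_radial_limit G \<xi> w)"

definition stolz_region :: "real \<Rightarrow> complex \<Rightarrow> complex set" where
  "stolz_region \<alpha> \<xi> = {z \<in> unit_disc. norm (z - \<xi>) < \<alpha> * (1 - norm z)}"

definition has_nontangential_limit :: "(complex \<Rightarrow> complex) \<Rightarrow> complex \<Rightarrow> complex \<Rightarrow> bool" where
  "has_nontangential_limit G \<xi> w \<longleftrightarrow>
     (\<forall>\<alpha>>1. (G \<longlongrightarrow> w) (at \<xi> within stolz_region \<alpha> \<xi>))"

definition boundary_value :: "(complex \<Rightarrow> complex) \<Rightarrow> complex \<Rightarrow> complex" where
  "boundary_value G \<xi> = (THE w. has_nontangential_limit G \<xi> w)"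

definition inner_function :: "(complex \<Rightarrow> complex) \<Rightarrow> bool" where
  "inner_function f \<longleftrightarrow>
     f holomorphic_on unit_disc \<and> f ` unit_disc \<subseteq> unit_disc \<and>
     (AE \<xi> in circle_measure. \<exists>w. has_radial_limit f \<xi> w \<and> norm w = 1)"

definition is_rotation :: "(complex \<Rightarrow> complex) \<Rightarrow> bool" where
  "is_rotation f \<longleftrightarrow> (\<exists>c. norm c = 1 \<and> (\<forall>z\<in>unit_disc. f z = c * z))"

definition H2_norm_sq :: "(complex \<Rightarrow> complex) \<Rightarrow> ennreal" where
  "H2_norm_sq G =
     (SUP r\<in>{0..<1}. \<integral>\<^sup>+\<xi>. ennreal ((norm (G (complex_of_real r * \<xi>)))\<^sup>2) \<partial>circle_measure)"

definition H2 :: "(complex \<Rightarrow> complex) set" where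
  "H2 = {G. G holomorphic_on unit_disc \<and> H2_norm_sq G < \<infinity>}"

definition H2_sums :: "(nat \<Rightarrow> complex \<Rightarrow> complex) \<Rightarrow> (complex \<Rightarrow> complex) \<Rightarrow> bool" where
  "H2_sums g G \<longleftrightarrow>
     (\<forall>n. g n \<in> H2) \<and> G \<in> H2 \<and>
     (\<lambda>N. H2_norm_sq (\<lambda>z. G z - (\<Sum>n<N. g n z))) \<longlonglongrightarrow> 0"

definition Hinf :: "(complex \<Rightarrow> complex) set" where
  "Hinf = {G. G holomorphic_on unit_disc \<and> bounded (G ` unit_disc)}"

definition poisson_kernel :: "complex \<Rightarrow> complex \<Rightarrow> real" where
  "poisson_kernel z \<xi> = (1 - (norm z)\<^sup>2) / (norm (\<xi> - z))\<^sup>2"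

definition BMOA_norm_sq :: "(complex \<Rightarrow> complex) \<Rightarrow> ennreal" where
  "BMOA_norm_sq G =
     (SUP z\<in>unit_disc. \<integral>\<^sup>+\<xi>. ennreal ((norm (boundary_value G \<xi> - G z))\<^sup>2 * poisson_kernel z \<xi>)
        \<partial>circle_measure)"

definition BMOA :: "(complex \<Rightarrow> complex) set" where
  "BMOA = {G. G holomorphic_on unit_disc \<and>
     (AE \<xi> in circle_measure. \<exists>w. has_nontangential_limit G \<xi> w) \<and>
     BMOA_norm_sq G < \<infinity>}"

definition BMOA_norm :: "(complex \<Rightarrow> complex) \<Rightarrow> real" where
  "BMOA_norm G = sqrt (enn2real (BMOA_norm_sq G))"

text \<open>Since \<^const>\<open>enn2real\<close> sends infinity to zero, \<^const>\<open>BMOA_norm\<close> is only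
  meaningful on \<^const>\<open>BMOA\<close>; hence the explicit membership of the difference below.\<close>

definition BMOA_closure :: "(complex \<Rightarrow> complex) set \<Rightarrow> (complex \<Rightarrow> complex) set" where
  "BMOA_closure S = {G \<in> BMOA. \<forall>\<epsilon>>0. \<exists>h\<in>S.
     (\<lambda>z. G z - h z) \<in> BMOA \<and> BMOA_norm (\<lambda>z. G z - h z) < \<epsilon>}"

text \<open>Arcs may be open, closed or half-open, and the whole circle is included.\<close>

definition circle_arc :: "complex set \<Rightarrow> bool" where
  "circle_arc I \<longleftrightarrow>
     (\<exists>J::real set. is_interval J \<and> (\<exists>s\<in>J. \<exists>t\<in>J. s < t) \<and> I = cis ` J)"

text \<open>The sequence \<open>a\<close> is indexed from 1, so \<open>a 0\<close> plays no role.\<close>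

definition iterate_series :: "(nat \<Rightarrow> complex) \<Rightarrow> (complex \<Rightarrow> complex) \<Rightarrow> complex \<Rightarrow> complex" where
  "iterate_series a f z = (\<Sum>n. a (Suc n) * (f ^^ Suc n) z)"

end

theory Submission
  imports Defs
begin

text \<open>Let \<open>T\<close> denote the boundary map of \<open>f\<close>. Comparing Fourier coefficients, \<open>T\<close> transports the
  Poisson kernel of \<open>z\<close> to that of \<open>f z\<close>. Hence \<open>T\<close> preserves Lebesgue measure, \<open>f ^^ n\<close> is the
  Poisson integral of \<open>T ^^ n\<close>, and with \<open>c = f'(0)\<close>, \<open>\<bar>c\<bar> < 1\<close>, the functions
  \<open>T ^^ n - cnj c * T ^^ (n + 1)\<close> form a reverse martingale difference sequence. Kolmogorov's
  inequality for these gives the almost everywhere convergence of \<open>\<Sum>n. a n * T ^^ n\<close>, and Fatou's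
  theorem identifies its sum with the nontangential limits of \<open>F\<close>.

  With respect to the Poisson kernel of any \<open>z\<close> the covariances of \<open>T ^^ n\<close> and \<open>T ^^ m\<close> decay so fast
  (Harnack) that the variance of \<open>\<Sum>n\<ge>N. a n * T ^^ n\<close> is at most a constant times
  \<open>\<Sum>n\<ge>N. \<bar>a n\<bar>\<^sup>2\<close>: the partial sums of \<open>F\<close>, which are bounded, converge to \<open>F\<close> in BMOA.

  Finally, a Riesz product built from the martingale differences has a correlation of order
  \<open>\<Sum>n. \<bar>a n\<bar> = \<infinity>\<close> with the sum. It still does so when it starts at a late index and is multiplied by
  the Poisson kernel of a point close to a given arc, so \<open>F\<close> cannot be bounded on that arc.\<close>

subsection \<open>Normalized Lebesgue measure on the circle\<close>

text \<open>Conditional expectations given the boundary map are not formed. A pairing replaces them: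
  if \<open>u\<close> has the same moments against \<open>bdry \<xi> ^ n\<close> as \<open>v\<close>
  has against \<open>\<xi> ^ n\<close>, then \<open>v \<circ> bdry\<close> acts as the conditional
  expectation of \<open>u\<close>; for \<open>\<xi>\<close> and \<open>\<xi>\<^sup>2\<close> the
  function \<open>v\<close> is an explicit polynomial.

  The differences are complex, and this is the obstacle for the Riesz product: the conditional mean
  of \<open>(Re (u * mdiff))\<^sup>2\<close> is not constant. Besides (1 - |c|^2) / 2 it contains a
  multiple of the real part of a term linear in the boundary map, of either sign, with the second
  Taylor coefficient of f as factor. It is harmless only if the Riesz weight has a small first
  moment, and this dictates the size of \<open>riesz_step\<close>.

  On an arc, boundedness is known only near one point, while the correlation is a global quantity.
  The localization errors grow with the sum B of the absolute values of the coefficients; they must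
  be at most a fixed fraction of \<open>riesz_gain * B\<close>, with the point near the arc and the
  late starting index chosen independently of the length of the product.\<close>

abbreviation circle_integral :: "(complex \<Rightarrow> 'a::{banach, second_countable_topology}) \<Rightarrow> 'a"
    (binder "\<integral>\<^sub>C" 10) where
  "circle_integral g \<equiv> integral\<^sup>L circle_measure g"

lemma sets_circle_measure: "sets circle_measure = sets (restrict_space borel unit_circle)"
  by (simp add: circle_measure_def)

lemma finite_circle_measure: "finite_measure circle_measure"
  by (rule finite_measureI)
    (simp add: space_circle_measure emeasure_circle_measure_space)

interpretation circle: finite_measure circle_measure
  by (rule finite_circle_measure)

lemma measure_circle_measure [simp]:
  "measure circle_measure unit_circle = 1" "measure circle_measure (space circle_measure) = 1"
  by (simp_all add: measure_def emeasure_circle_measure_space space_circle_measure)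

lemma measurable_circle_cong:
  "measurable circle_measure N = measurable (restrict_space borel unit_circle) N"
  by (rule measurable_cong_sets) (simp_all add: sets_circle_measure)

lemma borel_measurable_circleI [measurable (raw)]:
  "g \<in> borel_measurable borel \<Longrightarrow> g \<in> borel_measurable circle_measure"
  unfolding measurable_circle_cong by (rule measurable_restrict_space1)

lemma borel_measurable_circle_continuous:
  fixes g :: "complex \<Rightarrow> 'b::{second_countable_topology, metric_space}"
  assumes "continuous_on unit_circle g"
  shows "g \<in> borel_measurable circle_measure"
  unfolding measurable_circle_cong
  by (rule borel_measurable_continuous_on_restrict[OF assms])

lemma AE_circleI: "(\<And>\<xi>. norm \<xi> = 1 \<Longrightarrow> Q \<xi>) \<Longrightarrow> AE \<xi> in circle_measure. Q \<xi>"
  by (rule AE_I2) (simp add: space_circle_measure)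

lemma circle_integral_cong:
  "(\<And>\<xi>. norm \<xi> = 1 \<Longrightarrow> g \<xi> = h \<xi>) \<Longrightarrow> integral\<^sup>L circle_measure g = integral\<^sup>L circle_measure h"
  by (rule Bochner_Integration.integral_cong) (simp_all add: space_circle_measure)

lemma circle_integral_mono:
  fixes g h :: "complex \<Rightarrow> real"
  assumes "integrable circle_measure g" "integrable circle_measure h"
    and "\<And>\<xi>. norm \<xi> = 1 \<Longrightarrow> g \<xi> \<le> h \<xi>"
  shows "integral\<^sup>L circle_measure g \<le> integral\<^sup>L circle_measure h"
  by (rule integral_mono) (use assms in \<open>auto simp: space_circle_measure\<close>)

lemma circle_nn_integral_cong:
  "(\<And>\<xi>. norm \<xi> = 1 \<Longrightarrow> g \<xi> = h \<xi>) \<Longrightarrow> integral\<^sup>N circle_measure g = integral\<^sup>N circle_measure h"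
  by (rule nn_integral_cong) (simp add: space_circle_measure)

lemma circle_nn_integral_mono:
  "(\<And>\<xi>. norm \<xi> = 1 \<Longrightarrow> g \<xi> \<le> h \<xi>) \<Longrightarrow> integral\<^sup>N circle_measure g \<le> integral\<^sup>N circle_measure h"
  by (rule nn_integral_mono) (simp add: space_circle_measure)

lemma AE_norm_circle: "AE \<xi> in circle_measure. norm \<xi> = 1"
  by (rule AE_circleI)

lemma circle_cnj: "norm \<xi> = 1 \<Longrightarrow> \<xi> * cnj \<xi> = 1"
  by (simp add: complex_norm_square[symmetric])

lemma circle_integrable_bound:
  fixes g :: "complex \<Rightarrow> 'b::{second_countable_topology, banach}"
  assumes "g \<in> borel_measurable circle_measure"
    and "\<And>\<xi>. norm \<xi> = 1 \<Longrightarrow> norm (g \<xi>) \<le> B"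
  shows "integrable circle_measure g"
  by (rule circle.integrable_const_bound[where B = B])
    (use assms in \<open>auto simp: space_circle_measure\<close>)

lemma integral_circle_const [simp]:
  fixes c :: "'b::{second_countable_topology, banach}"
  shows "(\<integral>\<^sub>C \<xi>. c) = c"
  by (simp add: space_circle_measure)

lemma AE_circle_iff:
  assumes [measurable]: "Measurable.pred circle_measure P"
  shows "(AE \<xi> in circle_measure. P \<xi>) \<longleftrightarrow> (AE t in lborel. t \<in> {0..<2 * pi} \<longrightarrow> P (cis t))"
proof -
  have "{\<xi> \<in> space circle_measure. P \<xi>} \<in> sets circle_measure" by measurable
  then have 1: "{\<xi> \<in> space (restrict_space borel unit_circle). P \<xi>} \<in> sets (restrict_space borel unit_circle)"
    by (simp add: space_circle_measure sets_circle_measure space_restrict_space)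
  have "(AE \<xi> in circle_measure. P \<xi>) \<longleftrightarrow> (AE t in uniform_measure lborel {0..<2 * pi}. P (cis t))"
    unfolding circle_measure_def
    by (rule AE_distr_iff[OF cis_measurable_circle 1])
  also have "\<dots> \<longleftrightarrow> (AE t in lborel. t \<in> {0..<2 * pi} \<longrightarrow> P (cis t))"
    by (rule AE_uniform_measure) (auto)
  finally show ?thesis .
qed

lemma integral_circle:
  fixes g :: "complex \<Rightarrow> 'b::{second_countable_topology, banach}"
  assumes [measurable]: "g \<in> borel_measurable circle_measure"
  shows "(\<integral>\<^sub>C \<xi>. g \<xi>) = (LINT t:{0..<2 * pi}|lborel. g (cis t)) /\<^sub>R (2 * pi)"
    and "integrable circle_measure g \<longleftrightarrow> set_integrable lborel {0..<2 * pi} (\<lambda>t. g (cis t))"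
proof -
  have g: "g \<in> borel_measurable (restrict_space borel unit_circle)"
    using assms by (simp add: measurable_circle_cong)
  have m: "(\<lambda>t. g (cis t)) \<in> borel_measurable lborel"
    using measurable_compose[OF cis_measurable_circle g] by simp
  have u: "uniform_measure lborel {0..<2 * pi} =
      density lborel (\<lambda>t. ennreal (indicator {0..<2 * pi} t / (2 * pi)))"
    unfolding uniform_measure_def
    by (intro density_cong) (auto simp: indicator_def divide_ennreal ennreal_1[symmetric] simp del: ennreal_1)
  have "(\<integral>\<^sub>C \<xi>. g \<xi>) = (\<integral>t. g (cis t) \<partial>uniform_measure lborel {0..<2 * pi})"
    unfolding circle_measure_def by (rule integral_distr[OF cis_measurable_circle g])
  also have "\<dots> = (\<integral>t. (indicator {0..<2 * pi} t / (2 * pi)) *\<^sub>R g (cis t) \<partial>lborel)"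
    unfolding u by (rule integral_density) (use m in auto)
  also have "\<dots> = (\<integral>t. inverse (2 * pi) *\<^sub>R (indicator {0..<2 * pi} t *\<^sub>R g (cis t)) \<partial>lborel)"
    by (simp add: field_simps)
  also have "\<dots> = (LINT t:{0..<2 * pi}|lborel. g (cis t)) /\<^sub>R (2 * pi)"
    unfolding set_lebesgue_integral_def by (rule integral_scaleR_right)
  finally show "(\<integral>\<^sub>C \<xi>. g \<xi>) = (LINT t:{0..<2 * pi}|lborel. g (cis t)) /\<^sub>R (2 * pi)" .
  have "integrable circle_measure g \<longleftrightarrow> integrable (uniform_measure lborel {0..<2 * pi}) (\<lambda>t. g (cis t))"
    unfolding circle_measure_def by (rule integrable_distr_eq[OF cis_measurable_circle g])
  also have "\<dots> \<longleftrightarrow> integrable lborel (\<lambda>t. (indicator {0..<2 * pi} t / (2 * pi)) *\<^sub>R g (cis t))"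
    unfolding u by (rule integrable_density) (use m in auto)
  also have "\<dots> \<longleftrightarrow> integrable lborel (\<lambda>t. inverse (2 * pi) *\<^sub>R (indicator {0..<2 * pi} t *\<^sub>R g (cis t)))"
    by (simp add: field_simps)
  also have "\<dots> \<longleftrightarrow> set_integrable lborel {0..<2 * pi} (\<lambda>t. g (cis t))"
    unfolding set_integrable_def
    using integrable_scaleR_right[of "2 * pi" lborel "\<lambda>t. inverse (2 * pi) *\<^sub>R (indicator {0..<2 * pi} t *\<^sub>R g (cis t))"]
      integrable_scaleR_right[of "inverse (2 * pi)" lborel "\<lambda>t. indicator {0..<2 * pi} t *\<^sub>R g (cis t)"]
    by (auto simp: mult.assoc[symmetric])
  finally show "integrable circle_measure g \<longleftrightarrow> set_integrable lborel {0..<2 * pi} (\<lambda>t. g (cis t))" .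
qed

section \<open>Orthogonality of the powers on the circle\<close>

lemma integral_circle_power:
  "(\<integral>\<^sub>C \<xi>. \<xi> ^ n) = (if n = 0 then 1 else 0)"
proof (cases "n = 0")
  case False
  have "((\<lambda>t. cis t ^ n) has_integral
      cis (real n * (2 * pi)) / (\<i> * of_nat n) - cis (real n * 0) / (\<i> * of_nat n)) {0..2 * pi}"
  proof (rule fundamental_theorem_of_calculus)
    fix t :: real
    have "((\<lambda>t. exp (\<i> * of_nat n * of_real t) / (\<i> * of_nat n)) has_vector_derivative
        exp (\<i> * of_nat n * of_real t)) (at t within {0..2 * pi})"
      using False by (auto intro!: derivative_eq_intros has_vector_derivative_real_field simp: field_simps)
    then show "((\<lambda>t. cis (real n * t) / (\<i> * of_nat n)) has_vector_derivative cis t ^ n) (at t within {0..2 * pi})"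
      by (simp add: cis_conv_exp exp_of_nat_mult[symmetric] mult_ac)
  qed auto
  moreover have "cis (real n * (2 * pi)) = 1"
    using cis_multiple_2pi[of "real n"] by (simp add: mult_ac)
  ultimately have 1: "((\<lambda>t. cis t ^ n) has_integral 0) {0..2 * pi}" by simp
  have si: "set_integrable lborel {0..2 * pi} (\<lambda>t. cis t ^ n)"
    unfolding set_integrable_def
    by (rule borel_integrable_compact) (auto intro!: continuous_intros)
  \<comment> \<open>The circle is parametrized by a half-open interval, the fundamental theorem of
    calculus needs a closed one; the endpoint is a null set.\<close>
  have "(LINT t:{0..<2 * pi}|lborel. cis t ^ n) = (LINT t:{0..2 * pi}|lborel. cis t ^ n)"
    unfolding set_lebesgue_integral_def
  proof (rule integral_cong_AE)
    have "AE t in lborel. t \<noteq> 2 * pi" by (rule AE_lborel_singleton)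
    then show "AE t in lborel. indicat_real {0..<2 * pi} t *\<^sub>R cis t ^ n = indicat_real {0..2 * pi} t *\<^sub>R cis t ^ n"
      by eventually_elim (auto simp: indicator_def)
    have [measurable]: "cis \<in> borel_measurable borel"
      by (intro borel_measurable_continuous_onI continuous_intros)
    show "(\<lambda>t. indicat_real {0..<2 * pi} t *\<^sub>R cis t ^ n) \<in> borel_measurable lborel"
      "(\<lambda>t. indicat_real {0..2 * pi} t *\<^sub>R cis t ^ n) \<in> borel_measurable lborel"
      by measurable
  qed
  also have "\<dots> = integral {0..2 * pi} (\<lambda>t. cis t ^ n)"
    by (rule set_borel_integral_eq_integral(2)[OF si])
  also have "\<dots> = 0" using 1 by blast
  finally show ?thesis using False
    by (subst integral_circle) (auto intro!: borel_measurable_circle_continuous continuous_intros)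
qed simp

lemma circle_power_cnj:
  assumes "norm \<xi> = 1"
  shows "m \<le> n \<Longrightarrow> \<xi> ^ m * cnj \<xi> ^ n = cnj (\<xi> ^ (n - m))"
    and "n \<le> m \<Longrightarrow> \<xi> ^ m * cnj \<xi> ^ n = \<xi> ^ (m - n)"
proof -
  have 1: "\<xi> ^ k * cnj \<xi> ^ k = 1" for k
    using circle_cnj[OF assms] by (metis power_mult_distrib power_one)
  show "\<xi> ^ m * cnj \<xi> ^ n = cnj (\<xi> ^ (n - m))" if "m \<le> n"
  proof -
    have "cnj \<xi> ^ n = cnj \<xi> ^ m * cnj \<xi> ^ (n - m)" using that by (simp add: power_add[symmetric])
    then show ?thesis using 1[of m] by (simp add: mult.assoc[symmetric])
  qed
  show "\<xi> ^ m * cnj \<xi> ^ n = \<xi> ^ (m - n)" if "n \<le> m"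
  proof -
    have "\<xi> ^ m = \<xi> ^ (m - n) * \<xi> ^ n" using that by (simp add: power_add[symmetric])
    then show ?thesis using 1[of n] by (simp add: mult.assoc)
  qed
qed

lemma integral_circle_power_cnj:
  "(\<integral>\<^sub>C \<xi>. \<xi> ^ m * cnj \<xi> ^ n) = (if m = n then 1 else 0)"
proof (cases m n rule: linorder_le_cases)
  case le
  have "(\<integral>\<^sub>C \<xi>. \<xi> ^ m * cnj \<xi> ^ n) = (\<integral>\<^sub>C \<xi>. cnj (\<xi> ^ (n - m)))"
    by (rule circle_integral_cong) (rule circle_power_cnj(1)[OF _ le])
  also have "\<dots> = cnj (\<integral>\<^sub>C \<xi>. \<xi> ^ (n - m))" by (rule Bochner_Integration.integral_cnj)
  finally show ?thesis using le by (auto simp: integral_circle_power)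
next
  case ge
  have "(\<integral>\<^sub>C \<xi>. \<xi> ^ m * cnj \<xi> ^ n) = (\<integral>\<^sub>C \<xi>. \<xi> ^ (m - n))"
    by (rule circle_integral_cong) (rule circle_power_cnj(2)[OF _ ge])
  then show ?thesis using ge by (auto simp: integral_circle_power)
qed

subsection \<open>The Poisson kernel\<close>

lemma poisson_kernel_nonneg:
  assumes "norm z < 1" shows "0 \<le> poisson_kernel z \<xi>"
proof -
  have "(norm z)\<^sup>2 \<le> 1" using assms by (simp add: power_le_one)
  then show ?thesis by (simp add: poisson_kernel_def)
qed

lemma poisson_kernel_0 [simp]: "norm \<xi> = 1 \<Longrightarrow> poisson_kernel 0 \<xi> = 1"
  by (simp add: poisson_kernel_def)

lemma poisson_kernel_upper:
  assumes "norm z < 1" "0 < d" "d \<le> norm (\<xi> - z)"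
  shows "poisson_kernel z \<xi> \<le> 2 * (1 - norm z) / d\<^sup>2"
proof -
  have "1 - (norm z)\<^sup>2 = (1 + norm z) * (1 - norm z)" by (simp add: power2_eq_square algebra_simps)
  also have "\<dots> \<le> 2 * (1 - norm z)" using assms by (intro mult_right_mono) auto
  finally show ?thesis unfolding poisson_kernel_def
    using assms by (intro frac_le) (auto intro!: power_mono)
qed

text \<open>Harnack's bounds, here and in \<open>poisson_kernel_ge\<close>: on the circle
  \<open>norm (\<xi> - z)\<close> lies between \<open>1 - norm z\<close> and
  \<open>1 + norm z\<close>, and one factor of \<open>1 - (norm z)\<^sup>2\<close> cancels.\<close>

lemma poisson_kernel_le:
  assumes "norm z < 1" "norm \<xi> = 1"
  shows "poisson_kernel z \<xi> \<le> (1 + norm z) / (1 - norm z)"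
proof -
  have d: "1 - norm z \<le> norm (\<xi> - z)" using norm_triangle_ineq2[of \<xi> z] assms by simp
  have "poisson_kernel z \<xi> \<le> (1 - (norm z)\<^sup>2) / (1 - norm z)\<^sup>2"
    unfolding poisson_kernel_def using assms d
    by (intro divide_left_mono power_mono mult_pos_pos zero_less_power) (auto simp: power_le_one abs_square_le_1)
  also have "\<dots> = (1 + norm z) / (1 - norm z)"
    using assms by (simp add: power2_eq_square divide_simps) (simp add: algebra_simps)
  finally show ?thesis .
qed

lemma poisson_kernel_ge:
  assumes "norm z < 1" "norm \<xi> = 1"
  shows "(1 - norm z) / (1 + norm z) \<le> poisson_kernel z \<xi>"
proof -
  have d: "norm (\<xi> - z) \<le> 1 + norm z" using norm_triangle_ineq4[of \<xi> z] assms by simp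
  have p: "0 < norm (\<xi> - z)" using assms by auto
  have "(1 - norm z) / (1 + norm z) = (1 - (norm z)\<^sup>2) / (1 + norm z)\<^sup>2"
    using assms by (simp add: power2_eq_square divide_simps add_pos_nonneg) (simp add: algebra_simps)
  also have "\<dots> \<le> poisson_kernel z \<xi>"
    unfolding poisson_kernel_def using assms d p
    by (intro divide_left_mono power_mono mult_pos_pos zero_less_power) (auto simp: power_le_one abs_square_le_1 add_pos_nonneg)
  finally show ?thesis .
qed

lemma poisson_kernel_measurable [measurable]:
  "poisson_kernel z \<in> borel_measurable circle_measure"
  unfolding poisson_kernel_def by (rule borel_measurable_circleI) measurable

lemma poisson_kernel_abs_le:
  assumes "norm z < 1" "norm \<xi> = 1"
  shows "\<bar>poisson_kernel z \<xi>\<bar> \<le> 2 / (1 - norm z)"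
proof -
  have "poisson_kernel z \<xi> \<le> (1 + norm z) / (1 - norm z)" by (rule poisson_kernel_le[OF assms])
  also have "\<dots> \<le> 2 / (1 - norm z)" using assms by (intro divide_right_mono) auto
  finally show ?thesis using poisson_kernel_nonneg[OF assms(1), of \<xi>] by simp
qed

text \<open>The summands are geometric series, in the nonnegative powers of
  \<open>z * cnj \<xi>\<close> and the positive powers of \<open>cnj z * \<xi>\<close>, so that
  integrals against the kernel can be computed term by term.\<close>

lemma poisson_kernel_decompose:
  assumes "norm z < 1" "norm \<xi> = 1"
  shows "complex_of_real (poisson_kernel z \<xi>) = 1 / (1 - z * cnj \<xi>) + cnj z * \<xi> / (1 - cnj z * \<xi>)"
proof -
  have x: "\<xi> * cnj \<xi> = 1" using assms by (simp add: circle_cnj)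
  have n1: "1 - z * cnj \<xi> \<noteq> 0"
  proof
    assume "1 - z * cnj \<xi> = 0"
    then have "norm (z * cnj \<xi>) = 1" by simp
    then show False using assms by (simp add: norm_mult)
  qed
  have n2: "1 - cnj z * \<xi> \<noteq> 0"
  proof
    assume "1 - cnj z * \<xi> = 0"
    then have "norm (cnj z * \<xi>) = 1" by simp
    then show False using assms by (simp add: norm_mult)
  qed
  have "complex_of_real (poisson_kernel z \<xi>) = (1 - z * cnj z) / ((\<xi> - z) * cnj (\<xi> - z))"
    unfolding poisson_kernel_def of_real_divide of_real_diff of_real_1 complex_norm_square ..
  also have "(\<xi> - z) * cnj (\<xi> - z) = (1 - z * cnj \<xi>) * (1 - cnj z * \<xi>)"
    using x by (simp add: algebra_simps)
  also have "(1 - z * cnj z) / \<dots> = 1 / (1 - z * cnj \<xi>) + cnj z * \<xi> / (1 - cnj z * \<xi>)"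
  proof -
    have "1 - z * cnj z = (1 - cnj z * \<xi>) + cnj z * \<xi> * (1 - z * cnj \<xi>)"
      using x by (simp add: algebra_simps)
    then show ?thesis using n1 n2 by (simp add: divide_simps)
  qed
  finally show ?thesis .
qed

text \<open>Of the two geometric series of the kernel only the term
  \<open>z ^ n * cnj \<xi> ^ n\<close> is not orthogonal to \<open>\<xi> ^ n\<close>; here
  \<open>F k\<close> collects the \<open>k\<close>-th terms of both, multiplied by
  \<open>\<xi> ^ n\<close>.\<close>

lemma integral_power_poisson:
  assumes z: "norm z < 1"
  shows "(\<integral>\<^sub>C \<xi>. poisson_kernel z \<xi> *\<^sub>R \<xi> ^ n) = z ^ n"
proof -
  define F where "F k \<xi> = z ^ k * (\<xi> ^ n * cnj \<xi> ^ k) + cnj z ^ Suc k * \<xi> ^ (Suc k + n)" for k \<xi>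
  have sm: "F k \<in> borel_measurable circle_measure" for k
    unfolding F_def by (intro borel_measurable_circle_continuous continuous_intros)
  have nF: "norm (F k \<xi>) \<le> 2 * norm z ^ k" if "norm \<xi> = 1" for k \<xi>
  proof -
    have "norm (F k \<xi>) \<le> norm z ^ k + norm z ^ Suc k"
      unfolding F_def by (rule norm_triangle_le) (simp add: norm_mult norm_power that)
    also have "\<dots> \<le> 2 * norm z ^ k" using z mult_right_mono[of "norm z" 1 "norm z ^ k"] by simp
    finally show ?thesis .
  qed
  have int: "integrable circle_measure (F k)" for k
    by (rule circle_integrable_bound[OF sm nF])
  have summ: "summable (\<lambda>k. 2 * norm z ^ k)" using z by (intro summable_mult summable_geometric) simp
  have "(\<lambda>k. \<integral>\<^sub>C \<xi>. F k \<xi>) sums (\<integral>\<^sub>C \<xi>. (\<Sum>k. F k \<xi>))"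
  proof (rule sums_integral[OF int])
    show "AE \<xi> in circle_measure. summable (\<lambda>k. norm (F k \<xi>))"
      by (intro AE_circleI summable_comparison_test'[OF summ]) (use nF in \<open>auto simp: space_circle_measure\<close>)
    show "summable (\<lambda>k. \<integral>\<^sub>C \<xi>. norm (F k \<xi>))"
    proof (rule summable_comparison_test'[OF summ])
      fix k
      have "(\<integral>\<^sub>C \<xi>. norm (F k \<xi>)) \<le> (\<integral>\<^sub>C \<xi>. 2 * norm z ^ k)"
        by (rule circle_integral_mono) (use int nF in \<open>auto simp: space_circle_measure\<close>)
      then show "norm (\<integral>\<^sub>C \<xi>. norm (F k \<xi>)) \<le> 2 * norm z ^ k" by simp
    qed
  qed
  moreover have "(\<integral>\<^sub>C \<xi>. F k \<xi>) = (if k = n then z ^ n else 0)" for k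
  proof -
    have "(\<integral>\<^sub>C \<xi>. F k \<xi>) =
        (\<integral>\<^sub>C \<xi>. z ^ k * (\<xi> ^ n * cnj \<xi> ^ k)) + (\<integral>\<^sub>C \<xi>. cnj z ^ Suc k * \<xi> ^ (Suc k + n))"
      unfolding F_def
      by (rule Bochner_Integration.integral_add)
        (intro circle_integrable_bound[where B = "norm z ^ k"] borel_measurable_circle_continuous continuous_intros,
          simp add: norm_mult norm_power,
         intro circle_integrable_bound[where B = "norm z ^ Suc k"] borel_measurable_circle_continuous continuous_intros,
          simp add: norm_mult norm_power)
    also have "\<dots> = z ^ k * (\<integral>\<^sub>C \<xi>. \<xi> ^ n * cnj \<xi> ^ k) + cnj z ^ Suc k * (\<integral>\<^sub>C \<xi>. \<xi> ^ (Suc k + n))"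
      by (simp del: power_Suc add_Suc)
    finally show ?thesis
      by (simp only: integral_circle_power_cnj integral_circle_power) auto
  qed
  ultimately have "(\<lambda>k. if k = n then z ^ n else 0) sums (\<integral>\<^sub>C \<xi>. (\<Sum>k. F k \<xi>))"
    by (simp only:)
  moreover have "(\<lambda>k. if k = n then z ^ n else 0) sums z ^ n"
    by (rule sums_single)
  ultimately have "(\<integral>\<^sub>C \<xi>. (\<Sum>k. F k \<xi>)) = z ^ n"
    using sums_unique2 by blast
  moreover have "(\<integral>\<^sub>C \<xi>. (\<Sum>k. F k \<xi>)) = (\<integral>\<^sub>C \<xi>. poisson_kernel z \<xi> *\<^sub>R \<xi> ^ n)"
  proof (rule circle_integral_cong)
    fix \<xi> :: complex assume x: "norm \<xi> = 1"
    have "(\<lambda>k. (z * cnj \<xi>) ^ k) sums (1 / (1 - z * cnj \<xi>))"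
      by (rule geometric_sums) (use x z in \<open>simp add: norm_mult\<close>)
    moreover have "(\<lambda>k. (cnj z * \<xi>) ^ k) sums (1 / (1 - cnj z * \<xi>))"
      by (rule geometric_sums) (use x z in \<open>simp add: norm_mult\<close>)
    ultimately have "(\<lambda>k. \<xi> ^ n * (z * cnj \<xi>) ^ k + \<xi> ^ n * (cnj z * \<xi>) * (cnj z * \<xi>) ^ k) sums
        (\<xi> ^ n * (1 / (1 - z * cnj \<xi>)) + \<xi> ^ n * (cnj z * \<xi>) * (1 / (1 - cnj z * \<xi>)))"
      by (intro sums_add sums_mult)
    moreover have "(\<lambda>k. \<xi> ^ n * (z * cnj \<xi>) ^ k + \<xi> ^ n * (cnj z * \<xi>) * (cnj z * \<xi>) ^ k) = (\<lambda>k. F k \<xi>)"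
      by (auto simp: F_def power_mult_distrib power_add mult_ac)
    moreover have "\<xi> ^ n * (1 / (1 - z * cnj \<xi>)) + \<xi> ^ n * (cnj z * \<xi>) * (1 / (1 - cnj z * \<xi>)) =
        poisson_kernel z \<xi> *\<^sub>R \<xi> ^ n"
      unfolding scaleR_conv_of_real poisson_kernel_decompose[OF z x] by (simp add: algebra_simps)
    ultimately show "(\<Sum>k. F k \<xi>) = poisson_kernel z \<xi> *\<^sub>R \<xi> ^ n"
      by (metis sums_unique)
  qed
  ultimately show ?thesis by simp
qed

lemma integral_poisson_kernel:
  assumes "norm z < 1"
  shows "(\<integral>\<^sub>C \<xi>. poisson_kernel z \<xi>) = 1"
proof -
  have "complex_of_real (\<integral>\<^sub>C \<xi>. poisson_kernel z \<xi>) = 1"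
    using integral_power_poisson[OF assms, of 0] by (simp add: scaleR_conv_of_real)
  then show ?thesis using of_real_eq_1_iff by blast
qed

lemma integrable_poisson_mult:
  fixes g :: "complex \<Rightarrow> 'b::{second_countable_topology, banach}"
  assumes z: "norm z < 1" and g: "integrable circle_measure g"
  shows "integrable circle_measure (\<lambda>\<xi>. poisson_kernel z \<xi> *\<^sub>R g \<xi>)"
proof (rule Bochner_Integration.integrable_bound)
  show "integrable circle_measure (\<lambda>\<xi>. (2 / (1 - norm z)) *\<^sub>R g \<xi>)" using g by auto
  show "(\<lambda>\<xi>. poisson_kernel z \<xi> *\<^sub>R g \<xi>) \<in> borel_measurable circle_measure"
    using borel_measurable_integrable[OF g] by measurable
  show "AE \<xi> in circle_measure. norm (poisson_kernel z \<xi> *\<^sub>R g \<xi>) \<le> norm ((2 / (1 - norm z)) *\<^sub>R g \<xi>)"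
  proof (rule AE_circleI)
    fix \<xi> :: complex assume "norm \<xi> = 1"
    then have "\<bar>poisson_kernel z \<xi>\<bar> \<le> 2 / (1 - norm z)"
      by (intro poisson_kernel_abs_le[OF z]) (simp add: space_circle_measure)
    also have "\<dots> = \<bar>2 / (1 - norm z)\<bar>" using z by simp
    finally show "norm (poisson_kernel z \<xi> *\<^sub>R g \<xi>) \<le> norm ((2 / (1 - norm z)) *\<^sub>R g \<xi>)"
      unfolding norm_scaleR by (intro mult_right_mono) auto
  qed
qed

lemma integrable_poisson_kernel: "norm z < 1 \<Longrightarrow> integrable circle_measure (poisson_kernel z)"
  using integrable_poisson_mult[of z "\<lambda>_. 1::real"] by simp

section \<open>Poisson representation of bounded holomorphic functions\<close>

lemma poisson_holomorphic_dilation: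
  assumes h: "h holomorphic_on unit_disc" and r: "0 \<le> r" "r < 1" and z: "norm z < 1"
  shows "(\<integral>\<^sub>C \<xi>. poisson_kernel z \<xi> *\<^sub>R h (of_real r * \<xi>)) = h (of_real r * z)"
proof -
  define c where "c n = (deriv ^^ n) h 0 / fact n" for n
  have ps: "(\<lambda>n. c n * w ^ n) sums h w" if "norm w < 1" for w
    using holomorphic_power_series[OF h, of w] that by (simp add: c_def)
  \<comment> \<open>Convergence at the larger radius \<open>s\<close> turns into absolute
    convergence at \<open>r\<close>, which justifies integrating the power series term by
    term.\<close>
  obtain s where s: "r < s" "s < 1" using r dense by blast
  have "summable (\<lambda>n. c n * of_real s ^ n)" using ps[of "of_real s"] s r by (auto simp: sums_iff)
  from powser_insidea[OF this, of "of_real r"]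
  have summ: "summable (\<lambda>n. norm (c n) * r ^ n)" using s r by (simp add: norm_mult norm_power)
  define F where "F n \<xi> = poisson_kernel z \<xi> *\<^sub>R (c n * (of_real r * \<xi>) ^ n)" for n \<xi>
  let ?K = "2 / (1 - norm z)"
  have nF: "norm (F n \<xi>) \<le> ?K * (norm (c n) * r ^ n)" if "norm \<xi> = 1" for n \<xi>
  proof -
    have "norm (c n * (of_real r * \<xi>) ^ n) = norm (c n) * r ^ n"
      using r that by (simp add: norm_mult norm_power)
    then show ?thesis unfolding F_def norm_scaleR
      using poisson_kernel_abs_le[OF z that] r z by (intro mult_mono) auto
  qed
  have sm: "F n \<in> borel_measurable circle_measure" for n
    unfolding F_def
    by (intro borel_measurable_scaleR poisson_kernel_measurable borel_measurable_circle_continuous continuous_intros)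
  have int: "integrable circle_measure (F n)" for n
    by (rule circle_integrable_bound[OF sm nF])
  have summ': "summable (\<lambda>n. ?K * (norm (c n) * r ^ n))" by (rule summable_mult[OF summ])
  have "(\<lambda>n. \<integral>\<^sub>C \<xi>. F n \<xi>) sums (\<integral>\<^sub>C \<xi>. (\<Sum>n. F n \<xi>))"
  proof (rule sums_integral[OF int])
    show "AE \<xi> in circle_measure. summable (\<lambda>k. norm (F k \<xi>))"
      by (intro AE_circleI summable_comparison_test'[OF summ']) (use nF in \<open>auto simp: space_circle_measure\<close>)
    show "summable (\<lambda>k. \<integral>\<^sub>C \<xi>. norm (F k \<xi>))"
    proof (rule summable_comparison_test'[OF summ'])
      fix k
      have "(\<integral>\<^sub>C \<xi>. norm (F k \<xi>)) \<le> (\<integral>\<^sub>C \<xi>. ?K * (norm (c k) * r ^ k))"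
        by (rule circle_integral_mono) (use int nF in \<open>auto simp: space_circle_measure simp del: integral_circle_const\<close>)
      then show "norm (\<integral>\<^sub>C \<xi>. norm (F k \<xi>)) \<le> ?K * (norm (c k) * r ^ k)"
        by simp
    qed
  qed
  moreover have "(\<integral>\<^sub>C \<xi>. F n \<xi>) = c n * (of_real r * z) ^ n" for n
  proof -
    have "(\<integral>\<^sub>C \<xi>. F n \<xi>) = (\<integral>\<^sub>C \<xi>. (c n * of_real r ^ n) * (poisson_kernel z \<xi> *\<^sub>R \<xi> ^ n))"
      by (simp add: F_def power_mult_distrib mult_ac)
    also have "\<dots> = c n * of_real r ^ n * z ^ n"
      by (subst integral_mult_right_zero) (simp only: integral_power_poisson[OF z])
    finally show ?thesis by (simp add: power_mult_distrib mult_ac)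
  qed
  moreover have "(\<lambda>n. c n * (of_real r * z) ^ n) sums h (of_real r * z)"
  proof (rule ps)
    have "r * norm z \<le> 1 * norm z" using r by (intro mult_right_mono) auto
    then show "norm (of_real r * z) < 1" using z r by (simp add: norm_mult)
  qed
  moreover have "(\<integral>\<^sub>C \<xi>. (\<Sum>n. F n \<xi>)) = (\<integral>\<^sub>C \<xi>. poisson_kernel z \<xi> *\<^sub>R h (of_real r * \<xi>))"
  proof (rule circle_integral_cong)
    fix \<xi> :: complex assume "norm \<xi> = 1"
    then have "norm (of_real r * \<xi>) < 1" using r by (simp add: space_circle_measure norm_mult)
    from sums_scaleR_right[OF ps[OF this], of "poisson_kernel z \<xi>"]
    show "(\<Sum>n. F n \<xi>) = poisson_kernel z \<xi> *\<^sub>R h (of_real r * \<xi>)"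
      unfolding F_def by (simp add: sums_iff)
  qed
  ultimately show ?thesis using sums_unique2 by fastforce
qed

text \<open>A sequence of radii: limits along it are measurable in the boundary point and open to
  dominated convergence.\<close>

definition radius_seq :: "nat \<Rightarrow> real" where "radius_seq k = 1 - 1 / real (k + 2)"

lemma radius_seq: "0 \<le> radius_seq k" "radius_seq k < 1"
  by (auto simp: radius_seq_def field_simps)

lemma radius_seq_tendsto: "filterlim radius_seq (at_left 1) sequentially"
proof -
  have "(\<lambda>k. 1 - 1 / real (k + 2)) \<longlonglongrightarrow> 1 - 0"
    by (intro tendsto_intros LIMSEQ_ignore_initial_segment[OF lim_1_over_n])
  then show ?thesis
    by (simp add: filterlim_at radius_seq_def[abs_def] field_simps)
qed

lemma has_radial_limit_seq:
  "has_radial_limit G \<xi> w \<Longrightarrow> (\<lambda>k. G (of_real (radius_seq k) * \<xi>)) \<longlonglongrightarrow> w"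
  unfolding has_radial_limit_def by (rule filterlim_compose[OF _ radius_seq_tendsto])

lemma measurable_dilation:
  assumes "h holomorphic_on unit_disc" "0 \<le> r" "r < 1"
  shows "(\<lambda>\<xi>. h (of_real r * \<xi>)) \<in> borel_measurable circle_measure"
proof (rule borel_measurable_circle_continuous)
  have "continuous_on unit_disc h" using assms holomorphic_on_imp_continuous_on by blast
  then show "continuous_on unit_circle (\<lambda>\<xi>. h (of_real r * \<xi>))"
    by (rule continuous_on_compose2) (use assms in \<open>auto intro!: continuous_intros simp: norm_mult\<close>)
qed

text \<open>The formula for dilations passes to the limit as the radius tends to 1: the integrands
  are dominated by \<open>B\<close> times the maximum of the kernel, and \<open>h\<close> is
  continuous at \<open>z\<close>.\<close>

lemma poisson_bounded_holomorphic:
  assumes h: "h holomorphic_on unit_disc" and B: "\<And>w. norm w < 1 \<Longrightarrow> norm (h w) \<le> B"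
    and hs: "hs \<in> borel_measurable circle_measure" "AE \<xi> in circle_measure. has_radial_limit h \<xi> (hs \<xi>)"
    and z: "norm z < 1"
  shows "(\<integral>\<^sub>C \<xi>. poisson_kernel z \<xi> *\<^sub>R hs \<xi>) = h z"
proof -
  let ?r = radius_seq
  have "(\<lambda>k. \<integral>\<^sub>C \<xi>. poisson_kernel z \<xi> *\<^sub>R h (of_real (?r k) * \<xi>))
      \<longlonglongrightarrow> (\<integral>\<^sub>C \<xi>. poisson_kernel z \<xi> *\<^sub>R hs \<xi>)"
  proof (rule integral_dominated_convergence[where w = "\<lambda>_. 2 / (1 - norm z) * B"])
    show "(\<lambda>\<xi>. poisson_kernel z \<xi> *\<^sub>R hs \<xi>) \<in> borel_measurable circle_measure"
      using hs(1) by measurable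
    show "(\<lambda>\<xi>. poisson_kernel z \<xi> *\<^sub>R h (of_real (?r k) * \<xi>)) \<in> borel_measurable circle_measure" for k
      using measurable_dilation[OF h radius_seq] by measurable
    show "AE \<xi> in circle_measure. (\<lambda>k. poisson_kernel z \<xi> *\<^sub>R h (of_real (?r k) * \<xi>)) \<longlonglongrightarrow> poisson_kernel z \<xi> *\<^sub>R hs \<xi>"
      using hs(2) by eventually_elim (intro tendsto_intros has_radial_limit_seq)
    show "AE \<xi> in circle_measure. norm (poisson_kernel z \<xi> *\<^sub>R h (of_real (?r k) * \<xi>)) \<le> 2 / (1 - norm z) * B" for k
    proof (rule AE_circleI)
      fix \<xi> :: complex assume x: "norm \<xi> = 1"
      have "norm (h (of_real (?r k) * \<xi>)) \<le> B" using radius_seq[of k] x by (intro B) (simp add: norm_mult)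
      then show "norm (poisson_kernel z \<xi> *\<^sub>R h (of_real (?r k) * \<xi>)) \<le> 2 / (1 - norm z) * B"
        unfolding norm_scaleR by (intro mult_mono poisson_kernel_abs_le[OF z x]) (use z in auto)
    qed
  qed simp
  moreover have "(\<lambda>k. \<integral>\<^sub>C \<xi>. poisson_kernel z \<xi> *\<^sub>R h (of_real (?r k) * \<xi>)) \<longlonglongrightarrow> h z"
  proof -
    have "(\<lambda>k. of_real (?r k) * z) \<longlonglongrightarrow> of_real 1 * z"
      using radius_seq_tendsto by (intro tendsto_intros) (simp add: filterlim_at)
    moreover have "isCont h z"
      using h z holomorphic_on_imp_continuous_on continuous_on_interior[of unit_disc h z]
      by (metis centre_in_ball dist_0_norm interior_ball mem_ball)
    ultimately have "(\<lambda>k. h (of_real (?r k) * z)) \<longlonglongrightarrow> h z"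
      by (intro isCont_tendsto_compose[of z h]) auto
    then show ?thesis using radius_seq by (simp add: poisson_holomorphic_dilation[OF h _ _ z])
  qed
  ultimately show ?thesis using LIMSEQ_unique by blast
qed

subsection \<open>Uniqueness of measures with given Fourier coefficients\<close>

text \<open>On the circle \<open>cnj \<xi>\<close> is the inverse of \<open>\<xi>\<close>, so these
  are the restrictions of Laurent polynomials, written over a common denominator.\<close>

definition laurent_on_circle :: "(complex \<Rightarrow> complex) \<Rightarrow> bool" where
  "laurent_on_circle p \<longleftrightarrow> (\<exists>n q. \<forall>\<xi>. norm \<xi> = 1 \<longrightarrow> p \<xi> = poly q \<xi> * cnj \<xi> ^ n)"

lemma laurent_on_circle_const: "laurent_on_circle (\<lambda>_. c)"
  unfolding laurent_on_circle_def by (rule exI[of _ 0], rule exI[of _ "[:c:]"]) simp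

lemma laurent_on_circle_id: "laurent_on_circle (\<lambda>\<xi>. \<xi>)"
  unfolding laurent_on_circle_def by (rule exI[of _ 0], rule exI[of _ "[:0, 1:]"]) simp

lemma laurent_on_circle_cnj: "laurent_on_circle cnj"
  unfolding laurent_on_circle_def by (rule exI[of _ 1], rule exI[of _ "[:1:]"]) simp

lemma laurent_on_circle_mult:
  assumes "laurent_on_circle p" "laurent_on_circle q"
  shows "laurent_on_circle (\<lambda>\<xi>. p \<xi> * q \<xi>)"
proof -
  obtain m A where A: "\<And>\<xi>. norm \<xi> = 1 \<Longrightarrow> p \<xi> = poly A \<xi> * cnj \<xi> ^ m"
    using assms(1) unfolding laurent_on_circle_def by blast
  obtain n B where B: "\<And>\<xi>. norm \<xi> = 1 \<Longrightarrow> q \<xi> = poly B \<xi> * cnj \<xi> ^ n"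
    using assms(2) unfolding laurent_on_circle_def by blast
  show ?thesis unfolding laurent_on_circle_def
    by (rule exI[of _ "m + n"], rule exI[of _ "A * B"]) (simp add: A B power_add)
qed

lemma laurent_on_circle_add:
  assumes "laurent_on_circle p" "laurent_on_circle q"
  shows "laurent_on_circle (\<lambda>\<xi>. p \<xi> + q \<xi>)"
proof -
  obtain m A where A: "\<And>\<xi>. norm \<xi> = 1 \<Longrightarrow> p \<xi> = poly A \<xi> * cnj \<xi> ^ m"
    using assms(1) unfolding laurent_on_circle_def by blast
  obtain n B where B: "\<And>\<xi>. norm \<xi> = 1 \<Longrightarrow> q \<xi> = poly B \<xi> * cnj \<xi> ^ n"
    using assms(2) unfolding laurent_on_circle_def by blast
  have "p \<xi> + q \<xi> = poly (A * monom 1 n + B * monom 1 m) \<xi> * cnj \<xi> ^ (m + n)" if x: "norm \<xi> = 1" for \<xi>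
  proof -
    have "\<xi> ^ k * cnj \<xi> ^ k = 1" for k
      using circle_cnj[OF x] by (metis power_mult_distrib power_one)
    note one = this
    have "poly (A * monom 1 n + B * monom 1 m) \<xi> * cnj \<xi> ^ (m + n) =
        poly A \<xi> * cnj \<xi> ^ m * (\<xi> ^ n * cnj \<xi> ^ n) + poly B \<xi> * cnj \<xi> ^ n * (\<xi> ^ m * cnj \<xi> ^ m)"
      by (simp add: poly_monom power_add algebra_simps)
    also have "\<dots> = poly A \<xi> * cnj \<xi> ^ m + poly B \<xi> * cnj \<xi> ^ n"
      unfolding one by simp
    finally have "poly (A * monom 1 n + B * monom 1 m) \<xi> * cnj \<xi> ^ (m + n) = poly A \<xi> * cnj \<xi> ^ m + poly B \<xi> * cnj \<xi> ^ n" .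
    then show ?thesis by (simp add: A[OF x] B[OF x])
  qed
  then show ?thesis unfolding laurent_on_circle_def by blast
qed

text \<open>Links the Weierstrass theorem, which speaks of real polynomials on the plane, to
  moments: a real linear functional is a combination of \<open>\<xi>\<close> and
  \<open>cnj \<xi>\<close>.\<close>

lemma laurent_on_circle_real_polynomial:
  assumes "real_polynomial_function p"
  shows "laurent_on_circle (\<lambda>\<xi>. complex_of_real (p \<xi>))"
  using assms
proof (induction rule: real_polynomial_function.induct)
  case (linear p)
  have "complex_of_real (p \<xi>) =
      (of_real (p 1) / 2 + of_real (p \<i>) / (2 * \<i>)) * \<xi> + (of_real (p 1) / 2 - of_real (p \<i>) / (2 * \<i>)) * cnj \<xi>"
    for \<xi>
  proof -
    interpret p: bounded_linear p by fact
    have "p \<xi> = p (Re \<xi> *\<^sub>R 1 + Im \<xi> *\<^sub>R \<i>)"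
      by (rule arg_cong[where f = p]) (simp add: complex_eq_iff)
    also have "\<dots> = Re \<xi> * p 1 + Im \<xi> * p \<i>" by (simp add: p.add p.scaleR)
    finally show ?thesis by (simp add: complex_eq_iff field_simps)
  qed
  then have eq: "(\<lambda>\<xi>. complex_of_real (p \<xi>)) = (\<lambda>\<xi>.
      (of_real (p 1) / 2 + of_real (p \<i>) / (2 * \<i>)) * \<xi> + (of_real (p 1) / 2 - of_real (p \<i>) / (2 * \<i>)) * cnj \<xi>)"
    by (rule ext)
  show ?case
    by (rule ssubst[OF eq]) (rule laurent_on_circle_add; rule laurent_on_circle_mult;
        rule laurent_on_circle_const laurent_on_circle_id laurent_on_circle_cnj)
next
  case (const c)
  show ?case by (rule laurent_on_circle_const)
next
  case (add p q)
  show ?case unfolding of_real_add by (rule laurent_on_circle_add) (rule add.IH)+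
next
  case (mult p q)
  show ?case unfolding of_real_mult by (rule laurent_on_circle_mult) (rule mult.IH)+
qed

text \<open>Comparing nonnegative powers is enough: the measures are positive, so the negative
  moments are the conjugates of the positive ones.\<close>

locale circle_measures_same_moments =
  M: finite_measure M + N: finite_measure N for M N :: "complex measure" +
  assumes sets_M: "sets M = sets circle_measure" and sets_N: "sets N = sets circle_measure"
    and moments: "\<And>n. (\<integral>\<xi>. \<xi> ^ n \<partial>M) = (\<integral>\<xi>. \<xi> ^ n \<partial>N)"
begin

lemma space_M: "space M = unit_circle" and space_N: "space N = unit_circle"
  using sets_eq_imp_space_eq[OF sets_M] sets_eq_imp_space_eq[OF sets_N] by (simp_all add: space_circle_measure)

lemma meas_M: "g \<in> borel_measurable circle_measure \<Longrightarrow> g \<in> borel_measurable M"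
  and meas_N: "g \<in> borel_measurable circle_measure \<Longrightarrow> g \<in> borel_measurable N"
  using measurable_cong_sets[OF sets_M refl] measurable_cong_sets[OF sets_N refl] by blast+

lemma cont_integrable:
  fixes g :: "complex \<Rightarrow> 'b::{second_countable_topology, banach}"
  assumes g: "continuous_on unit_circle g"
  shows "integrable M g" "integrable N g"
proof -
  have "compact (g ` unit_circle)" using g by (intro compact_continuous_image) auto
  then obtain B where "\<forall>w\<in>g ` unit_circle. norm w \<le> B"
    using compact_imp_bounded[of "g ` unit_circle"] unfolding bounded_iff by blast
  then have B: "\<And>\<xi>. norm \<xi> = 1 \<Longrightarrow> norm (g \<xi>) \<le> B" by simp
  have m: "g \<in> borel_measurable circle_measure"
    using g by (rule borel_measurable_circle_continuous)
  show "integrable M g"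
    by (rule M.integrable_const_bound[where B = B]) (use B meas_M[OF m] in \<open>auto simp: space_M\<close>)
  show "integrable N g"
    by (rule N.integrable_const_bound[where B = B]) (use B meas_N[OF m] in \<open>auto simp: space_N\<close>)
qed

lemma moments_mixed: "(\<integral>\<xi>. \<xi> ^ k * cnj \<xi> ^ n \<partial>M) = (\<integral>\<xi>. \<xi> ^ k * cnj \<xi> ^ n \<partial>N)"
proof (cases k n rule: linorder_le_cases)
  case le
  have "(\<integral>\<xi>. \<xi> ^ k * cnj \<xi> ^ n \<partial>M) = (\<integral>\<xi>. cnj (\<xi> ^ (n - k)) \<partial>M)"
    by (intro Bochner_Integration.integral_cong refl circle_power_cnj(1) le) (simp add: space_M)
  also have "\<dots> = (\<integral>\<xi>. cnj (\<xi> ^ (n - k)) \<partial>N)"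
    unfolding Bochner_Integration.integral_cnj moments ..
  also have "\<dots> = (\<integral>\<xi>. \<xi> ^ k * cnj \<xi> ^ n \<partial>N)"
    by (intro Bochner_Integration.integral_cong refl circle_power_cnj(1)[symmetric] le) (simp add: space_N)
  finally show ?thesis .
next
  case ge
  have "(\<integral>\<xi>. \<xi> ^ k * cnj \<xi> ^ n \<partial>M) = (\<integral>\<xi>. \<xi> ^ (k - n) \<partial>M)"
    by (intro Bochner_Integration.integral_cong refl circle_power_cnj(2) ge) (simp add: space_M)
  also have "\<dots> = (\<integral>\<xi>. \<xi> ^ (k - n) \<partial>N)"
    by (rule moments)
  also have "\<dots> = (\<integral>\<xi>. \<xi> ^ k * cnj \<xi> ^ n \<partial>N)"
    by (intro Bochner_Integration.integral_cong refl circle_power_cnj(2)[symmetric] ge) (simp add: space_N)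
  finally show ?thesis .
qed

lemma integral_laurent:
  assumes "laurent_on_circle p"
  shows "(\<integral>\<xi>. p \<xi> \<partial>M) = (\<integral>\<xi>. p \<xi> \<partial>N)"
proof -
  obtain n A where A: "\<And>\<xi>. norm \<xi> = 1 \<Longrightarrow> p \<xi> = poly A \<xi> * cnj \<xi> ^ n"
    using assms unfolding laurent_on_circle_def by blast
  have eq: "p \<xi> = (\<Sum>k\<le>degree A. coeff A k * (\<xi> ^ k * cnj \<xi> ^ n))" if "norm \<xi> = 1" for \<xi>
    unfolding A[OF that] poly_altdef sum_distrib_right by (simp add: mult.assoc)
  have int: "integrable M (\<lambda>\<xi>. coeff A k * (\<xi> ^ k * cnj \<xi> ^ n))"
    "integrable N (\<lambda>\<xi>. coeff A k * (\<xi> ^ k * cnj \<xi> ^ n))" for k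
    by (intro cont_integrable continuous_intros)+
  have "(\<integral>\<xi>. p \<xi> \<partial>M) = (\<integral>\<xi>. (\<Sum>k\<le>degree A. coeff A k * (\<xi> ^ k * cnj \<xi> ^ n)) \<partial>M)"
    by (intro Bochner_Integration.integral_cong refl eq) (simp add: space_M)
  also have "\<dots> = (\<integral>\<xi>. (\<Sum>k\<le>degree A. coeff A k * (\<xi> ^ k * cnj \<xi> ^ n)) \<partial>N)"
    using int by (simp add: moments_mixed)
  also have "\<dots> = (\<integral>\<xi>. p \<xi> \<partial>N)"
    by (intro Bochner_Integration.integral_cong refl eq[symmetric]) (simp add: space_N)
  finally show ?thesis .
qed

lemma integral_continuous:
  fixes g :: "complex \<Rightarrow> real"
  assumes g: "continuous_on unit_circle g"
  shows "(\<integral>\<xi>. g \<xi> \<partial>M) = (\<integral>\<xi>. g \<xi> \<partial>N)"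
proof (rule ccontr)
  assume ne: "(\<integral>\<xi>. g \<xi> \<partial>M) \<noteq> (\<integral>\<xi>. g \<xi> \<partial>N)"
  let ?m = "measure M (space M) + measure N (space N) + 1"
  let ?d = "\<bar>(\<integral>\<xi>. g \<xi> \<partial>M) - (\<integral>\<xi>. g \<xi> \<partial>N)\<bar>"
  have m: "?m > 0" using measure_nonneg[of M "space M"] measure_nonneg[of N "space N"] by linarith
  \<comment> \<open>Replacing \<open>g\<close> by the polynomial costs at most \<open>e\<close>
    times the two total masses. The summand 1 in \<open>?m\<close> makes this strictly less than
    \<open>?d\<close> and keeps the denominator positive.\<close>
  define e where "e = ?d / ?m"
  have e: "e > 0" using ne m by (simp add: e_def)
  obtain p where p: "real_polynomial_function p" "\<And>\<xi>. \<xi> \<in> unit_circle \<Longrightarrow> \<bar>g \<xi> - p \<xi>\<bar> < e"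
    using Stone_Weierstrass_real_polynomial_function[OF _ g e] by auto
  have cp: "continuous_on unit_circle p"
    using p(1) continuous_on_polymonial_function real_polynomial_function_eq by blast
  have "complex_of_real (\<integral>\<xi>. p \<xi> \<partial>M) = complex_of_real (\<integral>\<xi>. p \<xi> \<partial>N)"
    using integral_laurent[OF laurent_on_circle_real_polynomial[OF p(1)]] by simp
  then have pe: "(\<integral>\<xi>. p \<xi> \<partial>M) = (\<integral>\<xi>. p \<xi> \<partial>N)" by simp
  have b1: "\<bar>(\<integral>\<xi>. g \<xi> \<partial>M) - (\<integral>\<xi>. p \<xi> \<partial>M)\<bar> \<le> e * measure M (space M)"
  proof -
    have "\<bar>(\<integral>\<xi>. g \<xi> \<partial>M) - (\<integral>\<xi>. p \<xi> \<partial>M)\<bar> = \<bar>\<integral>\<xi>. g \<xi> - p \<xi> \<partial>M\<bar>"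
      by (subst Bochner_Integration.integral_diff) (auto intro: cont_integrable g cp)
    also have "\<dots> \<le> (\<integral>\<xi>. \<bar>g \<xi> - p \<xi>\<bar> \<partial>M)" by (rule integral_abs_bound)
    also have "\<dots> \<le> (\<integral>\<xi>. e \<partial>M)"
      by (rule integral_mono) (use p(2) in \<open>auto intro!: cont_integrable continuous_intros g cp less_imp_le simp: space_M simp del: mem_sphere_0\<close>)
    finally show ?thesis by (simp add: mult.commute)
  qed
  have b2: "\<bar>(\<integral>\<xi>. g \<xi> \<partial>N) - (\<integral>\<xi>. p \<xi> \<partial>N)\<bar> \<le> e * measure N (space N)"
  proof -
    have "\<bar>(\<integral>\<xi>. g \<xi> \<partial>N) - (\<integral>\<xi>. p \<xi> \<partial>N)\<bar> = \<bar>\<integral>\<xi>. g \<xi> - p \<xi> \<partial>N\<bar>"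
      by (subst Bochner_Integration.integral_diff) (auto intro: cont_integrable g cp)
    also have "\<dots> \<le> (\<integral>\<xi>. \<bar>g \<xi> - p \<xi>\<bar> \<partial>N)" by (rule integral_abs_bound)
    also have "\<dots> \<le> (\<integral>\<xi>. e \<partial>N)"
      by (rule integral_mono) (use p(2) in \<open>auto intro!: cont_integrable continuous_intros g cp less_imp_le simp: space_N simp del: mem_sphere_0\<close>)
    finally show ?thesis by (simp add: mult.commute)
  qed
  have "?d \<le> e * measure M (space M) + e * measure N (space N)" using b1 b2 pe by linarith
  also have "\<dots> < e * ?m" using e by (simp add: algebra_simps)
  also have "\<dots> = ?d" using m by (simp add: e_def)
  finally show False by simp
qed

lemma emeasure_closed:
  assumes K: "closed K" "K \<subseteq> unit_circle" "K \<noteq> {}"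
  shows "emeasure M K = emeasure N K"
proof -
  have KC: "K \<in> sets circle_measure"
    using K by (auto simp: sets_circle_measure sets_restrict_space_iff)
  have KM: "K \<in> sets M" "K \<in> sets N" using KC sets_M sets_N by auto
  \<comment> \<open>Continuous functions decreasing to the indicator of \<open>K\<close>. The empty
    set is excluded because \<open>infdist\<close> to it is 0 by convention.\<close>
  define g where "g n \<xi> = max 0 (1 - real n * infdist \<xi> K)" for n \<xi>
  have cg: "continuous_on unit_circle (g n)" for n
    unfolding g_def by (intro continuous_intros)
  have lim: "(\<lambda>n. g n \<xi>) \<longlonglongrightarrow> indicator K \<xi>" for \<xi>
  proof (cases "\<xi> \<in> K")
    case True
    then show ?thesis by (simp add: g_def)
  next
    case False
    then have d: "infdist \<xi> K > 0"
      using in_closed_iff_infdist_zero[OF K(1,3)] infdist_nonneg[of \<xi> K] by (simp add: less_le)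
    obtain N where N: "1 / infdist \<xi> K < real N" using reals_Archimedean2 by blast
    have "g n \<xi> = 0" if "n \<ge> N" for n
    proof -
      have "1 < real N * infdist \<xi> K" using N d by (simp add: field_simps)
      also have "\<dots> \<le> real n * infdist \<xi> K" using that d by simp
      finally show ?thesis by (simp add: g_def)
    qed
    then show ?thesis using False by (auto intro!: tendsto_eventually eventually_sequentiallyI[of N])
  qed
  have bd: "norm (g n \<xi>) \<le> 1" for n \<xi> using infdist_nonneg[of \<xi> K] by (auto simp: g_def)
  have "(\<lambda>n. \<integral>\<xi>. g n \<xi> \<partial>M) \<longlonglongrightarrow> (\<integral>\<xi>. indicator K \<xi> \<partial>M)"
    by (rule integral_dominated_convergence[where w = "\<lambda>_. 1"])
      (use KM lim bd in \<open>auto intro!: borel_measurable_integrable cont_integrable cg\<close>)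
  moreover have "(\<lambda>n. \<integral>\<xi>. g n \<xi> \<partial>N) \<longlonglongrightarrow> (\<integral>\<xi>. indicator K \<xi> \<partial>N)"
    by (rule integral_dominated_convergence[where w = "\<lambda>_. 1"])
      (use KM lim bd in \<open>auto intro!: borel_measurable_integrable cont_integrable cg\<close>)
  ultimately have "(\<integral>\<xi>. indicat_real K \<xi> \<partial>M) = (\<integral>\<xi>. indicat_real K \<xi> \<partial>N)"
    using integral_continuous[OF cg] LIMSEQ_unique by simp
  then have "measure M K = measure N K"
    using KM K(2) by (simp add: space_M space_N Int_absorb1 Int_absorb2)
  then show ?thesis by (simp add: M.emeasure_eq_measure N.emeasure_eq_measure)
qed

text \<open>The closed subsets of the circle are stable under intersection, generate its Borel sets
  and include the whole circle, on which the measures are finite.\<close>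

lemma measures_eq: "M = N"
proof -
  define E where "E = {K. closed K \<and> K \<subseteq> unit_circle}"
  have sE: "sets circle_measure = sigma_sets unit_circle E"
  proof -
    have "E = (\<inter>) unit_circle ` {K. closed K}"
      unfolding E_def by (auto simp: image_iff)
    moreover have "sets (restrict_space borel unit_circle) = sigma_sets unit_circle ((\<inter>) unit_circle ` {K. closed K})"
    proof -
      have "unit_circle \<in> sigma_sets UNIV (Collect closed)"
        by (intro sigma_sets.Basic) simp
      then show ?thesis
        using sigma_sets_Int[of unit_circle UNIV "Collect closed"]
        by (simp add: sets_restrict_space borel_eq_closed sets_measure_of)
    qed
    ultimately show ?thesis by (simp add: sets_circle_measure)
  qed
  show ?thesis
  proof (rule measure_eqI_generator_eq[where E = E and \<Omega> = unit_circle and A = "\<lambda>_. unit_circle"])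
    show "Int_stable E" unfolding E_def Int_stable_def by auto
    show "emeasure M X = emeasure N X" if "X \<in> E" for X
      using that emeasure_closed[of X] by (cases "X = {}") (auto simp: E_def)
    show "sets M = sigma_sets unit_circle E" "sets N = sigma_sets unit_circle E"
      using sE sets_M sets_N by simp_all
  qed (auto simp: E_def M.emeasure_finite)
qed

end

subsection \<open>Inner functions fixing the origin as measure-preserving maps\<close>

lemma nn_integral_poisson_kernel:
  assumes "norm z < 1"
  shows "(\<integral>\<^sup>+\<xi>. ennreal (poisson_kernel z \<xi>) \<partial>circle_measure) = 1"
  using nn_integral_eq_integral[OF integrable_poisson_kernel[OF assms]] poisson_kernel_nonneg[OF assms]
    integral_poisson_kernel[OF assms] by simp

lemma cnj_borel_measurable [measurable]: "cnj \<in> borel_measurable borel"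
  by (intro borel_measurable_continuous_onI continuous_intros)

lemma cnj_circle_measurable [measurable]: "cnj \<in> borel_measurable circle_measure"
  by (rule borel_measurable_circleI) simp

lemma emeasure_density_space:
  assumes "u \<in> borel_measurable M"
  shows "emeasure (density M u) (space M) = (\<integral>\<^sup>+x. u x \<partial>M)"
  by (subst emeasure_density[OF assms]) (auto intro!: circle_nn_integral_cong)

lemma finite_measure_density_bounded:
  fixes u :: "complex \<Rightarrow> real"
  assumes "integrable circle_measure u" "\<And>\<xi>. norm \<xi> = 1 \<Longrightarrow> 0 \<le> u \<xi>"
  shows "finite_measure (density circle_measure (\<lambda>\<xi>. ennreal (u \<xi>)))"
proof (rule finite_measureI)
  have "(\<integral>\<^sup>+\<xi>. ennreal (u \<xi>) \<partial>circle_measure) = ennreal (\<integral>\<^sub>C \<xi>. u \<xi>)"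
    by (rule nn_integral_eq_integral) (use assms in \<open>auto simp: space_circle_measure\<close>)
  then show "emeasure (density circle_measure (\<lambda>\<xi>. ennreal (u \<xi>))) (space (density circle_measure (\<lambda>\<xi>. ennreal (u \<xi>)))) \<noteq> \<infinity>"
    using assms(1) by (simp add: emeasure_density_space)
qed

text \<open>Dividing by \<xi> on the circle is multiplying by its conjugate. The value of
  \<open>q\<close> at 0 is left open, since there the quotient is defined by a removable
  singularity.\<close>

lemma has_radial_limit_quotient:
  assumes h: "has_radial_limit h \<xi> w" and \<xi>: "norm \<xi> = 1"
    and q: "\<And>z. z \<noteq> 0 \<Longrightarrow> q z = h z / z"
  shows "has_radial_limit q \<xi> (w * cnj \<xi>)"
proof -
  have \<xi>0: "\<xi> \<noteq> 0" using \<xi> by auto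
  have "((\<lambda>r. h (of_real r * \<xi>) / (of_real r * \<xi>)) \<longlongrightarrow> w / (of_real 1 * \<xi>)) (at_left 1)"
    using h \<xi>0 unfolding has_radial_limit_def by (intro tendsto_intros) auto
  moreover have "eventually (\<lambda>r. h (of_real r * \<xi>) / (of_real r * \<xi>) = q (of_real r * \<xi>)) (at_left 1)"
    using eventually_at_left_real[of 0 1] \<xi>0 by (auto elim!: eventually_mono simp: q)
  ultimately have "((\<lambda>r. q (of_real r * \<xi>)) \<longlongrightarrow> w / (of_real 1 * \<xi>)) (at_left 1)"
    by (rule Lim_transform_eventually)
  moreover have "w / (of_real 1 * \<xi>) = w * cnj \<xi>"
    using circle_cnj[OF \<xi>] \<xi>0 by (auto simp: divide_simps mult_ac)
  ultimately show ?thesis unfolding has_radial_limit_def by simp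
qed

locale inner_dynamics =
  fixes f :: "complex \<Rightarrow> complex"
  assumes inner: "inner_function f" and f_0 [simp]: "f 0 = 0" and not_rotation: "\<not> is_rotation f"
begin

lemma f_holomorphic: "f holomorphic_on unit_disc"
  and f_disc: "norm z < 1 \<Longrightarrow> norm (f z) < 1"
  and f_radial: "AE \<xi> in circle_measure. \<exists>w. has_radial_limit f \<xi> w \<and> norm w = 1"
  using inner unfolding inner_function_def by (auto simp: image_subset_iff)

text \<open>A Borel measurable, everywhere unimodular version of the boundary values of \<open>f\<close>.\<close>

definition bdry :: "complex \<Rightarrow> complex" where
  "bdry \<xi> = (let w = lim (\<lambda>k. f (of_real (radius_seq k) * \<xi>)) in if norm w = 1 then w else 1)"

lemma norm_bdry [simp]: "norm (bdry \<xi>) = 1"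
  by (simp add: bdry_def Let_def)

lemma bdry_measurable [measurable]: "bdry \<in> circle_measure \<rightarrow>\<^sub>M circle_measure"
proof -
  have "(\<lambda>\<xi>. lim (\<lambda>k. f (of_real (radius_seq k) * \<xi>))) \<in> borel_measurable circle_measure"
    by (intro borel_measurable_lim_metric measurable_dilation[OF f_holomorphic] radius_seq)
  then have "bdry \<in> borel_measurable circle_measure"
    unfolding bdry_def Let_def by measurable
  then have "bdry \<in> circle_measure \<rightarrow>\<^sub>M restrict_space borel unit_circle"
    by (intro measurable_restrict_space2) auto
  then show ?thesis
    using measurable_cong_sets[OF refl sets_circle_measure] by blast
qed

lemma bdry_radial: "AE \<xi> in circle_measure. has_radial_limit f \<xi> (bdry \<xi>)"
  using f_radial
proof eventually_elim
  case (elim \<xi>)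
  then obtain w where w: "has_radial_limit f \<xi> w" "norm w = 1" by blast
  from limI[OF has_radial_limit_seq[OF w(1)]] have "bdry \<xi> = w"
    using w(2) by (simp add: bdry_def)
  then show ?case using w by simp
qed

lemma measurable_circle_id [measurable]: "(\<lambda>\<xi>. \<xi>) \<in> borel_measurable circle_measure"
  by (rule borel_measurable_circleI) simp

lemma bdry_borel [measurable]: "bdry \<in> borel_measurable circle_measure"
  using measurable_compose[OF bdry_measurable measurable_circle_id] .

text \<open>Both measures have \<open>f z ^ n\<close> as their \<open>n\<close>-th moment: on the
  left by the Poisson formula for the bounded function \<open>f ^ n\<close> (a power, not an
  iterate), on the right by \<open>integral_power_poisson\<close> at the point
  \<open>f z\<close>.\<close>

lemma distr_poisson:
  assumes z: "norm z < 1"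
  shows "distr (density circle_measure (\<lambda>\<xi>. ennreal (poisson_kernel z \<xi>))) circle_measure bdry =
    density circle_measure (\<lambda>\<xi>. ennreal (poisson_kernel (f z) \<xi>))"
proof -
  let ?M = "density circle_measure (\<lambda>\<xi>. ennreal (poisson_kernel z \<xi>))"
  have fin: "finite_measure (density circle_measure (\<lambda>\<xi>. ennreal (poisson_kernel w \<xi>)))" if "norm w < 1" for w
    by (rule finite_measure_density_bounded[OF integrable_poisson_kernel[OF that]])
      (rule poisson_kernel_nonneg[OF that])
  have mT: "bdry \<in> ?M \<rightarrow>\<^sub>M circle_measure" using bdry_measurable by simp
  interpret circle_measures_same_moments "distr ?M circle_measure bdry"
    "density circle_measure (\<lambda>\<xi>. ennreal (poisson_kernel (f z) \<xi>))"
  proof (intro circle_measures_same_moments.intro circle_measures_same_moments_axioms.intro)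
    show "finite_measure (distr ?M circle_measure bdry)"
      by (rule finite_measure.finite_measure_distr[OF fin[OF z] mT])
    show "finite_measure (density circle_measure (\<lambda>\<xi>. ennreal (poisson_kernel (f z) \<xi>)))"
      by (rule fin[OF f_disc[OF z]])
    fix n
    have "(\<integral>\<xi>. \<xi> ^ n \<partial>distr ?M circle_measure bdry) = (\<integral>\<xi>. bdry \<xi> ^ n \<partial>?M)"
      by (rule integral_distr[OF mT]) measurable
    also have "\<dots> = (\<integral>\<^sub>C \<xi>. poisson_kernel z \<xi> *\<^sub>R bdry \<xi> ^ n)"
      by (rule integral_density) (use poisson_kernel_nonneg[OF z] in auto)
    also have "\<dots> = f z ^ n"
    proof (rule poisson_bounded_holomorphic[where B = 1 and h = "\<lambda>z. f z ^ n", OF _ _ _ _ z])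
      show "(\<lambda>z. f z ^ n) holomorphic_on unit_disc" by (intro holomorphic_intros f_holomorphic)
      show "norm (f w ^ n) \<le> 1" if "norm w < 1" for w
        using f_disc[OF that] by (simp add: norm_power power_le_one)
      show "AE \<xi> in circle_measure. has_radial_limit (\<lambda>z. f z ^ n) \<xi> (bdry \<xi> ^ n)"
        using bdry_radial unfolding has_radial_limit_def by eventually_elim (intro tendsto_intros)
    qed measurable
    also have "\<dots> = (\<integral>\<^sub>C \<xi>. poisson_kernel (f z) \<xi> *\<^sub>R \<xi> ^ n)"
      by (rule integral_power_poisson[symmetric, OF f_disc[OF z]])
    also have "\<dots> = (\<integral>\<xi>. \<xi> ^ n \<partial>density circle_measure (\<lambda>\<xi>. ennreal (poisson_kernel (f z) \<xi>)))"
      by (rule integral_density[symmetric]) (use poisson_kernel_nonneg[OF f_disc[OF z]] in auto)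
    finally show "(\<integral>\<xi>. \<xi> ^ n \<partial>distr ?M circle_measure bdry) =
      (\<integral>\<xi>. \<xi> ^ n \<partial>density circle_measure (\<lambda>\<xi>. ennreal (poisson_kernel (f z) \<xi>)))" .
  qed simp_all
  show ?thesis by (rule measures_eq)
qed

lemma integral_poisson_bdry:
  fixes g :: "complex \<Rightarrow> 'b::{second_countable_topology, banach}"
  assumes z: "norm z < 1" and [measurable]: "g \<in> borel_measurable circle_measure"
  shows "(\<integral>\<^sub>C \<xi>. poisson_kernel z \<xi> *\<^sub>R g (bdry \<xi>)) =
      (\<integral>\<^sub>C \<xi>. poisson_kernel (f z) \<xi> *\<^sub>R g \<xi>)"
    and "integrable circle_measure (\<lambda>\<xi>. poisson_kernel z \<xi> *\<^sub>R g (bdry \<xi>)) \<longleftrightarrow>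
      integrable circle_measure (\<lambda>\<xi>. poisson_kernel (f z) \<xi> *\<^sub>R g \<xi>)"
proof -
  let ?M = "density circle_measure (\<lambda>\<xi>. ennreal (poisson_kernel z \<xi>))"
  let ?N = "density circle_measure (\<lambda>\<xi>. ennreal (poisson_kernel (f z) \<xi>))"
  have mT: "bdry \<in> ?M \<rightarrow>\<^sub>M circle_measure" by simp
  note pos = poisson_kernel_nonneg[OF z] poisson_kernel_nonneg[OF f_disc[OF z]]
  have "(\<integral>\<^sub>C \<xi>. poisson_kernel z \<xi> *\<^sub>R g (bdry \<xi>)) = (\<integral>\<xi>. g (bdry \<xi>) \<partial>?M)"
    by (rule integral_density[symmetric]) (use pos in auto)
  also have "\<dots> = (\<integral>\<xi>. g \<xi> \<partial>distr ?M circle_measure bdry)"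
    by (rule integral_distr[symmetric, OF mT]) simp
  also have "\<dots> = (\<integral>\<xi>. g \<xi> \<partial>?N)" unfolding distr_poisson[OF z] ..
  also have "\<dots> = (\<integral>\<^sub>C \<xi>. poisson_kernel (f z) \<xi> *\<^sub>R g \<xi>)"
    by (rule integral_density) (use pos in auto)
  finally show "(\<integral>\<^sub>C \<xi>. poisson_kernel z \<xi> *\<^sub>R g (bdry \<xi>)) =
      (\<integral>\<^sub>C \<xi>. poisson_kernel (f z) \<xi> *\<^sub>R g \<xi>)" .
  have "integrable circle_measure (\<lambda>\<xi>. poisson_kernel z \<xi> *\<^sub>R g (bdry \<xi>)) \<longleftrightarrow> integrable ?M (\<lambda>\<xi>. g (bdry \<xi>))"
    by (rule integrable_density[symmetric]) (use pos in auto)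
  also have "\<dots> \<longleftrightarrow> integrable (distr ?M circle_measure bdry) g"
    by (rule integrable_distr_eq[symmetric, OF mT]) simp
  also have "\<dots> \<longleftrightarrow> integrable ?N g" unfolding distr_poisson[OF z] ..
  also have "\<dots> \<longleftrightarrow> integrable circle_measure (\<lambda>\<xi>. poisson_kernel (f z) \<xi> *\<^sub>R g \<xi>)"
    by (rule integrable_density) (use pos in auto)
  finally show "integrable circle_measure (\<lambda>\<xi>. poisson_kernel z \<xi> *\<^sub>R g (bdry \<xi>)) \<longleftrightarrow>
      integrable circle_measure (\<lambda>\<xi>. poisson_kernel (f z) \<xi> *\<^sub>R g \<xi>)" .
qed

text \<open>The case \<open>z = 0\<close>: the kernel at the fixed point is the constant 1.\<close>

lemma distr_bdry: "distr circle_measure circle_measure bdry = circle_measure"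
proof -
  have "density circle_measure (\<lambda>\<xi>. ennreal (poisson_kernel 0 \<xi>)) = density circle_measure (\<lambda>_. 1)"
    by (rule density_cong) (auto simp: space_circle_measure)
  also have "\<dots> = circle_measure" by (rule density_1)
  finally show ?thesis using distr_poisson[of 0] by simp
qed

section \<open>Iterates of the map and of its boundary function\<close>

lemma bdry_iter_measurable [measurable]: "bdry ^^ n \<in> circle_measure \<rightarrow>\<^sub>M circle_measure"
  by (rule measurable_compose_n[OF bdry_measurable])

lemma bdry_iter_borel [measurable]: "bdry ^^ n \<in> borel_measurable circle_measure"
  using measurable_compose[OF bdry_iter_measurable measurable_circle_id] .

lemma norm_bdry_iter: "norm \<xi> = 1 \<Longrightarrow> norm ((bdry ^^ n) \<xi>) = 1"
  by (cases n) auto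

lemma distr_bdry_iter: "distr circle_measure circle_measure (bdry ^^ n) = circle_measure"
proof (induction n)
  case 0
  then show ?case by (simp add: distr_id2 id_def)
next
  case (Suc n)
  have "distr circle_measure circle_measure (bdry ^^ Suc n) =
      distr (distr circle_measure circle_measure (bdry ^^ n)) circle_measure bdry"
    by (subst distr_distr) (auto simp: comp_def)
  then show ?case unfolding Suc distr_bdry .
qed

lemma integral_bdry_iter:
  fixes g :: "complex \<Rightarrow> 'b::{second_countable_topology, banach}"
  assumes "g \<in> borel_measurable circle_measure"
  shows "(\<integral>\<^sub>C \<xi>. g ((bdry ^^ n) \<xi>)) = (\<integral>\<^sub>C \<xi>. g \<xi>)"
    and "integrable circle_measure (\<lambda>\<xi>. g ((bdry ^^ n) \<xi>)) \<longleftrightarrow> integrable circle_measure g"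
  using integral_distr[OF bdry_iter_measurable assms, of n] integrable_distr_eq[OF bdry_iter_measurable assms, of n]
  unfolding distr_bdry_iter by simp_all

lemmas integral_bdry = integral_bdry_iter[where n = 1, simplified]

lemma iter_disc: "norm z < 1 \<Longrightarrow> norm ((f ^^ n) z) < 1"
  by (induction n) (auto intro: f_disc)

lemma iter_holomorphic: "f ^^ n holomorphic_on unit_disc"
proof (induction n)
  case (Suc n)
  have "f \<circ> (f ^^ n) holomorphic_on unit_disc"
    by (rule holomorphic_on_compose_gen[OF Suc f_holomorphic]) (auto intro: iter_disc)
  then show ?case by (simp add: comp_def)
qed (simp add: id_def holomorphic_on_ident)

lemma iter_0 [simp]: "(f ^^ n) 0 = 0"
  by (induction n) auto

lemma integral_poisson_iter:
  fixes g :: "complex \<Rightarrow> 'b::{second_countable_topology, banach}"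
  assumes z: "norm z < 1" and g: "g \<in> borel_measurable circle_measure"
  shows "(\<integral>\<^sub>C \<xi>. poisson_kernel z \<xi> *\<^sub>R g ((bdry ^^ n) \<xi>)) =
      (\<integral>\<^sub>C \<xi>. poisson_kernel ((f ^^ n) z) \<xi> *\<^sub>R g \<xi>)"
  using g
proof (induction n arbitrary: g)
  case (Suc n)
  have "(\<integral>\<^sub>C \<xi>. poisson_kernel z \<xi> *\<^sub>R g ((bdry ^^ Suc n) \<xi>)) =
      (\<integral>\<^sub>C \<xi>. poisson_kernel ((f ^^ n) z) \<xi> *\<^sub>R g (bdry \<xi>))"
    using Suc.IH[of "\<lambda>\<xi>. g (bdry \<xi>)"] measurable_compose[OF bdry_measurable Suc.prems] by simp
  also have "\<dots> = (\<integral>\<^sub>C \<xi>. poisson_kernel ((f ^^ Suc n) z) \<xi> *\<^sub>R g \<xi>)"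
    using integral_poisson_bdry(1)[OF iter_disc[OF z] Suc.prems] by simp
  finally show ?case .
qed simp

text \<open>Obtained by transporting kernels, without a limit of a composition. That
  \<open>bdry ^^ n\<close> gives the boundary values of \<open>f ^^ n\<close> is a consequence, by
  Fatou's theorem, in \<open>iter_nontangential\<close>.\<close>

lemma poisson_bdry_iter:
  assumes "norm z < 1"
  shows "(\<integral>\<^sub>C \<xi>. poisson_kernel z \<xi> *\<^sub>R (bdry ^^ n) \<xi>) = (f ^^ n) z"
  using integral_poisson_iter[OF assms, of "\<lambda>\<xi>. \<xi>" n] integral_power_poisson[OF iter_disc[OF assms], of n 1]
  by simp

section \<open>The Schwarz quotient and its Harnack estimate\<close>

definition quot :: "complex \<Rightarrow> complex" where
  "quot z = (if z = 0 then deriv f 0 else f z / z)"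

lemma quot_holomorphic: "quot holomorphic_on unit_disc"
  by (rule pole_theorem_open_0[OF f_holomorphic, of 0]) (auto simp: quot_def)

lemma f_eq_quot: "f z = z * quot z"
  by (simp add: quot_def)

lemma norm_quot_le: "norm z < 1 \<Longrightarrow> norm (quot z) \<le> 1"
  using Schwarz_Lemma(1,2)[OF f_holomorphic f_0 f_disc] by (auto simp: quot_def norm_divide divide_simps)

definition mult0 :: complex where "mult0 = quot 0"

text \<open>Equality in the Schwarz lemma would make \<open>f\<close> a rotation.\<close>

lemma norm_mult0: "norm mult0 < 1"
proof (rule ccontr)
  assume "\<not> norm mult0 < 1"
  then have "norm (deriv f 0) = 1"
    using norm_quot_le[of 0] by (simp add: mult0_def quot_def)
  then obtain c where "\<forall>z. norm z < 1 \<longrightarrow> f z = c * z" "norm c = 1"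
    using Schwarz_Lemma(3)[OF f_holomorphic f_0 f_disc, of 0] by auto
  then show False using not_rotation unfolding is_rotation_def by auto
qed

lemma quot_radial: "AE \<xi> in circle_measure. has_radial_limit quot \<xi> (bdry \<xi> * cnj \<xi>)"
  using bdry_radial AE_norm_circle
  by eventually_elim (rule has_radial_limit_quotient[where h = f], auto simp: quot_def)

text \<open>The factor \<open>1 - norm mult0\<close> bounds from below the value at 0 of the
  harmonic function in \<open>norm_quot_harnack\<close>, and 1/2 bounds
  \<open>1 / (1 + norm w)\<close> in Harnack's inequality.\<close>

definition harnack_const :: real where "harnack_const = (1 - norm mult0) / 2"

lemma harnack_const: "0 < harnack_const" "harnack_const \<le> 1 / 2"
  using norm_mult0 by (auto simp: harnack_const_def)

text \<open>Harnack's inequality for the nonnegative harmonic function \<open>1 - Re (c * quot)\<close>, where the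
  unimodular \<open>c\<close> makes \<open>c * quot w\<close> nonnegative.\<close>

lemma norm_quot_harnack:
  assumes w: "norm w < 1"
  shows "norm (quot w) \<le> 1 - harnack_const * (1 - norm w)"
proof -
  define c where "c = (if quot w = 0 then 1 else cnj (quot w) / norm (quot w))"
  have c: "norm c = 1" "c * quot w = norm (quot w)"
    by (auto simp: c_def norm_divide complex_norm_square[symmetric] mult.commute[of "cnj _"] power2_eq_square)
  have P: "(\<integral>\<^sub>C \<xi>. poisson_kernel z \<xi> *\<^sub>R (c * (bdry \<xi> * cnj \<xi>))) = c * quot z" if "norm z < 1" for z
  proof (rule poisson_bounded_holomorphic[where B = 1 and h = "\<lambda>z. c * quot z", OF _ _ _ _ that])
    show "(\<lambda>z. c * quot z) holomorphic_on unit_disc" by (intro holomorphic_intros quot_holomorphic)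
    show "norm (c * quot w) \<le> 1" if "norm w < 1" for w using c norm_quot_le[OF that] by (simp add: norm_mult)
    show "AE \<xi> in circle_measure. has_radial_limit (\<lambda>z. c * quot z) \<xi> (c * (bdry \<xi> * cnj \<xi>))"
      using quot_radial unfolding has_radial_limit_def by eventually_elim (intro tendsto_intros)
  qed measurable
  define u where "u \<xi> = 1 - Re (c * (bdry \<xi> * cnj \<xi>))" for \<xi>
  have cm: "(\<lambda>\<xi>. c * (bdry \<xi> * cnj \<xi>)) \<in> borel_measurable circle_measure" by measurable
  have ci: "integrable circle_measure (\<lambda>\<xi>. c * (bdry \<xi> * cnj \<xi>))"
    by (rule circle_integrable_bound[OF cm, of 1]) (simp add: norm_mult c)
  have ui: "integrable circle_measure u"
    unfolding u_def using ci by (intro Bochner_Integration.integrable_diff integrable_Re) (auto intro: circle_integrable_bound)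
  have Pu: "(\<integral>\<^sub>C \<xi>. poisson_kernel z \<xi> * u \<xi>) = 1 - Re (c * quot z)" if z: "norm z < 1" for z
  proof -
    have "(\<integral>\<^sub>C \<xi>. poisson_kernel z \<xi> * u \<xi>) =
        (\<integral>\<^sub>C \<xi>. poisson_kernel z \<xi> - Re (poisson_kernel z \<xi> *\<^sub>R (c * (bdry \<xi> * cnj \<xi>))))"
      by (simp add: u_def algebra_simps)
    also have "\<dots> = (\<integral>\<^sub>C \<xi>. poisson_kernel z \<xi>) -
        Re (\<integral>\<^sub>C \<xi>. poisson_kernel z \<xi> *\<^sub>R (c * (bdry \<xi> * cnj \<xi>)))"
      using integrable_poisson_mult[OF z ci] integrable_poisson_kernel[OF z]
      by (subst Bochner_Integration.integral_diff) (auto simp del: scaleR_complex.simps)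
    finally show ?thesis using P[OF z] integral_poisson_kernel[OF z] by simp
  qed
  have upos: "0 \<le> u \<xi>" if "norm \<xi> = 1" for \<xi>
  proof -
    have "norm (c * (bdry \<xi> * cnj \<xi>)) = 1" using c that by (simp add: norm_mult)
    then show ?thesis unfolding u_def using complex_Re_le_cmod[of "c * (bdry \<xi> * cnj \<xi>)"] by linarith
  qed
  \<comment> \<open>The left side is a multiple of the mean of \<open>u\<close>, which is the value
    at 0 of the harmonic extension. As \<open>u\<close> is nonnegative, the lower bound of the
    kernel can be inserted under the integral.\<close>
  have "(1 - norm w) / (1 + norm w) * (1 - Re (c * quot 0)) =
      (\<integral>\<^sub>C \<xi>. (1 - norm w) / (1 + norm w) * u \<xi>)"
    using Pu[of 0] Bochner_Integration.integral_cong[OF refl, of circle_measure "\<lambda>\<xi>. poisson_kernel 0 \<xi> * u \<xi>" u]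
    by (simp add: space_circle_measure)
  also have "\<dots> \<le> (\<integral>\<^sub>C \<xi>. poisson_kernel w \<xi> * u \<xi>)"
  proof (rule circle_integral_mono)
    fix \<xi> :: complex assume "norm \<xi> = 1"
    then show "(1 - norm w) / (1 + norm w) * u \<xi> \<le> poisson_kernel w \<xi> * u \<xi>"
      by (intro mult_right_mono poisson_kernel_ge[OF w] upos)
  qed (use ui integrable_poisson_mult[OF w ui] in auto)
  also have "\<dots> = 1 - norm (quot w)" unfolding Pu[OF w] c(2) by simp
  finally have *: "(1 - norm w) / (1 + norm w) * (1 - Re (c * quot 0)) \<le> 1 - norm (quot w)" .
  have "Re (c * quot 0) \<le> norm mult0"
    using complex_Re_le_cmod[of "c * quot 0"] c by (simp add: norm_mult mult0_def)
  then have "(1 - norm w) / 2 * (1 - norm mult0) \<le> (1 - norm w) / (1 + norm w) * (1 - Re (c * quot 0))"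
    using w norm_mult0 by (intro mult_mono divide_left_mono) (auto simp: add_pos_nonneg)
  also note *
  finally have "harnack_const * (1 - norm w) \<le> 1 - norm (quot w)"
    by (simp add: harnack_const_def field_simps)
  then show ?thesis by simp
qed

end

subsection \<open>The adjoint of the composition operator\<close>

lemma circle_integrable_mult_bounded:
  fixes h :: "complex \<Rightarrow> complex"
  assumes h: "integrable circle_measure h" and u: "u \<in> borel_measurable circle_measure"
    and B: "\<And>\<xi>. norm \<xi> = 1 \<Longrightarrow> norm (u \<xi>) \<le> B"
  shows "integrable circle_measure (\<lambda>\<xi>. u \<xi> * h \<xi>)"
proof (rule Bochner_Integration.integrable_bound)
  show "integrable circle_measure (\<lambda>\<xi>. of_real B * h \<xi>)" using h by simp
  show "(\<lambda>\<xi>. u \<xi> * h \<xi>) \<in> borel_measurable circle_measure"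
    using u borel_measurable_integrable[OF h] by measurable
  show "AE \<xi> in circle_measure. norm (u \<xi> * h \<xi>) \<le> norm (of_real B * h \<xi>)"
  proof (rule AE_circleI)
    fix \<xi> :: complex assume "norm \<xi> = 1"
    then have "norm (u \<xi>) \<le> \<bar>B\<bar>" using B[of \<xi>] by (simp add: space_circle_measure)
    then show "norm (u \<xi> * h \<xi>) \<le> norm (of_real B * h \<xi>)"
      by (simp add: norm_mult mult_right_mono)
  qed
qed

context inner_dynamics
begin

text \<open>Says that \<open>v \<circ> bdry\<close> is the conditional expectation of
  \<open>u\<close> given \<open>bdry\<close>. Adding the constant \<open>B\<close> turns
  \<open>u\<close> and \<open>v\<close> into densities of positive measures, to which the uniqueness
  theorem applies; the contribution of \<open>B\<close> is the same on both sides because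
  \<open>bdry\<close> preserves the measure.\<close>

lemma adjoint_real:
  fixes u v :: "complex \<Rightarrow> real"
  assumes [measurable]: "u \<in> borel_measurable circle_measure" "v \<in> borel_measurable circle_measure"
    and B: "\<And>\<xi>. norm \<xi> = 1 \<Longrightarrow> \<bar>u \<xi>\<bar> \<le> B" "\<And>\<xi>. norm \<xi> = 1 \<Longrightarrow> \<bar>v \<xi>\<bar> \<le> B"
    and mom: "\<And>n. (\<integral>\<^sub>C \<xi>. u \<xi> *\<^sub>R bdry \<xi> ^ n) = (\<integral>\<^sub>C \<xi>. v \<xi> *\<^sub>R \<xi> ^ n)"
    and h: "integrable circle_measure (h :: complex \<Rightarrow> complex)"
  shows "(\<integral>\<^sub>C \<xi>. u \<xi> *\<^sub>R h (bdry \<xi>)) = (\<integral>\<^sub>C \<xi>. v \<xi> *\<^sub>R h \<xi>)"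
proof -
  let ?M = "density circle_measure (\<lambda>\<xi>. ennreal (B + u \<xi>))"
  let ?N = "density circle_measure (\<lambda>\<xi>. ennreal (B + v \<xi>))"
  have hm [measurable]: "h \<in> borel_measurable circle_measure" by (rule borel_measurable_integrable[OF h])
  have pos: "0 \<le> B + u \<xi>" "0 \<le> B + v \<xi>" if "norm \<xi> = 1" for \<xi> using B[OF that] by auto
  have le2: "\<bar>B + u \<xi>\<bar> \<le> 2 * B" "\<bar>B + v \<xi>\<bar> \<le> 2 * B" if "norm \<xi> = 1" for \<xi>
    using B(1)[OF that] B(2)[OF that] by auto
  have AEpos: "AE \<xi> in circle_measure. 0 \<le> B + u \<xi>" "AE \<xi> in circle_measure. 0 \<le> B + v \<xi>"
    using pos by (auto intro!: AE_circleI simp: space_circle_measure)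
  have ui: "integrable circle_measure (\<lambda>\<xi>. u \<xi> *\<^sub>R g \<xi>)" and vi: "integrable circle_measure (\<lambda>\<xi>. v \<xi> *\<^sub>R g \<xi>)"
    if "integrable circle_measure g" for g :: "complex \<Rightarrow> complex"
    using circle_integrable_mult_bounded[OF that, of "\<lambda>\<xi>. of_real (u \<xi>)" B]
      circle_integrable_mult_bounded[OF that, of "\<lambda>\<xi>. of_real (v \<xi>)" B] B
    by (simp_all add: scaleR_conv_of_real)
  have split_u: "(\<integral>\<^sub>C \<xi>. (B + u \<xi>) *\<^sub>R g \<xi>) = B *\<^sub>R (\<integral>\<^sub>C \<xi>. g \<xi>) + (\<integral>\<^sub>C \<xi>. u \<xi> *\<^sub>R g \<xi>)"
    and split_v: "(\<integral>\<^sub>C \<xi>. (B + v \<xi>) *\<^sub>R g \<xi>) = B *\<^sub>R (\<integral>\<^sub>C \<xi>. g \<xi>) + (\<integral>\<^sub>C \<xi>. v \<xi> *\<^sub>R g \<xi>)"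
    if "integrable circle_measure g" for g :: "complex \<Rightarrow> complex"
    using ui[OF that] vi[OF that] that by (simp_all add: scaleR_add_left)
  have mT: "bdry \<in> ?M \<rightarrow>\<^sub>M circle_measure" by simp
  interpret circle_measures_same_moments "distr ?M circle_measure bdry" ?N
  proof (intro circle_measures_same_moments.intro circle_measures_same_moments_axioms.intro)
    have "finite_measure ?M"
      by (rule finite_measure_density_bounded)
        (use pos le2 in \<open>auto intro!: circle_integrable_bound[where B = "2 * B"]\<close>)
    then show "finite_measure (distr ?M circle_measure bdry)"
      by (rule finite_measure.finite_measure_distr[OF _ mT])
    show "finite_measure ?N"
      by (rule finite_measure_density_bounded)
        (use pos le2 in \<open>auto intro!: circle_integrable_bound[where B = "2 * B"]\<close>)
    fix n
    have i1: "integrable circle_measure (\<lambda>\<xi>. bdry \<xi> ^ n)" "integrable circle_measure (\<lambda>\<xi>. \<xi> ^ n)"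
      by (rule circle_integrable_bound[where B = 1]; simp add: norm_power)+
    have "(\<integral>\<xi>. \<xi> ^ n \<partial>distr ?M circle_measure bdry) = (\<integral>\<xi>. bdry \<xi> ^ n \<partial>?M)"
      by (rule integral_distr[OF mT]) measurable
    also have "\<dots> = (\<integral>\<^sub>C \<xi>. (B + u \<xi>) *\<^sub>R bdry \<xi> ^ n)"
      by (rule integral_density) (use AEpos in auto)
    also have "\<dots> = (\<integral>\<^sub>C \<xi>. (B + v \<xi>) *\<^sub>R \<xi> ^ n)"
      unfolding split_u[OF i1(1)] split_v[OF i1(2)] mom
      using integral_bdry(1)[of "\<lambda>\<xi>. \<xi> ^ n"] by simp
    also have "\<dots> = (\<integral>\<xi>. \<xi> ^ n \<partial>?N)"
      by (rule integral_density[symmetric]) (use AEpos in auto)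
    finally show "(\<integral>\<xi>. \<xi> ^ n \<partial>distr ?M circle_measure bdry) = (\<integral>\<xi>. \<xi> ^ n \<partial>?N)" .
  qed simp_all
  have h': "integrable circle_measure (\<lambda>\<xi>. h (bdry \<xi>))"
    using integral_bdry(2)[OF hm] h by simp
  have "B *\<^sub>R (\<integral>\<^sub>C \<xi>. h (bdry \<xi>)) + (\<integral>\<^sub>C \<xi>. u \<xi> *\<^sub>R h (bdry \<xi>)) = (\<integral>\<xi>. h (bdry \<xi>) \<partial>?M)"
    unfolding split_u[OF h', symmetric]
    by (rule integral_density[symmetric]) (use AEpos in auto)
  also have "\<dots> = (\<integral>\<xi>. h \<xi> \<partial>distr ?M circle_measure bdry)"
    by (rule integral_distr[symmetric, OF mT]) simp
  also have "\<dots> = (\<integral>\<xi>. h \<xi> \<partial>?N)" unfolding measures_eq ..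
  also have "\<dots> = B *\<^sub>R (\<integral>\<^sub>C \<xi>. h \<xi>) + (\<integral>\<^sub>C \<xi>. v \<xi> *\<^sub>R h \<xi>)"
    unfolding split_v[OF h, symmetric]
    by (rule integral_density) (use AEpos in auto)
  finally show ?thesis using integral_bdry(1)[OF hm] by simp
qed

text \<open>For complex \<open>u\<close> the moments of \<open>cnj u\<close> have to be matched too:
  moments with nonnegative exponents see the real and the imaginary part separately only through
  both.\<close>

lemma adjoint:
  fixes u v :: "complex \<Rightarrow> complex"
  assumes um [measurable]: "u \<in> borel_measurable circle_measure" and vm [measurable]: "v \<in> borel_measurable circle_measure"
    and B: "\<And>\<xi>. norm \<xi> = 1 \<Longrightarrow> norm (u \<xi>) \<le> B" "\<And>\<xi>. norm \<xi> = 1 \<Longrightarrow> norm (v \<xi>) \<le> B"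
    and mom: "\<And>n. (\<integral>\<^sub>C \<xi>. u \<xi> * bdry \<xi> ^ n) = (\<integral>\<^sub>C \<xi>. v \<xi> * \<xi> ^ n)"
    and mom_cnj: "\<And>n. (\<integral>\<^sub>C \<xi>. cnj (u \<xi>) * bdry \<xi> ^ n) = (\<integral>\<^sub>C \<xi>. cnj (v \<xi>) * \<xi> ^ n)"
    and h: "integrable circle_measure (h :: complex \<Rightarrow> complex)"
  shows "(\<integral>\<^sub>C \<xi>. u \<xi> * h (bdry \<xi>)) = (\<integral>\<^sub>C \<xi>. v \<xi> * h \<xi>)"
proof -
  have Re_Im: "(\<integral>\<^sub>C \<xi>. Re (w \<xi>) *\<^sub>R g \<xi>) =
        ((\<integral>\<^sub>C \<xi>. w \<xi> * g \<xi>) + (\<integral>\<^sub>C \<xi>. cnj (w \<xi>) * g \<xi>)) / 2"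
      "(\<integral>\<^sub>C \<xi>. Im (w \<xi>) *\<^sub>R g \<xi>) =
        ((\<integral>\<^sub>C \<xi>. w \<xi> * g \<xi>) - (\<integral>\<^sub>C \<xi>. cnj (w \<xi>) * g \<xi>)) / (2 * \<i>)"
      "(\<integral>\<^sub>C \<xi>. w \<xi> * g \<xi>) =
        (\<integral>\<^sub>C \<xi>. Re (w \<xi>) *\<^sub>R g \<xi>) + \<i> * (\<integral>\<^sub>C \<xi>. Im (w \<xi>) *\<^sub>R g \<xi>)"
    if g: "integrable circle_measure g" and w [measurable]: "w \<in> borel_measurable circle_measure"
      and wB: "\<And>\<xi>. norm \<xi> = 1 \<Longrightarrow> norm (w \<xi>) \<le> B" for g w :: "complex \<Rightarrow> complex"
  proof -
    have i1: "integrable circle_measure (\<lambda>\<xi>. w \<xi> * g \<xi>)"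
      by (rule circle_integrable_mult_bounded[OF g w wB])
    have i2: "integrable circle_measure (\<lambda>\<xi>. cnj (w \<xi>) * g \<xi>)"
      by (rule circle_integrable_mult_bounded[OF g _, of _ B]) (use wB in auto)
    have "(\<integral>\<^sub>C \<xi>. Re (w \<xi>) *\<^sub>R g \<xi>) = (\<integral>\<^sub>C \<xi>. (w \<xi> * g \<xi> + cnj (w \<xi>) * g \<xi>) / 2)"
      by (rule circle_integral_cong)
        (simp add: scaleR_conv_of_real distrib_right[symmetric] complex_add_cnj)
    then show a: "(\<integral>\<^sub>C \<xi>. Re (w \<xi>) *\<^sub>R g \<xi>) =
        ((\<integral>\<^sub>C \<xi>. w \<xi> * g \<xi>) + (\<integral>\<^sub>C \<xi>. cnj (w \<xi>) * g \<xi>)) / 2"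
      using i1 i2 by simp
    have "(\<integral>\<^sub>C \<xi>. Im (w \<xi>) *\<^sub>R g \<xi>) = (\<integral>\<^sub>C \<xi>. (w \<xi> * g \<xi> - cnj (w \<xi>) * g \<xi>) / (2 * \<i>))"
    proof (rule circle_integral_cong)
      fix \<xi>
      have eq: "w \<xi> * g \<xi> - cnj (w \<xi>) * g \<xi> = (2 * \<i>) * (Im (w \<xi>) *\<^sub>R g \<xi>)"
        by (simp add: complex_eq_iff algebra_simps)
      show "Im (w \<xi>) *\<^sub>R g \<xi> = (w \<xi> * g \<xi> - cnj (w \<xi>) * g \<xi>) / (2 * \<i>)"
        unfolding eq by (rule nonzero_mult_div_cancel_left[symmetric]) simp
    qed
    then show b: "(\<integral>\<^sub>C \<xi>. Im (w \<xi>) *\<^sub>R g \<xi>) =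
        ((\<integral>\<^sub>C \<xi>. w \<xi> * g \<xi>) - (\<integral>\<^sub>C \<xi>. cnj (w \<xi>) * g \<xi>)) / (2 * \<i>)"
      using i1 i2 by simp
    show "(\<integral>\<^sub>C \<xi>. w \<xi> * g \<xi>) =
        (\<integral>\<^sub>C \<xi>. Re (w \<xi>) *\<^sub>R g \<xi>) + \<i> * (\<integral>\<^sub>C \<xi>. Im (w \<xi>) *\<^sub>R g \<xi>)"
      unfolding a b by (simp add: field_simps)
  qed
  have pw: "integrable circle_measure (\<lambda>\<xi>. bdry \<xi> ^ n)" "integrable circle_measure (\<lambda>\<xi>. \<xi> ^ n)" for n
    by (rule circle_integrable_bound[where B = 1]; simp add: norm_power)+
  have h': "integrable circle_measure (\<lambda>\<xi>. h (bdry \<xi>))"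
    using integral_bdry(2)[OF borel_measurable_integrable[OF h]] h by simp
  have "(\<integral>\<^sub>C \<xi>. Re (u \<xi>) *\<^sub>R h (bdry \<xi>)) = (\<integral>\<^sub>C \<xi>. Re (v \<xi>) *\<^sub>R h \<xi>)"
  proof (rule adjoint_real[where B = B, OF _ _ _ _ _ h])
    show "(\<integral>\<^sub>C \<xi>. Re (u \<xi>) *\<^sub>R bdry \<xi> ^ n) = (\<integral>\<^sub>C \<xi>. Re (v \<xi>) *\<^sub>R \<xi> ^ n)" for n
      by (simp only: Re_Im(1)[OF pw(1) um B(1)] Re_Im(1)[OF pw(2) vm B(2)] mom mom_cnj)
    show "\<bar>Re (u \<xi>)\<bar> \<le> B" "\<bar>Re (v \<xi>)\<bar> \<le> B" if "norm \<xi> = 1" for \<xi>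
      using B[OF that] abs_Re_le_cmod order_trans by blast+
  qed measurable
  moreover have "(\<integral>\<^sub>C \<xi>. Im (u \<xi>) *\<^sub>R h (bdry \<xi>)) = (\<integral>\<^sub>C \<xi>. Im (v \<xi>) *\<^sub>R h \<xi>)"
  proof (rule adjoint_real[where B = B, OF _ _ _ _ _ h])
    show "(\<integral>\<^sub>C \<xi>. Im (u \<xi>) *\<^sub>R bdry \<xi> ^ n) = (\<integral>\<^sub>C \<xi>. Im (v \<xi>) *\<^sub>R \<xi> ^ n)" for n
      by (simp only: Re_Im(2)[OF pw(1) um B(1)] Re_Im(2)[OF pw(2) vm B(2)] mom mom_cnj)
    show "\<bar>Im (u \<xi>)\<bar> \<le> B" "\<bar>Im (v \<xi>)\<bar> \<le> B" if "norm \<xi> = 1" for \<xi>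
      using B[OF that] abs_Im_le_cmod order_trans by blast+
  qed measurable
  ultimately show ?thesis
    by (simp only: Re_Im(3)[OF h' um B(1)] Re_Im(3)[OF h vm B(2)])
qed

section \<open>Moments of the boundary map and conditional means of the first two powers\<close>

lemma integral_bounded_holomorphic:
  assumes "h holomorphic_on unit_disc" "\<And>w. norm w < 1 \<Longrightarrow> norm (h w) \<le> B"
    and "hs \<in> borel_measurable circle_measure" "AE \<xi> in circle_measure. has_radial_limit h \<xi> (hs \<xi>)"
  shows "(\<integral>\<^sub>C \<xi>. hs \<xi>) = h 0"
proof -
  have "(\<integral>\<^sub>C \<xi>. hs \<xi>) = (\<integral>\<^sub>C \<xi>. poisson_kernel 0 \<xi> *\<^sub>R hs \<xi>)"
    by (rule circle_integral_cong) (simp add: space_circle_measure)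
  then show ?thesis using poisson_bounded_holomorphic[OF assms, of 0] by simp
qed

lemma moment_power: "(\<integral>\<^sub>C \<xi>. \<xi> ^ k * bdry \<xi> ^ n) = (if k = 0 \<and> n = 0 then 1 else 0)"
proof -
  have "(\<integral>\<^sub>C \<xi>. \<xi> ^ k * bdry \<xi> ^ n) = 0 ^ k * f 0 ^ n"
  proof (rule integral_bounded_holomorphic[where h = "\<lambda>z. z ^ k * f z ^ n" and B = 1])
    show "(\<lambda>z. z ^ k * f z ^ n) holomorphic_on unit_disc" by (intro holomorphic_intros f_holomorphic)
    show "norm (w ^ k * f w ^ n) \<le> 1" if "norm w < 1" for w
      using f_disc[OF that] that by (simp add: norm_mult norm_power mult_le_one power_le_one)
    show "AE \<xi> in circle_measure. has_radial_limit (\<lambda>z. z ^ k * f z ^ n) \<xi> (\<xi> ^ k * bdry \<xi> ^ n)"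
      using bdry_radial
    proof eventually_elim
      case (elim \<xi>)
      then have "((\<lambda>r. (of_real r * \<xi>) ^ k * f (of_real r * \<xi>) ^ n) \<longlongrightarrow> (of_real 1 * \<xi>) ^ k * bdry \<xi> ^ n) (at_left 1)"
        unfolding has_radial_limit_def by (intro tendsto_intros)
      then show ?case by (simp add: has_radial_limit_def)
    qed
  qed measurable
  then show ?thesis by (auto simp: power_0_left)
qed

text \<open>The integrand is the boundary function of \<open>quot ^ k * f ^ n\<close> (powers, not
  iterates), which is bounded and holomorphic; its mean is the value at 0. This handles negative
  powers of \<xi> as long as enough factors \<open>bdry\<close> compensate them.\<close>

lemma moment_quot:
  "(\<integral>\<^sub>C \<xi>. cnj \<xi> ^ k * bdry \<xi> ^ (k + n)) = (if n = 0 then mult0 ^ k else 0)"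
proof -
  have "(\<integral>\<^sub>C \<xi>. (bdry \<xi> * cnj \<xi>) ^ k * bdry \<xi> ^ n) = quot 0 ^ k * f 0 ^ n"
  proof (rule integral_bounded_holomorphic[where h = "\<lambda>z. quot z ^ k * f z ^ n" and B = 1])
    show "(\<lambda>z. quot z ^ k * f z ^ n) holomorphic_on unit_disc"
      by (intro holomorphic_intros f_holomorphic quot_holomorphic)
    show "norm (quot w ^ k * f w ^ n) \<le> 1" if "norm w < 1" for w
      using f_disc[OF that] norm_quot_le[OF that] by (simp add: norm_mult norm_power mult_le_one power_le_one)
    show "AE \<xi> in circle_measure. has_radial_limit (\<lambda>z. quot z ^ k * f z ^ n) \<xi> ((bdry \<xi> * cnj \<xi>) ^ k * bdry \<xi> ^ n)"
      using bdry_radial quot_radial unfolding has_radial_limit_def by eventually_elim (intro tendsto_intros)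
  qed measurable
  then show ?thesis by (auto simp: power_mult_distrib power_add mult_ac mult0_def power_0_left)
qed

text \<open>The second Taylor coefficient of \<open>f\<close>, as a Fourier coefficient of its
  boundary function.\<close>

definition second_coeff :: complex where
  "second_coeff = (\<integral>\<^sub>C \<xi>. cnj \<xi> ^ 2 * bdry \<xi>)"

lemma norm_second_coeff: "norm second_coeff \<le> 1"
proof -
  have "norm second_coeff \<le> (\<integral>\<^sub>C \<xi>. norm (cnj \<xi> ^ 2 * bdry \<xi>))"
    unfolding second_coeff_def by (rule integral_norm_bound)
  also have "\<dots> = (\<integral>\<^sub>C \<xi>. 1)"
    by (rule circle_integral_cong) (simp add: norm_mult norm_power space_circle_measure)
  finally show ?thesis by simp
qed

text \<open>The conditional mean of \<xi> given \<open>bdry\<close> is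
  \<open>cnj mult0 * bdry \<xi>\<close>: all moments of \<xi> against powers of \<open>bdry\<close>
  vanish, and those of its conjugate vanish except for exponent 1.\<close>

lemma adjoint_id:
  assumes h: "integrable circle_measure (h :: complex \<Rightarrow> complex)"
  shows "(\<integral>\<^sub>C \<xi>. \<xi> * h (bdry \<xi>)) = cnj mult0 * (\<integral>\<^sub>C \<xi>. \<xi> * h \<xi>)"
proof -
  have "(\<integral>\<^sub>C \<xi>. \<xi> * h (bdry \<xi>)) = (\<integral>\<^sub>C \<xi>. cnj mult0 * \<xi> * h \<xi>)"
  proof (rule adjoint[where B = 1, OF _ _ _ _ _ _ h])
    fix n
    show "(\<integral>\<^sub>C \<xi>. \<xi> * bdry \<xi> ^ n) = (\<integral>\<^sub>C \<xi>. cnj mult0 * \<xi> * \<xi> ^ n)"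
      using moment_power[of 1 n] integral_circle_power[of "Suc n"] by (simp add: mult.assoc)
    have "(\<integral>\<^sub>C \<xi>. cnj \<xi> * bdry \<xi> ^ n) = (if n = 1 then mult0 else 0)"
      using moment_quot[of 1 "n - 1"] integral_circle_power_cnj[of 0 1] by (cases n) auto
    moreover have "(\<integral>\<^sub>C \<xi>. cnj (cnj mult0 * \<xi>) * \<xi> ^ n) =
        (\<integral>\<^sub>C \<xi>. mult0 * (\<xi> ^ n * cnj \<xi> ^ 1))"
      by (rule circle_integral_cong) simp
    moreover have "\<dots> = (if n = 1 then mult0 else 0)"
      by (subst integral_mult_right_zero) (simp only: integral_circle_power_cnj, simp)
    ultimately show "(\<integral>\<^sub>C \<xi>. cnj \<xi> * bdry \<xi> ^ n) = (\<integral>\<^sub>C \<xi>. cnj (cnj mult0 * \<xi>) * \<xi> ^ n)"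
      by simp
  qed (use norm_mult0 in \<open>auto simp: norm_mult\<close>)
  then show ?thesis by (simp add: mult.assoc)
qed

text \<open>The conditional mean of the square is a polynomial of degree 2 in \<open>bdry\<close>,
  because the moments of its conjugate vanish except for the exponents 1 and 2.\<close>

lemma adjoint_square:
  assumes h: "integrable circle_measure (h :: complex \<Rightarrow> complex)"
  shows "(\<integral>\<^sub>C \<xi>. \<xi>\<^sup>2 * h (bdry \<xi>)) =
    cnj second_coeff * (\<integral>\<^sub>C \<xi>. \<xi> * h \<xi>) + cnj mult0 ^ 2 * (\<integral>\<^sub>C \<xi>. \<xi>\<^sup>2 * h \<xi>)"
proof -
  let ?v = "\<lambda>\<xi>. cnj second_coeff * \<xi> + cnj mult0 ^ 2 * \<xi>\<^sup>2"
  have i: "integrable circle_measure (\<lambda>\<xi>. \<xi> * h \<xi>)" "integrable circle_measure (\<lambda>\<xi>. \<xi>\<^sup>2 * h \<xi>)"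
    by (rule circle_integrable_mult_bounded[OF h, of _ 1]; simp add: norm_power)+
  have "(\<integral>\<^sub>C \<xi>. \<xi>\<^sup>2 * h (bdry \<xi>)) = (\<integral>\<^sub>C \<xi>. ?v \<xi> * h \<xi>)"
  proof (rule adjoint[where B = 2, OF _ _ _ _ _ _ h])
    fix n
    have p: "integrable circle_measure (\<lambda>\<xi>. \<xi> ^ n)" "integrable circle_measure (\<lambda>\<xi>. \<xi> ^ n * cnj \<xi> ^ m)" for n m
      by (rule circle_integrable_bound[where B = 1]; simp add: norm_mult norm_power)+
    have "(\<integral>\<^sub>C \<xi>. ?v \<xi> * \<xi> ^ n) =
        (\<integral>\<^sub>C \<xi>. cnj second_coeff * \<xi> ^ (n + 1) + cnj mult0 ^ 2 * \<xi> ^ (n + 2))"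
      by (rule circle_integral_cong) (simp add: power_add power2_eq_square algebra_simps)
    also have "\<dots> = 0" using p by (simp add: integral_circle_power del: power_Suc)
    finally show "(\<integral>\<^sub>C \<xi>. \<xi>\<^sup>2 * bdry \<xi> ^ n) = (\<integral>\<^sub>C \<xi>. ?v \<xi> * \<xi> ^ n)"
      using moment_power[of 2 n] by simp
    have "(\<integral>\<^sub>C \<xi>. cnj (?v \<xi>) * \<xi> ^ n) =
        (\<integral>\<^sub>C \<xi>. second_coeff * (\<xi> ^ n * cnj \<xi> ^ 1) + mult0 ^ 2 * (\<xi> ^ n * cnj \<xi> ^ 2))"
      by (rule circle_integral_cong) (simp add: algebra_simps)
    also have "\<dots> = (if n = 1 then second_coeff else if n = 2 then mult0 ^ 2 else 0)"
      using p(2)[of n 1] p(2)[of n 2] integral_circle_power_cnj[of n 1] integral_circle_power_cnj[of n 2]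
      by simp
    also have "\<dots> = (\<integral>\<^sub>C \<xi>. cnj (\<xi>\<^sup>2) * bdry \<xi> ^ n)"
    \<comment> \<open>\<open>moment_quot\<close> reaches the exponents from 2 on; exponent 0 is
      orthogonality of powers, and exponent 1 is the definition of
      \<open>second_coeff\<close>.\<close>
    proof (cases "n < 2")
      case True
      then have "n = 0 \<or> n = 1" by auto
      then show ?thesis using integral_circle_power_cnj[of 0 2] by (auto simp: second_coeff_def)
    next
      case False
      then obtain m where m: "n = 2 + m" using le_Suc_ex[of 2 n] by auto
      show ?thesis unfolding m complex_cnj_power moment_quot by simp
    qed
    finally show "(\<integral>\<^sub>C \<xi>. cnj (\<xi>\<^sup>2) * bdry \<xi> ^ n) = (\<integral>\<^sub>C \<xi>. cnj (?v \<xi>) * \<xi> ^ n)" ..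
  next
    fix \<xi> :: complex assume "norm \<xi> = 1"
    then have "norm (?v \<xi>) \<le> norm second_coeff + norm mult0 ^ 2"
      by (intro order_trans[OF norm_triangle_ineq]) (simp add: norm_mult norm_power)
    also have "\<dots> \<le> 1 + 1"
      using norm_second_coeff norm_mult0 by (intro add_mono power_le_one) auto
    finally show "norm (?v \<xi>) \<le> 2" by simp
  qed (auto simp: norm_power)
  also have "\<dots> = (\<integral>\<^sub>C \<xi>. cnj second_coeff * (\<xi> * h \<xi>) + cnj mult0 ^ 2 * (\<xi>\<^sup>2 * h \<xi>))"
    by (rule circle_integral_cong) (simp add: algebra_simps)
  finally show ?thesis using i by simp
qed

text \<open>\<open>mdiff \<circ> bdry ^^ n\<close> is the part of \<open>bdry ^^ n\<close> orthogonal to the functions of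
  \<open>bdry ^^ (n + 1)\<close>: a reverse martingale difference sequence.\<close>

definition mdiff :: "complex \<Rightarrow> complex" where
  "mdiff \<xi> = \<xi> - cnj mult0 * bdry \<xi>"

lemma mdiff_measurable [measurable]: "mdiff \<in> borel_measurable circle_measure"
  unfolding mdiff_def by measurable

lemma norm_mdiff: "norm \<xi> = 1 \<Longrightarrow> norm (mdiff \<xi>) \<le> 2"
  unfolding mdiff_def using norm_mult0
  by (intro order_trans[OF norm_triangle_ineq4]) (simp add: norm_mult)

lemma integrable_comp_bdry:
  "integrable circle_measure (h :: complex \<Rightarrow> complex) \<Longrightarrow> integrable circle_measure (\<lambda>\<xi>. h (bdry \<xi>))"
  using integral_bdry(2)[OF borel_measurable_integrable, of h] by simp

text \<open>The martingale property: subtracting the conditional mean leaves a function orthogonal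
  to all functions of \<open>bdry\<close>.\<close>

lemma integral_mdiff:
  assumes h: "integrable circle_measure (h :: complex \<Rightarrow> complex)"
  shows "(\<integral>\<^sub>C \<xi>. mdiff \<xi> * h (bdry \<xi>)) = 0"
proof -
  have hm [measurable]: "h \<in> borel_measurable circle_measure" by (rule borel_measurable_integrable[OF h])
  have i: "integrable circle_measure (\<lambda>\<xi>. \<xi> * h (bdry \<xi>))" "integrable circle_measure (\<lambda>\<xi>. bdry \<xi> * h (bdry \<xi>))"
    by (rule circle_integrable_mult_bounded[OF integrable_comp_bdry[OF h], of _ 1]; simp)+
  have "(\<integral>\<^sub>C \<xi>. mdiff \<xi> * h (bdry \<xi>)) =
      (\<integral>\<^sub>C \<xi>. \<xi> * h (bdry \<xi>) - cnj mult0 * (bdry \<xi> * h (bdry \<xi>)))"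
    by (simp add: mdiff_def algebra_simps)
  also have "\<dots> = 0"
    using i adjoint_id[OF h] integral_bdry(1)[of "\<lambda>\<xi>. \<xi> * h \<xi>"] by simp
  finally show ?thesis .
qed

text \<open>The conditional variance is constant: in the expansion of
  \<open>1 = \<xi> * cnj \<xi>\<close> with
  \<open>\<xi> = mdiff \<xi> + cnj mult0 * bdry \<xi>\<close> the mixed terms have conditional mean
  0, and \<open>bdry\<close> is unimodular.\<close>

lemma integral_mdiff_norm:
  assumes h: "integrable circle_measure (h :: complex \<Rightarrow> complex)"
  shows "(\<integral>\<^sub>C \<xi>. (mdiff \<xi> * cnj (mdiff \<xi>)) * h (bdry \<xi>)) =
    (1 - (norm mult0)\<^sup>2) *\<^sub>R (\<integral>\<^sub>C \<xi>. h \<xi>)"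
proof -
  have hm [measurable]: "h \<in> borel_measurable circle_measure" by (rule borel_measurable_integrable[OF h])
  have h1: "integrable circle_measure (\<lambda>\<xi>. cnj \<xi> * h \<xi>)"
    by (rule circle_integrable_mult_bounded[OF h, of _ 1]) simp_all
  have h2: "integrable circle_measure (\<lambda>\<xi>. \<xi> * h \<xi>)"
    by (rule circle_integrable_mult_bounded[OF h, of _ 1]) simp_all
  have i1: "integrable circle_measure (\<lambda>\<xi>. mdiff \<xi> * (cnj (bdry \<xi>) * h (bdry \<xi>)))"
    by (rule circle_integrable_mult_bounded[OF integrable_comp_bdry[OF h1], of _ 2]) (simp_all add: norm_mdiff)
  have i2: "integrable circle_measure (\<lambda>\<xi>. cnj (mdiff \<xi>) * (bdry \<xi> * h (bdry \<xi>)))"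
    by (rule circle_integrable_mult_bounded[OF integrable_comp_bdry[OF h2], of _ 2]) (simp_all add: norm_mdiff)
  have z1: "(\<integral>\<^sub>C \<xi>. mdiff \<xi> * (cnj (bdry \<xi>) * h (bdry \<xi>))) = 0"
    using integral_mdiff[OF h1] by simp
  have "integrable circle_measure (\<lambda>\<xi>. cnj (\<xi> * h \<xi>))" using h2 by (simp only: complex_integrable_cnj)
  from integral_mdiff[OF this]
  have "(\<integral>\<^sub>C \<xi>. cnj (cnj (mdiff \<xi>) * (bdry \<xi> * h (bdry \<xi>)))) = 0" by simp
  then have z2: "(\<integral>\<^sub>C \<xi>. cnj (mdiff \<xi>) * (bdry \<xi> * h (bdry \<xi>))) = 0"
    unfolding Bochner_Integration.integral_cnj by simp
  have "(\<integral>\<^sub>C \<xi>. (mdiff \<xi> * cnj (mdiff \<xi>)) * h (bdry \<xi>)) =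
      (\<integral>\<^sub>C \<xi>. (1 - (norm mult0)\<^sup>2) *\<^sub>R h (bdry \<xi>) - mult0 * (mdiff \<xi> * (cnj (bdry \<xi>) * h (bdry \<xi>)))
        - cnj mult0 * (cnj (mdiff \<xi>) * (bdry \<xi> * h (bdry \<xi>))))"
  proof (rule circle_integral_cong)
    fix \<xi> :: complex assume x: "norm \<xi> = 1"
    have e: "bdry \<xi> * cnj (bdry \<xi>) = 1" by (rule circle_cnj[OF norm_bdry])
    define d where "d = mdiff \<xi>"
    have "\<xi> = d + cnj mult0 * bdry \<xi>" by (simp add: d_def mdiff_def)
    then have "(d + cnj mult0 * bdry \<xi>) * cnj (d + cnj mult0 * bdry \<xi>) = 1"
      using circle_cnj[OF x] by simp
    then have "d * cnj d + mult0 * (d * cnj (bdry \<xi>)) + cnj mult0 * (cnj d * bdry \<xi>)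
        + mult0 * cnj mult0 * (bdry \<xi> * cnj (bdry \<xi>)) = 1"
      by (simp add: algebra_simps)
    then have "d * cnj d = 1 - of_real ((norm mult0)\<^sup>2) - mult0 * (d * cnj (bdry \<xi>)) - cnj mult0 * (cnj d * bdry \<xi>)"
      unfolding e complex_norm_square[of mult0] by (simp add: algebra_simps)
    then have "d * cnj d * h (bdry \<xi>) = (1 - of_real ((norm mult0)\<^sup>2) - mult0 * (d * cnj (bdry \<xi>)) - cnj mult0 * (cnj d * bdry \<xi>)) * h (bdry \<xi>)"
      by (rule arg_cong)
    then show "(mdiff \<xi> * cnj (mdiff \<xi>)) * h (bdry \<xi>) =
        (1 - (norm mult0)\<^sup>2) *\<^sub>R h (bdry \<xi>) - mult0 * (mdiff \<xi> * (cnj (bdry \<xi>) * h (bdry \<xi>)))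
        - cnj mult0 * (cnj (mdiff \<xi>) * (bdry \<xi> * h (bdry \<xi>)))"
      unfolding d_def[symmetric] scaleR_conv_of_real by (simp add: algebra_simps)
  qed
  also have "\<dots> = (1 - (norm mult0)\<^sup>2) *\<^sub>R (\<integral>\<^sub>C \<xi>. h (bdry \<xi>))"
    using i1 i2 integrable_comp_bdry[OF h] z1 z2 by simp
  finally show ?thesis using integral_bdry(1)[OF hm] by simp
qed

text \<open>In contrast to the modulus squared, the conditional mean of the square itself is not
  constant. Its quadratic part cancels, with coefficients 1 - 2 + 1, and the linear part with
  \<open>second_coeff\<close> remains; the Riesz products must cope with it.\<close>

lemma integral_mdiff_square:
  assumes h: "integrable circle_measure (h :: complex \<Rightarrow> complex)"
  shows "(\<integral>\<^sub>C \<xi>. mdiff \<xi> ^ 2 * h (bdry \<xi>)) =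
    cnj second_coeff * (\<integral>\<^sub>C \<xi>. \<xi> * h \<xi>)"
proof -
  have hm [measurable]: "h \<in> borel_measurable circle_measure" by (rule borel_measurable_integrable[OF h])
  have h1: "integrable circle_measure (\<lambda>\<xi>. \<xi> * h \<xi>)" and h2: "integrable circle_measure (\<lambda>\<xi>. \<xi>\<^sup>2 * h \<xi>)"
    by (rule circle_integrable_mult_bounded[OF h, of _ 1]; simp add: norm_power)+
  have i: "integrable circle_measure (\<lambda>\<xi>. \<xi>\<^sup>2 * h (bdry \<xi>))"
    by (rule circle_integrable_mult_bounded[OF integrable_comp_bdry[OF h], of _ 1]) (simp_all add: norm_power)
  have i1: "integrable circle_measure (\<lambda>\<xi>. \<xi> * (bdry \<xi> * h (bdry \<xi>)))"
    by (rule circle_integrable_mult_bounded[OF integrable_comp_bdry[OF h1], of _ 1]) (simp_all)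
  have "(\<integral>\<^sub>C \<xi>. mdiff \<xi> ^ 2 * h (bdry \<xi>)) =
      (\<integral>\<^sub>C \<xi>. \<xi>\<^sup>2 * h (bdry \<xi>) - 2 * cnj mult0 * (\<xi> * (bdry \<xi> * h (bdry \<xi>)))
        + cnj mult0 ^ 2 * (bdry \<xi> ^ 2 * h (bdry \<xi>)))"
    by (rule circle_integral_cong) (simp add: mdiff_def power2_eq_square algebra_simps)
  also have "\<dots> = cnj second_coeff * (\<integral>\<^sub>C \<xi>. \<xi> * h \<xi>) + cnj mult0 ^ 2 * (\<integral>\<^sub>C \<xi>. \<xi>\<^sup>2 * h \<xi>)
      - 2 * cnj mult0 * (cnj mult0 * (\<integral>\<^sub>C \<xi>. \<xi> * (\<xi> * h \<xi>)))
      + cnj mult0 ^ 2 * (\<integral>\<^sub>C \<xi>. bdry \<xi> ^ 2 * h (bdry \<xi>))"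
    using i i1 integrable_comp_bdry[OF h2] adjoint_id[OF h1] adjoint_square[OF h] by simp
  also have "(\<integral>\<^sub>C \<xi>. bdry \<xi> ^ 2 * h (bdry \<xi>)) = (\<integral>\<^sub>C \<xi>. \<xi>\<^sup>2 * h \<xi>)"
    by (rule integral_bdry(1)) measurable
  also have "(\<integral>\<^sub>C \<xi>. \<xi> * (\<xi> * h \<xi>)) = (\<integral>\<^sub>C \<xi>. \<xi>\<^sup>2 * h \<xi>)"
    by (simp add: power2_eq_square mult.assoc)
  finally show ?thesis by (simp add: power2_eq_square algebra_simps)
qed

end

subsection \<open>Lebesgue points on the circle\<close>

text \<open>The function is continuous off the nonnegative real axis and 0 on it, so it equals its
  product with an indicator.\<close>

lemma Arg2pi_borel_measurable: "Arg2pi \<in> borel_measurable borel"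
proof -
  have c: "continuous_on (- \<real>\<^sub>\<ge>\<^sub>0) Arg2pi"
    using continuous_at_Arg2pi by (auto intro!: continuous_at_imp_continuous_on)
  have "closed (\<real>\<^sub>\<ge>\<^sub>0 :: complex set)" by simp
  then have "(- \<real>\<^sub>\<ge>\<^sub>0 :: complex set) \<in> sets borel" by (intro borel_open) auto
  from borel_measurable_continuous_on_indicator[OF this c]
  have "(\<lambda>z. indicat_real (- \<real>\<^sub>\<ge>\<^sub>0) z *\<^sub>R Arg2pi z) \<in> borel_measurable borel" .
  moreover have "(\<lambda>z. indicat_real (- \<real>\<^sub>\<ge>\<^sub>0) z *\<^sub>R Arg2pi z) = Arg2pi"
    by (auto simp: fun_eq_iff indicator_def Arg2pi_eq_0 complex_nonneg_Reals_iff complex_is_Real_iff)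
  ultimately show ?thesis by simp
qed

lemma Arg2pi_cis: "0 \<le> t \<Longrightarrow> t < 2 * pi \<Longrightarrow> Arg2pi (cis t) = t"
  by (rule Arg2pi_unique[of 1]) (auto simp: cis_conv_exp)

lemma cis_Arg2pi: "norm \<xi> = 1 \<Longrightarrow> cis (Arg2pi \<xi>) = \<xi>"
  using Arg2pi_eq[of \<xi>] by (simp add: cis_conv_exp)

text \<open>The cubic Taylor error is at most two thirds of \<open>x\<close>, as
  \<open>x \<le> pi / 2 < 2\<close>. The bound serves to compare chords with arcs.\<close>

lemma sin_ge_third:
  assumes "0 \<le> x" "x \<le> pi / 2"
  shows "x / 3 \<le> sin x"
proof -
  have "\<bar>sin x - (\<Sum>m<3. sin_coeff m * x ^ m)\<bar> \<le> inverse (fact 3) * \<bar>x\<bar> ^ 3"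
    by (rule Maclaurin_sin_bound)
  then have "\<bar>sin x - x\<bar> \<le> x ^ 3 / 6"
    using assms by (simp add: numeral_3_eq_3 sin_coeff_def fact_numeral field_simps)
  moreover have "x ^ 3 / 6 \<le> x * (2 / 3)"
  proof -
    have "x * x \<le> 2 * 2" using assms pi_less_4 by (intro mult_mono) auto
    then have "x * (x * x) \<le> x * 4" using assms by (intro mult_left_mono) auto
    then show ?thesis by (simp add: power3_eq_cube)
  qed
  ultimately show ?thesis by linarith
qed

lemma norm_cis_diff: "norm (cis a - cis b) = 2 * \<bar>sin ((a - b) / 2)\<bar>"
proof -
  have "(norm (cis a - cis b))\<^sup>2 = 2 - 2 * cos (a - b)"
    unfolding cmod_power2 by (simp add: cos_diff power2_diff algebra_simps)
  also have "\<dots> = (2 * \<bar>sin ((a - b) / 2)\<bar>)\<^sup>2"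
  proof -
    have "2 * ((a - b) / 2) = a - b" by simp
    from cos_double_sin[of "(a - b) / 2", unfolded this] show ?thesis by (simp add: power_mult_distrib)
  qed
  finally show ?thesis by (rule power2_eq_imp_eq) auto
qed

lemma abs_sin_half_abs: "\<bar>sin (x / 2)\<bar> = \<bar>sin (\<bar>x\<bar> / 2)\<bar>" for x :: real
proof (cases "x \<ge> 0")
  case False
  then have "\<bar>x\<bar> / 2 = - (x / 2)" by simp
  then show ?thesis by (simp only: sin_minus abs_minus_cancel)
qed simp

text \<open>An arc is at most three times its chord. The bound on \<open>s\<close> keeps away from
  the endpoints of the parameter interval, where close points of the circle have distant
  parameters.\<close>

lemma cis_close:
  assumes t: "0 \<le> t" "t < 2 * pi" and t0: "0 < t0" "t0 < 2 * pi"
    and s: "norm (cis t - cis t0) \<le> s" "s < min t0 (2 * pi - t0) / 3"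
  shows "\<bar>t - t0\<bar> \<le> 3 * s"
proof (cases "\<bar>t - t0\<bar> \<le> pi")
  case True
  have "\<bar>sin ((t - t0) / 2)\<bar> = \<bar>sin (\<bar>t - t0\<bar> / 2)\<bar>"
    by (rule abs_sin_half_abs)
  moreover have "\<bar>t - t0\<bar> / 2 / 3 \<le> sin (\<bar>t - t0\<bar> / 2)"
    by (rule sin_ge_third) (use True in auto)
  ultimately have "\<bar>t - t0\<bar> / 6 \<le> \<bar>sin ((t - t0) / 2)\<bar>" by simp
  also have "\<dots> \<le> s / 2" using s norm_cis_diff[of t t0] by simp
  finally show ?thesis by simp
next
  case False
  \<comment> \<open>Half the length of the complementary arc, which has the same chord and contains
    one of the two pieces of the parameter interval outside \<open>t0\<close>.\<close>
  let ?u = "pi - \<bar>t - t0\<bar> / 2"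
  have d: "\<bar>t - t0\<bar> < 2 * pi" using t t0 by linarith
  have "\<bar>sin ((t - t0) / 2)\<bar> = \<bar>sin (\<bar>t - t0\<bar> / 2)\<bar>"
    by (rule abs_sin_half_abs)
  also have "sin (\<bar>t - t0\<bar> / 2) = sin ?u" by (simp only: sin_pi_minus)
  finally have e: "\<bar>sin ((t - t0) / 2)\<bar> = \<bar>sin ?u\<bar>" .
  have "?u / 3 \<le> sin ?u" by (rule sin_ge_third) (use False d in auto)
  moreover have "2 * ?u \<ge> min t0 (2 * pi - t0)" using t t0 by (auto simp: abs_if min_def)
  ultimately have "min t0 (2 * pi - t0) / 6 \<le> \<bar>sin ((t - t0) / 2)\<bar>"
    using abs_ge_self[of "sin ?u"] unfolding e by linarith
  also have "\<dots> \<le> s / 2" using s norm_cis_diff[of t t0] by simp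
  finally have False using s by simp
  then show ?thesis ..
qed

text \<open>Lebesgue differentiation for cubes with a given lower corner, which on the line are
  right-hand intervals.\<close>

lemma AE_right_differentiable:
  fixes k :: "real \<Rightarrow> real"
  assumes k: "integrable lborel k"
  shows "AE t in lborel. \<forall>e>0. \<exists>d>0. \<forall>h. 0 < h \<and> h < d \<longrightarrow> \<bar>(LINT x:{t..t + h}|lborel. k x) / h - k t\<bar> < e"
proof -
  have ki: "k integrable_on cbox a b" for a b
    using integrable_on_lborel[OF k] integrable_on_subcbox by blast
  obtain N where N: "negligible N"
    "\<And>x e. \<lbrakk>x \<notin> N; 0 < e\<rbrakk> \<Longrightarrow> \<exists>d>0. \<forall>h. 0 < h \<and> h < d \<longrightarrow>
        norm (integral (cbox x (x + h *\<^sub>R One)) k /\<^sub>R h ^ DIM(real) - k x) < e"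
    using integrable_ccontinuous_explicit[OF ki] by blast
  have "AE t in lebesgue. t \<notin> N"
    using N(1) by (intro AE_not_in) (simp add: negligible_iff_null_sets)
  then have "AE t in lborel. t \<notin> N" using AE_completion_iff by blast
  then show ?thesis
  proof eventually_elim
    case (elim t)
    have eq: "integral (cbox t (t + h *\<^sub>R One)) k /\<^sub>R h ^ DIM(real) = (LINT x:{t..t + h}|lborel. k x) / h" for h
    proof -
      have "set_integrable lborel {t..t + h} k" using k
        by (rule set_integrable_subset[where A = UNIV, simplified, unfolded set_integrable_def, simplified, folded set_integrable_def]) auto
      then show ?thesis
        by (simp add: set_borel_integral_eq_integral(2) divide_inverse mult.commute)
    qed
    show ?case using N(2)[OF elim] unfolding eq real_norm_def by blast
  qed
qed

text \<open>The reflection of the line preserves Lebesgue measure and exchanges the two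
  sides.\<close>

lemma AE_left_differentiable:
  fixes k :: "real \<Rightarrow> real"
  assumes k: "integrable lborel k"
  shows "AE t in lborel. \<forall>e>0. \<exists>d>0. \<forall>h. 0 < h \<and> h < d \<longrightarrow> \<bar>(LINT x:{t - h..t}|lborel. k x) / h - k t\<bar> < e"
proof -
  have k': "integrable lborel (\<lambda>x. k (- x))"
    using lborel_integrable_real_affine[OF k, of "-1" 0] by simp
  have "AE t in distr lborel borel uminus. \<forall>e>0. \<exists>d>0. \<forall>h. 0 < h \<and> h < d \<longrightarrow>
      \<bar>(LINT x:{t..t + h}|lborel. k (- x)) / h - k (- t)\<bar> < e"
    unfolding lborel_distr_uminus by (rule AE_right_differentiable[OF k'])
  from AE_distrD[OF _ this]
  have "AE t in lborel. \<forall>e>0. \<exists>d>0. \<forall>h. 0 < h \<and> h < d \<longrightarrow>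
      \<bar>(LINT x:{- t..- t + h}|lborel. k (- x)) / h - k t\<bar> < e" by simp
  moreover have "(LINT x:{- t..- t + h}|lborel. k (- x)) = (LINT x:{t - h..t}|lborel. k x)" for t h
  proof -
    have "(LINT x:{t - h..t}|lborel. k x) = (\<integral>x. indicator {t - h..t} (0 + (-1) * x) *\<^sub>R k (0 + (-1) * x) \<partial>lborel)"
      unfolding set_lebesgue_integral_def by (subst lborel_integral_real_affine[where c = "-1" and t = 0]) auto
    also have "\<dots> = (LINT x:{- t..- t + h}|lborel. k (- x))"
      unfolding set_lebesgue_integral_def
      by (intro Bochner_Integration.integral_cong) (auto simp: indicator_def)
    finally show ?thesis ..
  qed
  ultimately show ?thesis by simp
qed

text \<open>The function to be differentiated depends on the point through \<open>g \<xi>0\<close>.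
  Differentiating \<open>norm (g - q)\<close> for the countably many \<open>q\<close> of a dense set
  leaves a single null set, and then some \<open>q\<close> close to \<open>g \<xi>0\<close> is
  chosen.\<close>

lemma AE_lebesgue_point:
  fixes g :: "complex \<Rightarrow> complex"
  assumes g: "integrable circle_measure g"
  shows "AE \<xi>0 in circle_measure. \<forall>\<epsilon>>0. \<exists>s0>0. \<forall>s. 0 < s \<and> s < s0 \<longrightarrow>
    (\<integral>\<^sub>C \<xi>. indicator {\<xi>. norm (\<xi> - \<xi>0) \<le> s} \<xi> * norm (g \<xi> - g \<xi>0)) \<le> \<epsilon> * s"
proof -
  have gm [measurable]: "g \<in> borel_measurable circle_measure" by (rule borel_measurable_integrable[OF g])
  define J where "J = {0..<2 * pi}"
  define k where "k q t = indicator J t * norm (g (cis t) - q)" for q t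
  have J [measurable]: "J \<in> sets borel" by (simp add: J_def)
  have gi: "set_integrable lborel J (\<lambda>t. g (cis t) - q)" for q
  proof -
    have "integrable circle_measure (\<lambda>\<xi>. g \<xi> - q)" using g by simp
    then show ?thesis using integral_circle(2)[of "\<lambda>\<xi>. g \<xi> - q"] by (simp add: J_def)
  qed
  have ki: "integrable lborel (k q)" for q
    using set_integrable_norm[OF gi[of q]] by (simp add: k_def[abs_def] set_integrable_def)
  obtain D :: "complex set" where D: "countable D" "\<And>X. open X \<Longrightarrow> X \<noteq> {} \<Longrightarrow> \<exists>d\<in>D. d \<in> X"
    by (rule countable_dense_setE) blast
  have "AE t in lborel. \<forall>q\<in>D. \<forall>e>0. \<exists>d>0. \<forall>h. 0 < h \<and> h < d \<longrightarrow> \<bar>(LINT x:{t..t + h}|lborel. k q x) / h - k q t\<bar> < e"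
    using D(1) AE_right_differentiable[OF ki] by (simp add: AE_ball_countable)
  moreover have "AE t in lborel. \<forall>q\<in>D. \<forall>e>0. \<exists>d>0. \<forall>h. 0 < h \<and> h < d \<longrightarrow> \<bar>(LINT x:{t - h..t}|lborel. k q x) / h - k q t\<bar> < e"
    using D(1) AE_left_differentiable[OF ki] by (simp add: AE_ball_countable)
  \<comment> \<open>At parameter 0 a neighbourhood on the circle would split into two
    intervals.\<close>
  moreover have "AE t in lborel. t \<noteq> 0" by (rule AE_lborel_singleton)
  ultimately have "AE t in lborel. t \<noteq> 0 \<and>
      (\<forall>q\<in>D. \<forall>e>0. \<exists>d>0. \<forall>h. 0 < h \<and> h < d \<longrightarrow> \<bar>(LINT x:{t..t + h}|lborel. k q x) / h - k q t\<bar> < e) \<and>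
      (\<forall>q\<in>D. \<forall>e>0. \<exists>d>0. \<forall>h. 0 < h \<and> h < d \<longrightarrow> \<bar>(LINT x:{t - h..t}|lborel. k q x) / h - k q t\<bar> < e)"
    by eventually_elim auto
  then obtain N where N: "N \<in> null_sets lborel" and
    good: "\<And>t. t \<notin> N \<Longrightarrow> t \<noteq> 0 \<and>
      (\<forall>q\<in>D. \<forall>e>0. \<exists>d>0. \<forall>h. 0 < h \<and> h < d \<longrightarrow> \<bar>(LINT x:{t..t + h}|lborel. k q x) / h - k q t\<bar> < e) \<and>
      (\<forall>q\<in>D. \<forall>e>0. \<exists>d>0. \<forall>h. 0 < h \<and> h < d \<longrightarrow> \<bar>(LINT x:{t - h..t}|lborel. k q x) / h - k q t\<bar> < e)"
    by (elim AE_E3) auto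
  have N': "N \<in> sets borel" using N by (simp add: null_sets_def)
  have "AE \<xi> in circle_measure. Arg2pi \<xi> \<notin> N"
  proof (subst AE_circle_iff)
    show "Measurable.pred circle_measure (\<lambda>\<xi>. Arg2pi \<xi> \<notin> N)"
      using borel_measurable_circleI[OF Arg2pi_borel_measurable] N' by measurable
    have "AE t in lborel. t \<notin> N" by (rule AE_not_in[OF N])
    then show "AE t in lborel. t \<in> {0..<2 * pi} \<longrightarrow> Arg2pi (cis t) \<notin> N"
      by eventually_elim (auto simp: Arg2pi_cis)
  qed
  moreover have "AE \<xi> in circle_measure. norm \<xi> = 1" by (rule AE_norm_circle)
  ultimately show ?thesis
  proof eventually_elim
    case (elim \<xi>0)
    define t0 where "t0 = Arg2pi \<xi>0"
    have x0: "\<xi>0 = cis t0" using cis_Arg2pi[OF elim(2)] by (simp add: t0_def)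
    have t0N: "t0 \<notin> N" using elim by (simp add: t0_def)
    have t0: "0 < t0" "t0 < 2 * pi"
      using good[OF t0N] Arg2pi_ge_0[of \<xi>0] Arg2pi_lt_2pi[of \<xi>0] by (auto simp: t0_def)
    then have t0J: "t0 \<in> J" by (simp add: J_def)
    note R = good[OF t0N, THEN conjunct2, THEN conjunct1] and L = good[OF t0N, THEN conjunct2, THEN conjunct2]
    show ?case
    proof (intro allI impI)
      fix \<epsilon> :: real assume e: "\<epsilon> > 0"
      obtain q where q: "q \<in> D" "norm (g \<xi>0 - q) < \<epsilon> / 6"
        using D(2)[of "ball (g \<xi>0) (\<epsilon> / 6)"] e by (auto simp: dist_norm)
      have kq: "k q t0 < \<epsilon> / 6" using q t0J by (simp add: k_def x0)
      obtain d1 where d1: "d1 > 0" "\<And>h. 0 < h \<and> h < d1 \<Longrightarrow> \<bar>(LINT x:{t0..t0 + h}|lborel. k q x) / h - k q t0\<bar> < \<epsilon> / 6"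
        using R[rule_format, OF q(1), of "\<epsilon> / 6"] e by auto
      obtain d2 where d2: "d2 > 0" "\<And>h. 0 < h \<and> h < d2 \<Longrightarrow> \<bar>(LINT x:{t0 - h..t0}|lborel. k q x) / h - k q t0\<bar> < \<epsilon> / 6"
        using L[rule_format, OF q(1), of "\<epsilon> / 6"] e by auto
      \<comment> \<open>The first part keeps \<open>3 * s\<close> below both differentiation scales,
        the second is the condition of \<open>cis_close\<close>.\<close>
      define s0 where "s0 = min (min d1 d2 / 3) (min t0 (2 * pi - t0) / 3)"
      have s0: "s0 > 0" using d1 d2 t0 by (simp add: s0_def)
      show "\<exists>s0>0. \<forall>s. 0 < s \<and> s < s0 \<longrightarrow>
        (\<integral>\<^sub>C \<xi>. indicator {\<xi>. norm (\<xi> - \<xi>0) \<le> s} \<xi> * norm (g \<xi> - g \<xi>0)) \<le> \<epsilon> * s"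
      proof (rule exI[of _ s0], intro conjI allI impI s0)
        fix s assume s: "0 < s \<and> s < s0"
        let ?h = "3 * s"
        have h: "0 < ?h \<and> ?h < d1" "0 < ?h \<and> ?h < d2" "s < min t0 (2 * pi - t0) / 3"
          using s by (auto simp: s0_def)
        have si: "set_integrable lborel A (k q)" if "A \<in> sets borel" for A
          unfolding set_integrable_def using integrable_mult_indicator[OF _ ki] that by simp
        have b1: "(LINT x:{t0..t0 + ?h}|lborel. k q x) \<le> \<epsilon> / 3 * ?h"
        proof -
          have "(LINT x:{t0..t0 + ?h}|lborel. k q x) / ?h \<le> \<epsilon> / 3" using d1(2)[OF h(1)] kq by linarith
          then show ?thesis using s by (simp add: field_simps)
        qed
        have b2: "(LINT x:{t0 - ?h..t0}|lborel. k q x) \<le> \<epsilon> / 3 * ?h"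
        proof -
          have "(LINT x:{t0 - ?h..t0}|lborel. k q x) / ?h \<le> \<epsilon> / 3" using d2(2)[OF h(2)] kq by linarith
          then show ?thesis using s by (simp add: field_simps)
        qed
        let ?F = "\<lambda>\<xi>. indicat_real {\<xi>. norm (\<xi> - \<xi>0) \<le> s} \<xi> * norm (g \<xi> - g \<xi>0)"
        \<comment> \<open>Within distance \<open>s\<close> of \<xi>0 the parameter lies within
          \<open>?h = 3 * s\<close> of \<open>t0\<close>; the last summand pays for replacing
          \<open>g \<xi>0\<close> by \<open>q\<close>. Each of the three terms integrates to at most
          \<open>\<epsilon> * s\<close>, and normalization divides by \<open>2 * pi\<close>, which
          exceeds 3.\<close>
        let ?G = "\<lambda>x. indicator {t0..t0 + ?h} x *\<^sub>R k q x + indicator {t0 - ?h..t0} x *\<^sub>R k q x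
            + indicator {t0 - ?h..t0 + ?h} x * (\<epsilon> / 6)"
        have Fm: "?F \<in> borel_measurable circle_measure"
        proof -
          have "{\<xi>. norm (\<xi> - \<xi>0) \<le> s} \<in> sets borel" by measurable
          then have "indicat_real {\<xi>. norm (\<xi> - \<xi>0) \<le> s} \<in> borel_measurable circle_measure"
            by (intro borel_measurable_circleI borel_measurable_indicator)
          then show ?thesis by measurable
        qed
        have Fi: "integrable circle_measure ?F"
        proof (rule Bochner_Integration.integrable_bound)
          show "integrable circle_measure (\<lambda>\<xi>. g \<xi> - g \<xi>0)" using g by simp
        qed (use Fm in \<open>auto simp: indicator_def\<close>)
        have "(LINT t:J|lborel. ?F (cis t)) \<le> (\<integral>x. ?G x \<partial>lborel)"
          unfolding set_lebesgue_integral_def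
        proof (rule integral_mono)
          show "integrable lborel (\<lambda>t. indicator J t *\<^sub>R ?F (cis t))"
            using Fi integral_circle(2)[OF Fm] by (simp add: J_def set_integrable_def)
          show "integrable lborel ?G"
            using si[of "{t0..t0 + ?h}"] si[of "{t0 - ?h..t0}"]
            by (intro Bochner_Integration.integrable_add integrable_mult_left)
              (auto simp: set_integrable_def emeasure_lborel_Icc_eq intro!: integrable_real_indicator)
          fix x
          show "indicator J x *\<^sub>R ?F (cis x) \<le> ?G x"
          proof (cases "x \<in> J \<and> norm (cis x - \<xi>0) \<le> s")
            case True
            then have x: "\<bar>x - t0\<bar> \<le> ?h" using cis_close[of x t0 s] h t0 by (auto simp: J_def x0)
            have "norm (g (cis x) - g \<xi>0) \<le> norm (g (cis x) - q) + norm (g \<xi>0 - q)"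
              using norm_triangle_ineq4[of "g (cis x) - q" "g \<xi>0 - q"] by simp
            also have "\<dots> \<le> k q x + \<epsilon> / 6" using True q by (simp add: k_def)
            finally have "norm (g (cis x) - g \<xi>0) \<le> k q x + \<epsilon> / 6" .
            moreover have "0 \<le> k q x" by (simp add: k_def)
            ultimately show ?thesis using True x by (auto simp: indicator_def abs_le_iff)
          next
            case False
            moreover have "0 \<le> k q x" by (simp add: k_def)
            ultimately show ?thesis using e by (auto simp: indicator_def)
          qed
        qed
        also have "\<dots> = (LINT x:{t0..t0 + ?h}|lborel. k q x) + (LINT x:{t0 - ?h..t0}|lborel. k q x) + 2 * ?h * (\<epsilon> / 6)"
          unfolding set_lebesgue_integral_def
          using si[of "{t0..t0 + ?h}"] si[of "{t0 - ?h..t0}"] s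
          by (simp add: set_integrable_def)
        also have "\<dots> \<le> 3 * \<epsilon> * s" using b1 b2 by (simp add: algebra_simps)
        finally have "(LINT t:J|lborel. ?F (cis t)) \<le> 3 * \<epsilon> * s" .
        then have "(\<integral>\<^sub>C \<xi>. ?F \<xi>) \<le> 3 * \<epsilon> * s / (2 * pi)"
          unfolding integral_circle(1)[OF Fm] J_def[symmetric] using pi_gt_zero
          by (simp add: field_simps)
        also have "\<dots> \<le> \<epsilon> * s"
        proof -
          have "3 * (\<epsilon> * s) \<le> 2 * pi * (\<epsilon> * s)" using e s pi_gt3 by (intro mult_right_mono) auto
          then show ?thesis using pi_gt_zero by (simp add: field_simps)
        qed
        finally show "(\<integral>\<^sub>C \<xi>. ?F \<xi>) \<le> \<epsilon> * s" .
      qed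
    qed
  qed
qed

subsection \<open>Fatou's theorem for Poisson integrals\<close>

lemma dyadic_scale:
  fixes d s0 :: real
  assumes "0 < d" "d < s0"
  obtains J :: nat where "2 ^ J * d < s0" "s0 \<le> 2 ^ Suc J * d"
proof -
  obtain n where "s0 / d < 2 ^ n" using real_arch_pow[of 2 "s0 / d"] by auto
  then have ex: "s0 \<le> 2 ^ Suc n * d" using assms by (simp add: field_simps)
  define J where "J = (LEAST n. s0 \<le> 2 ^ Suc n * d)"
  have J: "s0 \<le> 2 ^ Suc J * d" unfolding J_def by (rule LeastI[of "\<lambda>n. s0 \<le> 2 ^ Suc n * d", OF ex])
  have "2 ^ J * d < s0"
  proof (cases J)
    case (Suc m)
    then have "\<not> s0 \<le> 2 ^ Suc m * d" using not_less_Least[of m "\<lambda>n. s0 \<le> 2 ^ Suc n * d"] by (simp add: J_def)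
    then show ?thesis using Suc by simp
  qed (use assms in simp)
  with J that show ?thesis by blast
qed

text \<open>By the Stolz condition \<open>norm (z - \<xi>0)\<close> is at most \<alpha> times
  \<open>1 - norm z\<close>, hence at most \<alpha> times \<open>norm (\<xi> - z)\<close>. Approach
  within the region thus costs only the constant 1 + \<alpha> compared with radial approach.\<close>

lemma stolz_distance:
  assumes "z \<in> stolz_region \<alpha> \<xi>0" "norm \<xi> = 1"
  shows "norm (\<xi> - \<xi>0) \<le> (1 + \<alpha>) * norm (\<xi> - z)"
proof -
  have "1 - norm z \<le> norm (\<xi> - z)" using norm_triangle_ineq2[of \<xi> z] assms by simp
  have "0 < 1 - norm z" "norm (z - \<xi>0) < \<alpha> * (1 - norm z)" using assms by (auto simp: stolz_region_def)
  then have "0 < \<alpha>" by (metis less_le_trans norm_ge_zero not_less zero_less_mult_pos2 order_le_less_trans)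
  have "norm (\<xi> - \<xi>0) \<le> norm (\<xi> - z) + norm (z - \<xi>0)" using norm_triangle_ineq[of "\<xi> - z" "z - \<xi>0"] by simp
  also have "\<dots> \<le> norm (\<xi> - z) + \<alpha> * norm (\<xi> - z)"
    using \<open>1 - norm z \<le> _\<close> \<open>0 < \<alpha>\<close> \<open>norm (z - \<xi>0) < _\<close> mult_left_mono[of "1 - norm z" "norm (\<xi> - z)" \<alpha>]
    by linarith
  finally show ?thesis by (simp add: algebra_simps)
qed

text \<open>On the ring between the radii \<open>2 ^ k * d\<close> and \<open>2 ^ Suc k * d\<close>,
  where \<open>d = 1 - norm z\<close>, the kernel is at most
  \<open>2 * A\<^sup>2 * d / (2 ^ k * d)\<^sup>2\<close>. Written with the outer index this is the
  weight of the disc, which explains the factor 8; points outside all discs have distance at least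
  \<open>s0 / 2\<close>.\<close>

lemma poisson_kernel_dyadic:
  assumes z: "norm z < 1" and A: "A \<ge> 1" and x: "norm \<xi> = 1"
    and st: "norm (\<xi> - \<xi>0) \<le> A * norm (\<xi> - z)"
    and J: "s0 \<le> 2 ^ Suc J * (1 - norm z)" and s0: "0 < s0"
  shows "poisson_kernel z \<xi> \<le>
    (\<Sum>j\<le>J. 8 * A\<^sup>2 / (4 ^ j * (1 - norm z)) * indicator {\<xi>. norm (\<xi> - \<xi>0) \<le> 2 ^ j * (1 - norm z)} \<xi>)
    + 8 * A\<^sup>2 * (1 - norm z) / s0\<^sup>2"
proof -
  define d where "d = 1 - norm z"
  have d: "0 < d" using z by (simp add: d_def)
  have dx: "d \<le> norm (\<xi> - z)" using norm_triangle_ineq2[of \<xi> z] x by (simp add: d_def)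
  let ?c = "\<lambda>j. 8 * A\<^sup>2 / (4 ^ j * d) * indicator {\<xi>. norm (\<xi> - \<xi>0) \<le> 2 ^ j * d} \<xi>"
  have A2: "1 \<le> A\<^sup>2" using A by simp
  have far: "poisson_kernel z \<xi> \<le> 2 * A\<^sup>2 * d / s\<^sup>2" if s: "0 < s" "s \<le> norm (\<xi> - \<xi>0)" for s
  proof -
    have "s / A \<le> norm (\<xi> - z)" using st s A by (simp add: field_simps)
    then have "poisson_kernel z \<xi> \<le> 2 * d / (s / A)\<^sup>2"
      unfolding d_def using z s A by (intro poisson_kernel_upper) auto
    then show ?thesis using A s by (simp add: power_divide field_simps)
  qed
  have near: "poisson_kernel z \<xi> \<le> 2 / d"
    using poisson_kernel_upper[OF z d dx] d by (simp add: d_def[symmetric] power2_eq_square)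
  have c_nonneg: "0 \<le> ?c j" for j using d by (simp add: indicator_def)
  have rest: "0 \<le> 8 * A\<^sup>2 * d / s0\<^sup>2" using d by simp
  show ?thesis
    unfolding d_def[symmetric]
  proof (cases "norm (\<xi> - \<xi>0) \<le> 2 ^ J * d")
    case True
    \<comment> \<open>The smallest dyadic disc containing \<xi>: minimality supplies the lower bound
      on the distance, and its summand alone dominates the kernel.\<close>
    define m where "m = (LEAST j. norm (\<xi> - \<xi>0) \<le> 2 ^ j * d)"
    have m: "norm (\<xi> - \<xi>0) \<le> 2 ^ m * d" unfolding m_def by (rule LeastI[of "\<lambda>j. norm (\<xi> - \<xi>0) \<le> 2 ^ j * d", OF True])
    have mJ: "m \<le> J" unfolding m_def by (rule Least_le[of "\<lambda>j. norm (\<xi> - \<xi>0) \<le> 2 ^ j * d", OF True])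
    have "poisson_kernel z \<xi> \<le> 8 * A\<^sup>2 / (4 ^ m * d)"
    proof (cases m)
      case 0
      have "2 / d \<le> 8 * A\<^sup>2 / d" using d A2 by (intro divide_right_mono) auto
      then show ?thesis using near 0 by simp
    next
      case (Suc k)
      have "2 ^ k * d \<le> norm (\<xi> - \<xi>0)"
        using not_less_Least[of k "\<lambda>j. norm (\<xi> - \<xi>0) \<le> 2 ^ j * d"] Suc by (simp add: m_def)
      then have "poisson_kernel z \<xi> \<le> 2 * A\<^sup>2 * d / (2 ^ k * d)\<^sup>2" using d by (intro far) auto
      also have "\<dots> = 8 * A\<^sup>2 / (4 ^ m * d)"
      proof -
        have "((2::real) ^ k)\<^sup>2 = 4 ^ k" by (simp add: power2_eq_square power_mult_distrib[symmetric])
        then show ?thesis using d Suc by (simp add: power_mult_distrib power2_eq_square[of d] field_simps)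
      qed
      finally show ?thesis .
    qed
    also have "\<dots> = ?c m" using m by simp
    also have "\<dots> \<le> (\<Sum>j\<le>J. ?c j)" using mJ c_nonneg by (intro member_le_sum) auto
    finally show "poisson_kernel z \<xi> \<le> (\<Sum>j\<le>J. ?c j) + 8 * A\<^sup>2 * d / s0\<^sup>2" using rest by linarith
  next
    case False
    have "s0 / 2 \<le> 2 ^ J * d" using J by (simp add: d_def)
    then have "poisson_kernel z \<xi> \<le> 2 * A\<^sup>2 * d / (s0 / 2)\<^sup>2" using False s0 by (intro far) auto
    also have "\<dots> = 8 * A\<^sup>2 * d / s0\<^sup>2" by (simp add: power_divide)
    finally have "poisson_kernel z \<xi> \<le> 8 * A\<^sup>2 * d / s0\<^sup>2" .
    moreover have "0 \<le> (\<Sum>j\<le>J. ?c j)" by (intro sum_nonneg c_nonneg)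
    ultimately show "poisson_kernel z \<xi> \<le> (\<Sum>j\<le>J. ?c j) + 8 * A\<^sup>2 * d / s0\<^sup>2" by linarith
  qed
qed

text \<open>The disc of radius \<open>2 ^ j * d\<close> has weight of order
  \<open>1 / (4 ^ j * d)\<close>, while the deviation of \<open>g\<close> has integral at most
  \<open>\<epsilon> * 2 ^ j * d\<close> over it. The scale \<open>d\<close> cancels and a geometric
  series in \<open>j\<close> remains.\<close>

lemma fatou_at_lebesgue_point:
  fixes g :: "complex \<Rightarrow> complex"
  assumes g: "integrable circle_measure g" and x0: "norm \<xi>0 = 1"
    and leb: "\<And>\<epsilon>. \<epsilon> > 0 \<Longrightarrow> \<exists>s0>0. \<forall>s. 0 < s \<and> s < s0 \<longrightarrow>
      (\<integral>\<^sub>C \<xi>. indicator {\<xi>. norm (\<xi> - \<xi>0) \<le> s} \<xi> * norm (g \<xi> - g \<xi>0)) \<le> \<epsilon> * s"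
  shows "has_nontangential_limit (\<lambda>z. \<integral>\<^sub>C \<xi>. poisson_kernel z \<xi> *\<^sub>R g \<xi>) \<xi>0 (g \<xi>0)"
  unfolding has_nontangential_limit_def
proof (intro allI impI tendstoI)
  fix \<alpha> e :: real assume \<alpha>: "\<alpha> > 1" and e: "e > 0"
  define A where "A = 1 + \<alpha>"
  have A: "A \<ge> 1" using \<alpha> by (simp add: A_def)
  define k where "k \<xi> = norm (g \<xi> - g \<xi>0)" for \<xi>
  have ki: "integrable circle_measure k" unfolding k_def using g by simp
  have k0: "0 \<le> k \<xi>" for \<xi> by (simp add: k_def)
  define K where "K = (\<integral>\<^sub>C \<xi>. k \<xi>)"
  have K: "0 \<le> K" unfolding K_def using k0 by simp
  \<comment> \<open>The geometric series sums to at most 2, so the discs contribute at most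
    \<open>16 * A\<^sup>2 * \<epsilon> = e / 2\<close>.\<close>
  define \<epsilon> where "\<epsilon> = e / (32 * A\<^sup>2)"
  have A2: "A\<^sup>2 > 0" using A by simp
  have \<epsilon>: "\<epsilon> > 0" using e A2 by (simp add: \<epsilon>_def)
  obtain s0 where s0: "s0 > 0" and leb': "\<And>s. 0 < s \<Longrightarrow> s < s0 \<Longrightarrow>
      (\<integral>\<^sub>C \<xi>. indicator {\<xi>. norm (\<xi> - \<xi>0) \<le> s} \<xi> * k \<xi>) \<le> \<epsilon> * s"
    using leb[OF \<epsilon>] unfolding k_def by blast
  \<comment> \<open>The second bound makes the part far from \<xi>0 less than \<open>e / 2\<close>;
    \<open>K + 1\<close> guards against \<open>K = 0\<close>.\<close>
  define \<eta> where "\<eta> = min s0 (e / (2 * (8 * A\<^sup>2 / s0\<^sup>2 * (K + 1))))"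
  have \<eta>: "\<eta> > 0" using s0 e A2 K by (simp add: \<eta>_def)
  have main: "dist (\<integral>\<^sub>C \<xi>. poisson_kernel z \<xi> *\<^sub>R g \<xi>) (g \<xi>0) < e"
    if zs: "z \<in> stolz_region \<alpha> \<xi>0" and zd: "norm (z - \<xi>0) < \<eta>" for z
  proof -
    have z: "norm z < 1" using zs by (simp add: stolz_region_def)
    define d where "d = 1 - norm z"
    have d: "0 < d" using z by (simp add: d_def)
    have d\<eta>: "d < \<eta>" using norm_triangle_ineq2[of \<xi>0 z] zd x0 by (simp add: d_def norm_minus_commute)
    then have "d < s0" by (simp add: \<eta>_def)
    then obtain J where J: "2 ^ J * d < s0" "s0 \<le> 2 ^ Suc J * d" using dyadic_scale[OF d] by blast
    let ?B = "\<lambda>j. indicat_real {\<xi>. norm (\<xi> - \<xi>0) \<le> 2 ^ j * d}"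
    let ?c = "\<lambda>j. 8 * A\<^sup>2 / (4 ^ j * d)"
    have Bm: "?B j \<in> borel_measurable circle_measure" for j
    proof -
      have "{\<xi>. norm (\<xi> - \<xi>0) \<le> 2 ^ j * d} \<in> sets borel" by measurable
      then show ?thesis by (intro borel_measurable_circleI borel_measurable_indicator)
    qed
    have Bi: "integrable circle_measure (\<lambda>\<xi>. ?B j \<xi> * k \<xi>)" for j
    proof (rule Bochner_Integration.integrable_bound[OF ki])
      show "(\<lambda>\<xi>. ?B j \<xi> * k \<xi>) \<in> borel_measurable circle_measure"
        using Bm borel_measurable_integrable[OF ki] by measurable
    qed (auto simp: indicator_def k0)
    have "norm ((\<integral>\<^sub>C \<xi>. poisson_kernel z \<xi> *\<^sub>R g \<xi>) - g \<xi>0) =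
        norm (\<integral>\<^sub>C \<xi>. poisson_kernel z \<xi> *\<^sub>R (g \<xi> - g \<xi>0))"
    proof -
      have "(\<integral>\<^sub>C \<xi>. poisson_kernel z \<xi> *\<^sub>R g \<xi>0) = g \<xi>0"
        using integral_poisson_kernel[OF z] integrable_poisson_kernel[OF z]
        by (subst integral_scaleR_left) auto
      then show ?thesis
        using integrable_poisson_mult[OF z g] integrable_poisson_kernel[OF z]
        by (simp add: scaleR_diff_right)
    qed
    also have "\<dots> \<le> (\<integral>\<^sub>C \<xi>. norm (poisson_kernel z \<xi> *\<^sub>R (g \<xi> - g \<xi>0)))"
      by (rule integral_norm_bound)
    also have "\<dots> = (\<integral>\<^sub>C \<xi>. poisson_kernel z \<xi> * k \<xi>)"
      using poisson_kernel_nonneg[OF z] by (simp add: k_def)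
    also have "\<dots> \<le> (\<integral>\<^sub>C \<xi>. (\<Sum>j\<le>J. ?c j * (?B j \<xi> * k \<xi>)) + 8 * A\<^sup>2 * d / s0\<^sup>2 * k \<xi>)"
    proof (rule circle_integral_mono)
      show "integrable circle_measure (\<lambda>\<xi>. poisson_kernel z \<xi> * k \<xi>)"
        using integrable_poisson_mult[OF z ki] by simp
      show "integrable circle_measure (\<lambda>\<xi>. (\<Sum>j\<le>J. ?c j * (?B j \<xi> * k \<xi>)) + 8 * A\<^sup>2 * d / s0\<^sup>2 * k \<xi>)"
        by (intro Bochner_Integration.integrable_add Bochner_Integration.integrable_sum integrable_mult_right Bi ki)
      fix \<xi> :: complex assume x: "norm \<xi> = 1"
      have "poisson_kernel z \<xi> \<le> (\<Sum>j\<le>J. ?c j * ?B j \<xi>) + 8 * A\<^sup>2 * d / s0\<^sup>2"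
        unfolding d_def
        by (rule poisson_kernel_dyadic[OF z A x]) (use stolz_distance[OF zs x] J s0 in \<open>auto simp: A_def d_def\<close>)
      from mult_right_mono[OF this k0[of \<xi>]]
      show "poisson_kernel z \<xi> * k \<xi> \<le> (\<Sum>j\<le>J. ?c j * (?B j \<xi> * k \<xi>)) + 8 * A\<^sup>2 * d / s0\<^sup>2 * k \<xi>"
        by (simp add: distrib_right sum_distrib_right mult.assoc)
    qed
    also have "\<dots> = (\<Sum>j\<le>J. ?c j * (\<integral>\<^sub>C \<xi>. ?B j \<xi> * k \<xi>)) + 8 * A\<^sup>2 * d / s0\<^sup>2 * K"
      unfolding K_def
      by (subst Bochner_Integration.integral_add, (intro Bochner_Integration.integrable_sum integrable_mult_right Bi ki)+,
          subst Bochner_Integration.integral_sum, intro integrable_mult_right Bi) simp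
    also have "(\<Sum>j\<le>J. ?c j * (\<integral>\<^sub>C \<xi>. ?B j \<xi> * k \<xi>)) \<le> (\<Sum>j\<le>J. 8 * A\<^sup>2 * \<epsilon> * (1 / 2) ^ j)"
    proof (rule sum_mono)
      fix j assume "j \<in> {..J}"
      then have "(2::real) ^ j \<le> 2 ^ J" by (intro power_increasing) auto
      then have "2 ^ j * d \<le> 2 ^ J * d" using d by (intro mult_right_mono) auto
      then have "2 ^ j * d < s0" using J by linarith
      then have "(\<integral>\<^sub>C \<xi>. ?B j \<xi> * k \<xi>) \<le> \<epsilon> * (2 ^ j * d)" using d by (intro leb') auto
      then have "?c j * (\<integral>\<^sub>C \<xi>. ?B j \<xi> * k \<xi>) \<le> ?c j * (\<epsilon> * (2 ^ j * d))"
        using d by (intro mult_left_mono) auto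
      also have "\<dots> = 8 * A\<^sup>2 * \<epsilon> * (1 / 2) ^ j"
      proof -
        have "(4::real) ^ j = 2 ^ j * 2 ^ j" by (simp add: power_mult_distrib[symmetric])
        then show ?thesis using d by (simp add: field_simps power_divide)
      qed
      finally show "?c j * (\<integral>\<^sub>C \<xi>. ?B j \<xi> * k \<xi>) \<le> 8 * A\<^sup>2 * \<epsilon> * (1 / 2) ^ j" .
    qed
    also have "(\<Sum>j\<le>J. 8 * A\<^sup>2 * \<epsilon> * (1 / 2) ^ j) \<le> 8 * A\<^sup>2 * \<epsilon> * 2"
    proof -
      have "(\<Sum>j\<le>J. (1 / 2 :: real) ^ j) = 2 - (1 / 2) ^ J"
        by (induction J) auto
      then have "(\<Sum>j\<le>J. (1 / 2 :: real) ^ j) \<le> 2" by simp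
      then show ?thesis unfolding sum_distrib_left[symmetric] using \<epsilon> by (intro mult_left_mono) auto
    qed
    also have "8 * A\<^sup>2 * \<epsilon> * 2 = e / 2" using A2 by (simp add: \<epsilon>_def)
    also have "8 * A\<^sup>2 * d / s0\<^sup>2 * K < e / 2"
    proof -
      define M where "M = 8 * A\<^sup>2 / s0\<^sup>2 * (K + 1)"
      have "M > 0" unfolding M_def using A2 s0 K by simp
      moreover have "d < e / (2 * M)" using d\<eta> by (simp add: \<eta>_def M_def)
      ultimately have "d * M < e / 2" by (simp add: field_simps)
      then have "d * (8 * A\<^sup>2 / s0\<^sup>2 * (K + 1)) < e / 2" by (simp only: M_def)
      moreover have "8 * A\<^sup>2 * d / s0\<^sup>2 * K \<le> d * (8 * A\<^sup>2 / s0\<^sup>2 * (K + 1))"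
        using d s0 A2 K by (simp add: field_simps)
      ultimately show ?thesis by linarith
    qed
    finally show ?thesis by (simp add: dist_norm)
  qed
  show "eventually (\<lambda>z. dist (\<integral>\<^sub>C \<xi>. poisson_kernel z \<xi> *\<^sub>R g \<xi>) (g \<xi>0) < e) (at \<xi>0 within stolz_region \<alpha> \<xi>0)"
    unfolding eventually_at using \<eta> main by (auto simp: dist_norm)
qed

theorem fatou_poisson:
  fixes g :: "complex \<Rightarrow> complex"
  assumes g: "integrable circle_measure g"
  shows "AE \<xi> in circle_measure.
    has_nontangential_limit (\<lambda>z. \<integral>\<^sub>C \<xi>. poisson_kernel z \<xi> *\<^sub>R g \<xi>) \<xi> (g \<xi>)"
  using AE_lebesgue_point[OF g] AE_norm_circle
  by eventually_elim (rule fatou_at_lebesgue_point[OF g], auto)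

section \<open>Nontangential and radial limits\<close>

lemma eventually_radius_stolz:
  assumes "norm \<xi> = 1" "\<alpha> > 1"
  shows "filterlim (\<lambda>r. complex_of_real r * \<xi>) (at \<xi> within stolz_region \<alpha> \<xi>) (at_left 1)"
  unfolding filterlim_at
proof
  have "eventually (\<lambda>r. r \<in> {0<..<1::real}) (at_left 1)" by (rule eventually_at_left_real) simp
  then show "eventually (\<lambda>r. complex_of_real r * \<xi> \<in> stolz_region \<alpha> \<xi> \<and> complex_of_real r * \<xi> \<noteq> \<xi>) (at_left 1)"
  proof eventually_elim
    case (elim r)
    have "complex_of_real r * \<xi> - \<xi> = of_real (r - 1) * \<xi>" by (simp add: algebra_simps)
    then have "norm (complex_of_real r * \<xi> - \<xi>) = 1 - r" using elim assms by (simp add: norm_mult del: of_real_diff)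
    moreover have "norm (complex_of_real r * \<xi>) = r" using elim assms by (simp add: norm_mult)
    moreover have "1 * (1 - r) < \<alpha> * (1 - r)" using elim assms by (intro mult_strict_right_mono) auto
    ultimately show ?case using elim by (auto simp: stolz_region_def)
  qed
  have "((\<lambda>r. complex_of_real r * \<xi>) \<longlongrightarrow> of_real 1 * \<xi>) (at_left 1)" by (intro tendsto_intros)
  then show "((\<lambda>r. complex_of_real r * \<xi>) \<longlongrightarrow> \<xi>) (at_left 1)" by simp
qed

lemma nontangential_imp_radial:
  assumes "norm \<xi> = 1" "has_nontangential_limit G \<xi> w"
  shows "has_radial_limit G \<xi> w"
proof -
  have "(G \<longlongrightarrow> w) (at \<xi> within stolz_region 2 \<xi>)"
    using assms(2) by (simp add: has_nontangential_limit_def)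
  from filterlim_compose[OF this eventually_radius_stolz[OF assms(1)]]
  show ?thesis by (simp add: has_radial_limit_def)
qed

lemma radial_limit_eq:
  assumes "has_radial_limit G \<xi> w"
  shows "radial_limit G \<xi> = w"
  unfolding radial_limit_def
proof (rule the_equality)
  show "has_radial_limit G \<xi> w" by fact
  fix v assume "has_radial_limit G \<xi> v"
  then show "v = w" using assms unfolding has_radial_limit_def
    by (rule tendsto_unique[OF trivial_limit_at_left_real])
qed

text \<open>Uniqueness, on which the definite description rests, is read off along the radius: it
  ends in every Stolz region.\<close>

lemma boundary_value_eq:
  assumes "norm \<xi> = 1" "has_nontangential_limit G \<xi> w"
  shows "boundary_value G \<xi> = w"
  unfolding boundary_value_def
proof (rule the_equality)
  show "has_nontangential_limit G \<xi> w" by fact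
  fix v assume "has_nontangential_limit G \<xi> v"
  from radial_limit_eq[OF nontangential_imp_radial[OF assms(1) this]]
    radial_limit_eq[OF nontangential_imp_radial[OF assms]]
  show "v = w" by simp
qed

lemma has_nontangential_limit_cong:
  assumes "\<And>z. norm z < 1 \<Longrightarrow> G z = H z"
  shows "has_nontangential_limit G \<xi> w \<longleftrightarrow> has_nontangential_limit H \<xi> w"
proof -
  have "(G \<longlongrightarrow> w) (at \<xi> within stolz_region \<alpha> \<xi>) \<longleftrightarrow> (H \<longlongrightarrow> w) (at \<xi> within stolz_region \<alpha> \<xi>)" for \<alpha>
    by (rule Lim_cong_within) (use assms in \<open>auto simp: stolz_region_def\<close>)
  then show ?thesis unfolding has_nontangential_limit_def by simp
qed

lemma has_nontangential_limit_diff: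
  "has_nontangential_limit G \<xi> v \<Longrightarrow> has_nontangential_limit H \<xi> w \<Longrightarrow>
    has_nontangential_limit (\<lambda>z. G z - H z) \<xi> (v - w)"
  unfolding has_nontangential_limit_def by (auto intro: tendsto_diff)

lemma has_nontangential_limit_sum:
  "(\<And>i. i \<in> I \<Longrightarrow> has_nontangential_limit (G i) \<xi> (v i)) \<Longrightarrow>
    has_nontangential_limit (\<lambda>z. \<Sum>i\<in>I. G i z) \<xi> (\<Sum>i\<in>I. v i)"
  unfolding has_nontangential_limit_def by (auto intro: tendsto_sum)

lemma has_nontangential_limit_cmult:
  "has_nontangential_limit G \<xi> v \<Longrightarrow> has_nontangential_limit (\<lambda>z. c * G z) \<xi> (c * v)"
  unfolding has_nontangential_limit_def by (auto intro: tendsto_mult_left)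

subsection \<open>Almost everywhere convergence\<close>

context inner_dynamics
begin

lemma mdiff_iter_measurable [measurable]:
  "(\<lambda>\<xi>. mdiff ((bdry ^^ n) \<xi>)) \<in> borel_measurable circle_measure"
  using measurable_compose[OF bdry_iter_measurable mdiff_measurable] .

text \<open>Invariance of the measure under \<open>bdry ^^ m\<close> reduces the claim to
  \<open>m = 0\<close>, where the other factor is a function of \<open>bdry\<close>.\<close>

lemma orthogonal_mdiff_iter:
  assumes h: "integrable circle_measure (h :: complex \<Rightarrow> complex)" and mn: "m < n"
  shows "(\<integral>\<^sub>C \<xi>. mdiff ((bdry ^^ m) \<xi>) * h ((bdry ^^ n) \<xi>)) = 0"
proof -
  obtain k where k: "n = Suc (k + m)" using mn less_iff_Suc_add[of m n] by (auto simp: add.commute)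
  have hm [measurable]: "h \<in> borel_measurable circle_measure" by (rule borel_measurable_integrable[OF h])
  have hk: "integrable circle_measure (\<lambda>\<xi>. h ((bdry ^^ k) \<xi>))"
    using integral_bdry_iter(2)[OF hm] h by simp
  have sh: "(bdry ^^ n) \<xi> = (bdry ^^ k) (bdry ((bdry ^^ m) \<xi>))" for \<xi>
  proof -
    have "bdry ^^ n = bdry ^^ (k + Suc m)" by (simp only: k add_Suc_right)
    then show ?thesis by (simp only: funpow_add funpow.simps(2) comp_apply)
  qed
  have "(\<lambda>\<xi>. mdiff \<xi> * h ((bdry ^^ k) (bdry \<xi>))) \<in> borel_measurable circle_measure"
    by measurable
  from integral_bdry_iter(1)[OF this, of m] integral_mdiff[OF hk]
  show ?thesis by (simp add: sh)
qed

text \<open>Tail sums, with the index shifted so that \<open>tail_sum b n N ((bdry ^^ n) \<xi>)\<close> is the sum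
  over \<open>n \<le> m < N\<close> of \<open>b m * mdiff ((bdry ^^ m) \<xi>)\<close>.\<close>

definition tail_sum :: "(nat \<Rightarrow> complex) \<Rightarrow> nat \<Rightarrow> nat \<Rightarrow> complex \<Rightarrow> complex" where
  "tail_sum b n N \<xi> = (\<Sum>m\<in>{n..<N}. b m * mdiff ((bdry ^^ (m - n)) \<xi>))"

lemma tail_sum_measurable [measurable]: "tail_sum b n N \<in> borel_measurable circle_measure"
  unfolding tail_sum_def by measurable

lemma tail_sum_shift:
  assumes "n \<le> k"
  shows "tail_sum b k N ((bdry ^^ k) \<xi>) = tail_sum b k N ((bdry ^^ (k - n)) ((bdry ^^ n) \<xi>))"
proof -
  have "bdry ^^ k = bdry ^^ ((k - n) + n)" using assms by simp
  then show ?thesis by (simp only: funpow_add comp_apply)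
qed

lemma tail_sum_iter: "tail_sum b n N ((bdry ^^ n) \<xi>) = (\<Sum>m\<in>{n..<N}. b m * mdiff ((bdry ^^ m) \<xi>))"
  unfolding tail_sum_def
proof (rule sum.cong[OF refl])
  fix m assume "m \<in> {n..<N}"
  then have "bdry ^^ m = bdry ^^ ((m - n) + n)" by simp
  then show "b m * mdiff ((bdry ^^ (m - n)) ((bdry ^^ n) \<xi>)) = b m * mdiff ((bdry ^^ m) \<xi>)"
    by (simp only: funpow_add comp_apply)
qed

lemma norm_tail_sum: "norm \<xi> = 1 \<Longrightarrow> norm (tail_sum b n N \<xi>) \<le> 2 * (\<Sum>m\<in>{n..<N}. norm (b m))"
  unfolding tail_sum_def sum_distrib_left
proof (rule sum_norm_le)
  fix m assume "norm \<xi> = 1"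
  then show "norm (b m * mdiff ((bdry ^^ (m - n)) \<xi>)) \<le> 2 * norm (b m)"
    using mult_left_mono[OF norm_mdiff[OF norm_bdry_iter, of \<xi> "m - n"], of "norm (b m)"]
    by (simp add: norm_mult mult.commute)
qed

text \<open>The filtration runs backwards: bounded functions of \<open>bdry ^^ n\<close> are the
  past of the differences with index below \<open>n\<close>.\<close>

lemma orthogonal_tail:
  assumes h: "h \<in> borel_measurable circle_measure" and hB: "\<And>\<xi>. norm \<xi> = 1 \<Longrightarrow> norm (h \<xi> :: complex) \<le> B"
    and "M \<le> n"
  shows "(\<integral>\<^sub>C \<xi>. h ((bdry ^^ n) \<xi>) * (\<Sum>m\<in>{M..<n}. b m * mdiff ((bdry ^^ m) \<xi>))) = 0"
proof -
  have hi: "integrable circle_measure h" by (rule circle_integrable_bound[OF h hB])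
  have hni: "integrable circle_measure (\<lambda>\<xi>. h ((bdry ^^ n) \<xi>))" using integral_bdry_iter(2)[OF h] hi by simp
  have i: "integrable circle_measure (\<lambda>\<xi>. mdiff ((bdry ^^ m) \<xi>) * h ((bdry ^^ n) \<xi>))" for m
    by (rule circle_integrable_mult_bounded[OF hni _ norm_mdiff[OF norm_bdry_iter]]) simp
  have "(\<integral>\<^sub>C \<xi>. h ((bdry ^^ n) \<xi>) * (\<Sum>m\<in>{M..<n}. b m * mdiff ((bdry ^^ m) \<xi>))) =
      (\<integral>\<^sub>C \<xi>. (\<Sum>m\<in>{M..<n}. b m * (mdiff ((bdry ^^ m) \<xi>) * h ((bdry ^^ n) \<xi>))))"
    by (simp add: sum_distrib_left mult_ac)
  also have "\<dots> = (\<Sum>m\<in>{M..<n}. b m * (\<integral>\<^sub>C \<xi>. mdiff ((bdry ^^ m) \<xi>) * h ((bdry ^^ n) \<xi>)))"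
    by (subst Bochner_Integration.integral_sum) (use i in auto)
  also have "\<dots> = 0" by (intro sum.neutral ballI) (simp add: orthogonal_mdiff_iter[OF hi])
  finally show ?thesis .
qed

lemma norm_sq_add: "(norm (x + y))\<^sup>2 = (norm x)\<^sup>2 + 2 * Re (cnj x * y) + (norm y)\<^sup>2" for x y :: complex
  unfolding cmod_power2 by (simp add: power2_eq_square algebra_simps)

text \<open>Pythagoras, removing the lowest index first, since the rest is a function of the next
  iterate. The factor 4 is the square of the bound 2 for \<open>mdiff\<close>.\<close>

lemma integral_tail_sq:
  "(\<integral>\<^sub>C \<xi>. (norm (tail_sum b n N ((bdry ^^ n) \<xi>)))\<^sup>2) \<le> 4 * (\<Sum>m\<in>{n..<N}. (norm (b m))\<^sup>2)"
proof (induction "N - n" arbitrary: n)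
  case 0
  then show ?case by (simp add: tail_sum_def)
next
  case (Suc k)
  then have nN: "n < N" by simp
  let ?S = "\<lambda>\<xi>. tail_sum b (Suc n) N ((bdry ^^ Suc n) \<xi>)"
  let ?D = "\<lambda>\<xi>. b n * mdiff ((bdry ^^ n) \<xi>)"
  define B where "B = 2 * (\<Sum>m\<in>{Suc n..<N}. norm (b m))"
  have SB: "norm (tail_sum b (Suc n) N \<xi>) \<le> B" if "norm \<xi> = 1" for \<xi>
    unfolding B_def by (rule norm_tail_sum[OF that])
  have SB': "norm (?S \<xi>) \<le> B" if "norm \<xi> = 1" for \<xi>
    by (rule SB[OF norm_bdry_iter[OF that]])
  have B0: "B \<ge> 0" unfolding B_def by (simp add: sum_nonneg)
  have DB: "norm (?D \<xi>) \<le> norm (b n) * 2" if "norm \<xi> = 1" for \<xi>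
    unfolding norm_mult by (intro mult_left_mono norm_mdiff norm_bdry_iter that) simp
  have Sm: "?S \<in> borel_measurable circle_measure"
    by (rule measurable_compose[OF bdry_iter_measurable tail_sum_measurable])
  have i1: "integrable circle_measure (\<lambda>\<xi>. (norm (?S \<xi>))\<^sup>2)"
    by (rule circle_integrable_bound[where B = "B\<^sup>2"]) (use Sm SB' in \<open>auto intro!: power_mono\<close>)
  have i2: "integrable circle_measure (\<lambda>\<xi>. (norm (?D \<xi>))\<^sup>2)"
  proof (rule circle_integrable_bound[where B = "(norm (b n) * 2)\<^sup>2"])
    show "(\<lambda>\<xi>. (norm (?D \<xi>))\<^sup>2) \<in> borel_measurable circle_measure"
      using mdiff_iter_measurable[of n] by measurable
    fix \<xi> :: complex assume "norm \<xi> = 1"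
    from power_mono[OF DB[OF this], of 2] show "norm ((norm (?D \<xi>))\<^sup>2) \<le> (norm (b n) * 2)\<^sup>2" by simp
  qed
  have i3: "integrable circle_measure (\<lambda>\<xi>. cnj (?S \<xi>) * ?D \<xi>)"
  proof (rule circle_integrable_bound[where B = "B * (norm (b n) * 2)"])
    show "(\<lambda>\<xi>. cnj (?S \<xi>) * ?D \<xi>) \<in> borel_measurable circle_measure" using Sm by measurable
    fix \<xi> :: complex assume x: "norm \<xi> = 1"
    have "norm (cnj (?S \<xi>)) * norm (?D \<xi>) \<le> B * (norm (b n) * 2)"
      using SB'[OF x] B0 by (intro mult_mono DB[OF x]) auto
    then show "norm (cnj (?S \<xi>) * ?D \<xi>) \<le> B * (norm (b n) * 2)" unfolding norm_mult .
  qed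
  have z: "(\<integral>\<^sub>C \<xi>. cnj (?S \<xi>) * ?D \<xi>) = 0"
    using orthogonal_tail[of "\<lambda>\<xi>. cnj (tail_sum b (Suc n) N \<xi>)" B n "Suc n" b] SB by simp
  have split: "tail_sum b n N ((bdry ^^ n) \<xi>) = ?S \<xi> + ?D \<xi>" for \<xi>
    unfolding tail_sum_iter using nN by (simp add: sum.atLeast_Suc_lessThan)
  have "(\<integral>\<^sub>C \<xi>. (norm (tail_sum b n N ((bdry ^^ n) \<xi>)))\<^sup>2) =
      (\<integral>\<^sub>C \<xi>. (norm (?S \<xi>))\<^sup>2 + 2 * Re (cnj (?S \<xi>) * ?D \<xi>) + (norm (?D \<xi>))\<^sup>2)"
    unfolding split norm_sq_add ..
  also have "\<dots> = (\<integral>\<^sub>C \<xi>. (norm (?S \<xi>))\<^sup>2) + 2 * Re (\<integral>\<^sub>C \<xi>. cnj (?S \<xi>) * ?D \<xi>)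
      + (\<integral>\<^sub>C \<xi>. (norm (?D \<xi>))\<^sup>2)"
    using i1 i2 i3 by (simp del: norm_mult times_complex.simps)
  also note z
  also have "(\<integral>\<^sub>C \<xi>. (norm (?D \<xi>))\<^sup>2) \<le> (\<integral>\<^sub>C \<xi>. (norm (b n) * 2)\<^sup>2)"
  proof (rule circle_integral_mono)
    fix \<xi> :: complex assume "norm \<xi> = 1"
    then show "(norm (?D \<xi>))\<^sup>2 \<le> (norm (b n) * 2)\<^sup>2"
      by (intro power_mono DB) (simp_all add: space_circle_measure)
  qed (use i2 in simp_all)
  also have "(\<integral>\<^sub>C \<xi>. (norm (?S \<xi>))\<^sup>2) \<le> 4 * (\<Sum>m\<in>{Suc n..<N}. (norm (b m))\<^sup>2)"
    using Suc.hyps(1)[of "Suc n"] Suc.hyps(2) by simp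
  finally show ?case using nN by (simp add: sum.atLeast_Suc_lessThan power_mult_distrib algebra_simps)
qed

text \<open>Time runs backwards, so one stops at the last index at which the tail
  sum is large.\<close>

lemma kolmogorov_inequality:
  assumes l: "0 < l"
  shows "measure circle_measure {\<xi> \<in> space circle_measure. \<exists>n\<in>{M..<N}. l < norm (tail_sum b n N ((bdry ^^ n) \<xi>))}
    \<le> 4 * (\<Sum>m\<in>{M..<N}. (norm (b m))\<^sup>2) / l\<^sup>2"
proof -
  define Sf where "Sf n \<xi> = tail_sum b n N ((bdry ^^ n) \<xi>)" for n \<xi>
  have Sfm [measurable]: "Sf n \<in> borel_measurable circle_measure" for n
    unfolding Sf_def by (rule measurable_compose[OF bdry_iter_measurable tail_sum_measurable])
  \<comment> \<open>These events are disjoint, and membership in \<open>A n\<close> depends only on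
    \<open>(bdry ^^ n) \<xi>\<close>, because all tail sums from index \<open>n\<close> on
    do.\<close>
  define A where "A n = {\<xi> \<in> space circle_measure. l < norm (Sf n \<xi>) \<and> (\<forall>k\<in>{n<..<N}. norm (Sf k \<xi>) \<le> l)}" for n
  have Am [measurable]: "A n \<in> sets circle_measure" for n unfolding A_def by measurable
  define B where "B = 2 * (\<Sum>m\<in>{..<N}. norm (b m))"
  have B0: "B \<ge> 0" unfolding B_def by (simp add: sum_nonneg)
  have tB: "norm (tail_sum b n N \<xi>) \<le> B" if "norm \<xi> = 1" for \<xi> n
  proof -
    have "(\<Sum>m\<in>{n..<N}. norm (b m)) \<le> (\<Sum>m\<in>{..<N}. norm (b m))" by (intro sum_mono2) auto
    then show ?thesis using norm_tail_sum[OF that, of b n N] by (simp add: B_def)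
  qed
  have SB: "norm (Sf n \<xi>) \<le> B" if "norm \<xi> = 1" for \<xi> n
    unfolding Sf_def by (rule tB[OF norm_bdry_iter[OF that]])
  have Si: "integrable circle_measure (\<lambda>\<xi>. (norm (Sf n \<xi>))\<^sup>2)" for n
    by (rule circle_integrable_bound[where B = "B\<^sup>2"]) (use SB in \<open>auto intro!: power_mono\<close>)
  have iSi: "integrable circle_measure (\<lambda>\<xi>. indicat_real (A n) \<xi> * (norm (Sf k \<xi>))\<^sup>2)" for n k
    by (rule Bochner_Integration.integrable_bound[OF Si[of k]]) (auto simp: indicator_def)
  have step: "l\<^sup>2 * measure circle_measure (A n) \<le> (\<integral>\<^sub>C \<xi>. indicat_real (A n) \<xi> * (norm (Sf M \<xi>))\<^sup>2)"
    if n: "n \<in> {M..<N}" for n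
  proof -
    define R where "R \<xi> = (\<Sum>m\<in>{M..<n}. b m * mdiff ((bdry ^^ m) \<xi>))" for \<xi>
    have SR: "Sf M \<xi> = Sf n \<xi> + R \<xi>" for \<xi>
    proof -
      have "{M..<N} = {M..<n} \<union> {n..<N}" using n by auto
      then have "(\<Sum>m\<in>{M..<N}. b m * mdiff ((bdry ^^ m) \<xi>)) = R \<xi> + (\<Sum>m\<in>{n..<N}. b m * mdiff ((bdry ^^ m) \<xi>))"
        unfolding R_def by (simp only:) (rule sum.union_disjoint, auto)
      then show ?thesis unfolding Sf_def tail_sum_iter by simp
    qed
    \<comment> \<open>Exhibits the indicator of \<open>A n\<close> times the conjugate tail sum as a
      bounded function of \<open>bdry ^^ n\<close>, as \<open>orthogonal_tail\<close>
      requires.\<close>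
    define H where "H \<eta> = (if l < norm (tail_sum b n N \<eta>) \<and> (\<forall>k\<in>{n<..<N}. norm (tail_sum b k N ((bdry ^^ (k - n)) \<eta>)) \<le> l)
        then cnj (tail_sum b n N \<eta>) else 0)" for \<eta>
    have tm [measurable]: "(\<lambda>\<eta>. tail_sum b k N ((bdry ^^ j) \<eta>)) \<in> borel_measurable circle_measure" for k j
      by (rule measurable_compose[OF bdry_iter_measurable tail_sum_measurable])
    have Hm: "H \<in> borel_measurable circle_measure" unfolding H_def by measurable
    have HB: "norm (H \<eta>) \<le> B" if "norm \<eta> = 1" for \<eta> using tB[OF that] B0 by (auto simp: H_def)
    have HA: "indicator (A n) \<xi> * cnj (Sf n \<xi>) = H ((bdry ^^ n) \<xi>)" if "norm \<xi> = 1" for \<xi>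
    proof -
      have "tail_sum b k N ((bdry ^^ (k - n)) ((bdry ^^ n) \<xi>)) = Sf k \<xi>" if "k \<in> {n<..<N}" for k
        unfolding Sf_def using tail_sum_shift[of n k b N \<xi>] that by simp
      then show ?thesis using that
        by (auto simp: H_def A_def indicator_def Sf_def[of n] space_circle_measure)
    qed
    have "(\<integral>\<^sub>C \<xi>. indicator (A n) \<xi> * cnj (Sf n \<xi>) * R \<xi>) = (\<integral>\<^sub>C \<xi>. H ((bdry ^^ n) \<xi>) * R \<xi>)"
      by (rule circle_integral_cong) (simp add: HA space_circle_measure)
    also have "\<dots> = 0"
      unfolding R_def by (rule orthogonal_tail[OF Hm HB]) (use n in auto)
    finally have z: "(\<integral>\<^sub>C \<xi>. indicator (A n) \<xi> * cnj (Sf n \<xi>) * R \<xi>) = 0" .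
    have Rm [measurable]: "R \<in> borel_measurable circle_measure" unfolding R_def by measurable
    have RB: "norm (R \<xi>) \<le> 2 * B" if "norm \<xi> = 1" for \<xi>
    proof -
      have "R \<xi> = Sf M \<xi> - Sf n \<xi>" by (simp add: SR)
      then show ?thesis using norm_triangle_ineq4[of "Sf M \<xi>" "Sf n \<xi>"] SB[OF that, of M] SB[OF that, of n] by simp
    qed
    have zi: "integrable circle_measure (\<lambda>\<xi>. indicator (A n) \<xi> * cnj (Sf n \<xi>) * R \<xi>)"
    proof (rule circle_integrable_bound[where B = "B * (2 * B)"])
      fix \<xi> :: complex assume x: "norm \<xi> = 1"
      have "norm (cnj (Sf n \<xi>)) * norm (R \<xi>) \<le> B * (2 * B)"
        using SB[OF x, of n] B0 by (intro mult_mono RB[OF x]) auto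
      then show "norm (indicator (A n) \<xi> * cnj (Sf n \<xi>) * R \<xi>) \<le> B * (2 * B)"
        using B0 by (auto simp: indicator_def norm_mult)
    qed measurable
    have "l\<^sup>2 * measure circle_measure (A n) = (\<integral>\<^sub>C \<xi>. indicat_real (A n) \<xi> * l\<^sup>2)"
      using sets.sets_into_space[OF Am[of n]] by (simp add: Int_absorb1 Int_absorb2 mult.commute)
    also have "\<dots> \<le> (\<integral>\<^sub>C \<xi>. indicat_real (A n) \<xi> * (norm (Sf n \<xi>))\<^sup>2)"
    proof (rule circle_integral_mono[OF _ iSi])
      show "integrable circle_measure (\<lambda>\<xi>. indicat_real (A n) \<xi> * l\<^sup>2)"
        by (rule circle_integrable_bound[where B = "l\<^sup>2"]) (auto simp: indicator_def)
      show "indicat_real (A n) \<xi> * l\<^sup>2 \<le> indicat_real (A n) \<xi> * (norm (Sf n \<xi>))\<^sup>2" for \<xi>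
        using l by (auto simp: indicator_def A_def intro!: power_mono)
    qed
    also have "\<dots> = (\<integral>\<^sub>C \<xi>. indicat_real (A n) \<xi> * (norm (Sf n \<xi>))\<^sup>2 + 2 * Re (indicator (A n) \<xi> * cnj (Sf n \<xi>) * R \<xi>))"
      using iSi[of n n] zi z by (simp del: times_complex.simps)
    also have "\<dots> \<le> (\<integral>\<^sub>C \<xi>. indicat_real (A n) \<xi> * (norm (Sf M \<xi>))\<^sup>2)"
    proof (rule circle_integral_mono[OF _ iSi])
      show "integrable circle_measure (\<lambda>\<xi>. indicat_real (A n) \<xi> * (norm (Sf n \<xi>))\<^sup>2 + 2 * Re (indicator (A n) \<xi> * cnj (Sf n \<xi>) * R \<xi>))"
        using iSi[of n n] zi by (simp del: times_complex.simps)
      show "indicat_real (A n) \<xi> * (norm (Sf n \<xi>))\<^sup>2 + 2 * Re (indicator (A n) \<xi> * cnj (Sf n \<xi>) * R \<xi>)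
          \<le> indicat_real (A n) \<xi> * (norm (Sf M \<xi>))\<^sup>2" for \<xi>
        unfolding SR norm_sq_add by (auto simp: indicator_def)
    qed
    finally show ?thesis .
  qed
  have disj: "disjoint_family_on A {M..<N}"
    unfolding disjoint_family_on_def
  proof (intro ballI impI)
    fix m n assume "m \<in> {M..<N}" "n \<in> {M..<N}" "m \<noteq> n"
    moreover have "A i \<inter> A j = {}" if "i < j" "j < N" for i j
      using that by (auto simp: A_def Ball_def not_less[symmetric])
    ultimately show "A m \<inter> A n = {}"
      using Int_commute[of "A m" "A n"] by (metis atLeastLessThan_iff linorder_neqE_nat)
  qed
  have un: "{\<xi> \<in> space circle_measure. \<exists>n\<in>{M..<N}. l < norm (Sf n \<xi>)} = (\<Union>n\<in>{M..<N}. A n)"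
  proof (intro equalityI subsetI)
    fix \<xi> assume "\<xi> \<in> {\<xi> \<in> space circle_measure. \<exists>n\<in>{M..<N}. l < norm (Sf n \<xi>)}"
    then obtain n where x: "\<xi> \<in> space circle_measure" and n: "n \<in> {M..<N}" "l < norm (Sf n \<xi>)" by blast
    define G where "G = {n \<in> {M..<N}. l < norm (Sf n \<xi>)}"
    have G: "finite G" "G \<noteq> {}" using n by (auto simp: G_def)
    have "\<xi> \<in> A (Max G)" unfolding A_def
    proof (intro CollectI conjI ballI x)
      show "l < norm (Sf (Max G) \<xi>)" using Max_in[OF G] by (simp add: G_def)
      fix k assume k: "k \<in> {Max G<..<N}"
      then have "k \<notin> G" using Max_ge[OF G(1), of k] by auto
      moreover have "M \<le> k" using k Max_in[OF G] by (simp add: G_def)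
      ultimately show "norm (Sf k \<xi>) \<le> l" using k by (simp add: G_def)
    qed
    moreover have "Max G \<in> {M..<N}" using Max_in[OF G] by (simp add: G_def)
    ultimately show "\<xi> \<in> (\<Union>n\<in>{M..<N}. A n)" by blast
  qed (auto simp: A_def)
  have "l\<^sup>2 * measure circle_measure (\<Union>n\<in>{M..<N}. A n) = (\<Sum>n\<in>{M..<N}. l\<^sup>2 * measure circle_measure (A n))"
    unfolding sum_distrib_left[symmetric]
    by (subst circle.finite_measure_finite_Union[OF _ _ disj]) auto
  also have "\<dots> \<le> (\<Sum>n\<in>{M..<N}. \<integral>\<^sub>C \<xi>. indicat_real (A n) \<xi> * (norm (Sf M \<xi>))\<^sup>2)"
    by (intro sum_mono step)
  also have "\<dots> = (\<integral>\<^sub>C \<xi>. (\<Sum>n\<in>{M..<N}. indicat_real (A n) \<xi> * (norm (Sf M \<xi>))\<^sup>2))"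
    by (rule Bochner_Integration.integral_sum[symmetric]) (rule iSi)
  also have "\<dots> \<le> (\<integral>\<^sub>C \<xi>. (norm (Sf M \<xi>))\<^sup>2)"
  proof (rule circle_integral_mono)
    fix \<xi>
    have "(\<Sum>n\<in>{M..<N}. indicat_real (A n) \<xi>) = indicat_real (\<Union>n\<in>{M..<N}. A n) \<xi>"
      by (rule indicator_UN_disjoint[symmetric, OF _ disj]) simp
    also have "\<dots> \<le> 1" by (simp add: indicator_def)
    finally show "(\<Sum>n\<in>{M..<N}. indicat_real (A n) \<xi> * (norm (Sf M \<xi>))\<^sup>2) \<le> (norm (Sf M \<xi>))\<^sup>2"
      unfolding sum_distrib_right[symmetric] by (intro mult_left_le_one_le sum_nonneg) auto
  qed (intro Bochner_Integration.integrable_sum iSi, rule Si)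
  also have "\<dots> \<le> 4 * (\<Sum>m\<in>{M..<N}. (norm (b m))\<^sup>2)"
    unfolding Sf_def by (rule integral_tail_sq)
  finally show ?thesis using l unfolding un[symmetric] Sf_def by (simp add: field_simps)
qed

text \<open>The maximal inequality bounds the probability of an oscillation on [M, N] uniformly in
  \<open>N\<close>, by a Cauchy tail of the squares. Letting \<open>N\<close> and then
  \<open>M\<close> grow, oscillations of each size \<open>1 / Suc j\<close> have probability 0, so
  the partial sums are Cauchy.\<close>

lemma AE_convergent_mdiff:
  assumes b: "summable (\<lambda>n. (norm (b n))\<^sup>2)"
  shows "AE \<xi> in circle_measure. convergent (\<lambda>n. \<Sum>m<n. b m * mdiff ((bdry ^^ m) \<xi>))"
proof -
  define X where "X n \<xi> = (\<Sum>m<n. b m * mdiff ((bdry ^^ m) \<xi>))" for n \<xi>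
  have Xm [measurable]: "X n \<in> borel_measurable circle_measure" for n unfolding X_def by measurable
  \<comment> \<open>The factor 2 appears because \<open>X n - X M\<close> is a difference of two
    tail sums, each at most \<open>l\<close> off the exceptional set.\<close>
  define E where "E l M N = {\<xi> \<in> space circle_measure. \<exists>n\<in>{M..N}. 2 * l < norm (X n \<xi> - X M \<xi>)}" for l M N
  have Em [measurable]: "E l M N \<in> sets circle_measure" for l M N unfolding E_def by measurable
  have E_le: "measure circle_measure (E l M N) \<le> 4 * (\<Sum>m\<in>{M..<N}. (norm (b m))\<^sup>2) / l\<^sup>2" if l: "0 < l" for l M N
  proof -
    let ?K = "{\<xi> \<in> space circle_measure. \<exists>n\<in>{M..<N}. l < norm (tail_sum b n N ((bdry ^^ n) \<xi>))}"
    have tm [measurable]: "(\<lambda>\<eta>. tail_sum b k N ((bdry ^^ j) \<eta>)) \<in> borel_measurable circle_measure" for k j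
      by (rule measurable_compose[OF bdry_iter_measurable tail_sum_measurable])
    have "E l M N \<subseteq> ?K"
    proof
      fix \<xi> assume "\<xi> \<in> E l M N"
      then obtain n where x: "\<xi> \<in> space circle_measure" and n: "n \<in> {M..N}" "2 * l < norm (X n \<xi> - X M \<xi>)"
        by (auto simp: E_def)
      have tX: "tail_sum b k N ((bdry ^^ k) \<xi>) = X N \<xi> - X k \<xi>" if "k \<le> N" for k
        unfolding tail_sum_iter X_def using sum_diff_nat_ivl[of 0 k N "\<lambda>m. b m * mdiff ((bdry ^^ m) \<xi>)"] that
        by (simp add: atLeast0LessThan)
      show "\<xi> \<in> ?K"
      proof (rule ccontr)
        assume "\<xi> \<notin> ?K"
        then have s: "norm (X N \<xi> - X k \<xi>) \<le> l" if "k \<in> {M..<N}" for k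
          using that x tX[of k] by force
        have s': "norm (X N \<xi> - X k \<xi>) \<le> l" if "k \<in> {M..N}" for k
          using that s[of k] l by (cases "k = N") auto
        have "norm (X n \<xi> - X M \<xi>) \<le> norm (X N \<xi> - X M \<xi>) + norm (X N \<xi> - X n \<xi>)"
          using norm_triangle_ineq4[of "X N \<xi> - X M \<xi>" "X N \<xi> - X n \<xi>"] by simp
        also have "\<dots> \<le> 2 * l" using s'[of M] s'[of n] n by simp
        finally show False using n by simp
      qed
    qed
    then have "measure circle_measure (E l M N) \<le> measure circle_measure ?K"
      by (rule circle.finite_measure_mono) measurable
    also have "\<dots> \<le> 4 * (\<Sum>m\<in>{M..<N}. (norm (b m))\<^sup>2) / l\<^sup>2" by (rule kolmogorov_inequality[OF l])
    finally show ?thesis .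
  qed
  have null: "AE \<xi> in circle_measure. \<xi> \<notin> (\<Inter>M. \<Union>N. E l M N)" if l: "0 < l" for l
  proof -
    have "measure circle_measure (\<Inter>M. \<Union>N. E l M N) \<le> e" if e: "e > 0" for e
    proof -
      have "e * l\<^sup>2 / 4 > 0" using e l by simp
      then obtain M where M: "\<And>m n. m \<ge> M \<Longrightarrow> norm (\<Sum>k\<in>{m..<n}. (norm (b k))\<^sup>2) < e * l\<^sup>2 / 4"
        using b unfolding summable_Cauchy by blast
      have "measure circle_measure (E l M N) \<le> e" for N
      proof -
        have "(\<Sum>m\<in>{M..<N}. (norm (b m))\<^sup>2) < e * l\<^sup>2 / 4" using M[of M N] by (simp add: abs_less_iff)
        then have "4 * (\<Sum>m\<in>{M..<N}. (norm (b m))\<^sup>2) / l\<^sup>2 \<le> e" using l by (simp add: field_simps)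
        then show ?thesis using E_le[OF l, of M N] by linarith
      qed
      moreover have "(\<lambda>N. measure circle_measure (E l M N)) \<longlonglongrightarrow> measure circle_measure (\<Union>N. E l M N)"
        by (rule circle.finite_Lim_measure_incseq) (fastforce simp: E_def incseq_def)+
      ultimately have "measure circle_measure (\<Union>N. E l M N) \<le> e"
        by (intro LIMSEQ_le_const2) auto
      moreover have "measure circle_measure (\<Inter>M. \<Union>N. E l M N) \<le> measure circle_measure (\<Union>N. E l M N)"
        by (rule circle.finite_measure_mono) auto
      ultimately show ?thesis by linarith
    qed
    note le_e = this
    have "measure circle_measure (\<Inter>M. \<Union>N. E l M N) \<le> 0"
      by (rule field_le_epsilon) (simp only: add_0 le_e)
    then have "measure circle_measure (\<Inter>M. \<Union>N. E l M N) = 0"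
      using measure_nonneg[of circle_measure "\<Inter>M. \<Union>N. E l M N"] by linarith
    then have "(\<Inter>M. \<Union>N. E l M N) \<in> null_sets circle_measure"
      by (intro null_setsI) (auto simp: circle.emeasure_eq_measure)
    then show ?thesis by (rule AE_not_in)
  qed
  have "AE \<xi> in circle_measure. \<forall>j. \<xi> \<notin> (\<Inter>M. \<Union>N. E (1 / real (Suc j)) M N)"
    unfolding AE_all_countable by (intro allI null) simp
  moreover have "AE \<xi> in circle_measure. \<xi> \<in> space circle_measure" by (rule AE_space)
  ultimately have "AE \<xi> in circle_measure. convergent (\<lambda>n. X n \<xi>)"
  proof eventually_elim
    case (elim \<xi>)
    have "Cauchy (\<lambda>n. X n \<xi>)"
    proof (rule CauchyI')
      fix e :: real assume e: "e > 0"
      obtain j where j: "1 / real (Suc j) < e / 4" using nat_approx_posE[of "e / 4"] e by auto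
      obtain M where M: "\<And>N. \<xi> \<notin> E (1 / real (Suc j)) M N" using elim(1) by blast
      have c: "norm (X n \<xi> - X M \<xi>) < e / 2" if "n \<ge> M" for n
      proof -
        have "norm (X n \<xi> - X M \<xi>) \<le> 2 * (1 / real (Suc j))"
          using M[of n] elim(2) that by (auto simp: E_def not_less)
        then show ?thesis using j by linarith
      qed
      show "\<exists>M. \<forall>m\<ge>M. \<forall>n>m. dist (X m \<xi>) (X n \<xi>) < e"
      proof (intro exI[of _ M] allI impI)
        fix m n assume "M \<le> m" "m < n"
        then have "dist (X m \<xi>) (X M \<xi>) < e / 2" "dist (X n \<xi>) (X M \<xi>) < e / 2"
          using c[of m] c[of n] by (auto simp: dist_norm)
        then show "dist (X m \<xi>) (X n \<xi>) < e" by (rule dist_triangle_half_l)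
      qed
    qed
    then show ?case by (simp add: Cauchy_convergent_iff)
  qed
  then show ?thesis unfolding X_def .
qed

text \<open>The coefficients of \<open>\<Sum>n. A n * bdry ^^ n\<close> with respect to \<open>mdiff \<circ> bdry ^^ n\<close>.\<close>

fun mcoeff :: "(nat \<Rightarrow> complex) \<Rightarrow> nat \<Rightarrow> complex" where
  "mcoeff A 0 = A 0"
| "mcoeff A (Suc n) = A (Suc n) + cnj mult0 * mcoeff A n"

text \<open>Summation by parts from \<open>(bdry ^^ n) \<xi> = mdiff ((bdry ^^ n) \<xi>) + cnj mult0
  * (bdry ^^ Suc n) \<xi>\<close>; the last step leaves one boundary term.\<close>

lemma sum_mcoeff:
  "(\<Sum>n<Suc N. A n * (bdry ^^ n) \<xi>) =
    (\<Sum>n<Suc N. mcoeff A n * mdiff ((bdry ^^ n) \<xi>)) + cnj mult0 * mcoeff A N * (bdry ^^ Suc N) \<xi>"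
proof (induction N)
  case 0
  then show ?case by (simp add: mdiff_def algebra_simps)
next
  case (Suc N)
  show ?case
    unfolding sum.lessThan_Suc[of _ "Suc N"] Suc by (simp add: mdiff_def algebra_simps)
qed

text \<open>\<open>mcoeff A\<close> is the convolution of \<open>A\<close> with the powers of
  \<open>cnj mult0\<close>, whose absolute sum is \<open>1 / (1 - norm mult0)\<close>: this is
  Young's inequality, proved by induction along the recursion.\<close>

lemma sum_mcoeff_sq:
  assumes "summable (\<lambda>n. (norm (A n))\<^sup>2)"
  shows "(\<Sum>n\<le>N. (norm (mcoeff A n))\<^sup>2) \<le> (\<Sum>n. (norm (A n))\<^sup>2) / (1 - norm mult0)\<^sup>2"
proof -
  define S where "S = (\<Sum>n. (norm (A n))\<^sup>2)"
  define q where "q = norm mult0"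
  have q: "0 \<le> q" "q < 1" using norm_mult0 by (auto simp: q_def)
  have S: "(\<Sum>n\<le>N. (norm (A n))\<^sup>2) \<le> S" for N
    unfolding S_def by (intro sum_le_suminf assms) auto
  have S0: "0 \<le> S" using S[of 0] by (simp add: order_trans[OF zero_le_power2])
  \<comment> \<open>Convexity of the square, for the point \<open>x / (1 - q)\<close> with weight
    \<open>1 - q\<close> and the point \<open>y\<close> with weight \<open>q\<close>.\<close>
  have conv: "(x + q * y)\<^sup>2 \<le> x\<^sup>2 / (1 - q) + q * y\<^sup>2" for x y :: real
  proof -
    have "x\<^sup>2 / (1 - q) + q * y\<^sup>2 - (x + q * y)\<^sup>2 = q * (x - (1 - q) * y)\<^sup>2 / (1 - q)"
      using q by (simp add: field_simps power2_eq_square)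
    also have "\<dots> \<ge> 0" using q by simp
    finally show ?thesis by linarith
  qed
  have "(\<Sum>n\<le>N. (norm (mcoeff A n))\<^sup>2) \<le> S / (1 - q)\<^sup>2 \<and>
      (\<Sum>n\<le>N. (norm (mcoeff A n))\<^sup>2) \<le> (\<Sum>n\<le>N. (norm (A n))\<^sup>2) / (1 - q) + q * (S / (1 - q)\<^sup>2)"
  proof (induction N)
    case 0
    have "(norm (A 0))\<^sup>2 * (1 - q) \<le> (norm (A 0))\<^sup>2" using q by (intro mult_right_le_one_le) auto
    then have "(norm (A 0))\<^sup>2 \<le> (norm (A 0))\<^sup>2 / (1 - q)" using q by (simp add: field_simps)
    moreover have "0 \<le> q * (S / (1 - q)\<^sup>2)" using q S0 by simp
    moreover have "(norm (A 0))\<^sup>2 \<le> S / (1 - q)\<^sup>2"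
    proof -
      have "(1 - q)\<^sup>2 \<le> 1" using q by (intro power_le_one) auto
      then have "S * (1 - q)\<^sup>2 \<le> S" using S0 by (intro mult_right_le_one_le) auto
      then have "S \<le> S / (1 - q)\<^sup>2" using q by (simp add: field_simps)
      then show ?thesis using S[of 0] by simp
    qed
    ultimately show ?case by simp
  next
    case (Suc N)
    have "(\<Sum>n\<le>Suc N. (norm (mcoeff A n))\<^sup>2) = (norm (A 0))\<^sup>2 + (\<Sum>n\<le>N. (norm (mcoeff A (Suc n)))\<^sup>2)"
      by (subst sum.atMost_Suc_shift) simp
    also have "(\<Sum>n\<le>N. (norm (mcoeff A (Suc n)))\<^sup>2) \<le> (\<Sum>n\<le>N. (norm (A (Suc n)))\<^sup>2 / (1 - q) + q * (norm (mcoeff A n))\<^sup>2)"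
    proof (rule sum_mono)
      fix n
      have "norm (mcoeff A (Suc n)) \<le> norm (A (Suc n)) + q * norm (mcoeff A n)"
        using norm_triangle_ineq[of "A (Suc n)" "cnj mult0 * mcoeff A n"] by (simp add: norm_mult q_def)
      then have "(norm (mcoeff A (Suc n)))\<^sup>2 \<le> (norm (A (Suc n)) + q * norm (mcoeff A n))\<^sup>2"
        by (intro power_mono) auto
      also note conv
      finally show "(norm (mcoeff A (Suc n)))\<^sup>2 \<le> (norm (A (Suc n)))\<^sup>2 / (1 - q) + q * (norm (mcoeff A n))\<^sup>2" .
    qed
    also have "\<dots> = (\<Sum>n\<le>N. (norm (A (Suc n)))\<^sup>2) / (1 - q) + q * (\<Sum>n\<le>N. (norm (mcoeff A n))\<^sup>2)"
      by (simp add: sum.distrib sum_divide_distrib sum_distrib_left)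
    also have "(\<Sum>n\<le>N. (norm (mcoeff A n))\<^sup>2) \<le> S / (1 - q)\<^sup>2" using Suc by simp
    also have "(norm (A 0))\<^sup>2 \<le> (norm (A 0))\<^sup>2 / (1 - q)"
    proof -
      have "(norm (A 0))\<^sup>2 * (1 - q) \<le> (norm (A 0))\<^sup>2" using q by (intro mult_right_le_one_le) auto
      then show ?thesis using q by (simp add: field_simps)
    qed
    finally have 1: "(\<Sum>n\<le>Suc N. (norm (mcoeff A n))\<^sup>2) \<le>
        (\<Sum>n\<le>Suc N. (norm (A n))\<^sup>2) / (1 - q) + q * (S / (1 - q)\<^sup>2)"
      using q by (subst (2) sum.atMost_Suc_shift) (simp add: add_divide_distrib mult_left_mono)
    also have "\<dots> \<le> S / (1 - q) + q * (S / (1 - q)\<^sup>2)"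
      using q S[of "Suc N"] by (intro add_right_mono divide_right_mono) auto
    also have "\<dots> = S / (1 - q)\<^sup>2"
      using q by (simp add: power2_eq_square divide_simps) (simp add: algebra_simps)
    finally show ?case using 1 by simp
  qed
  then show ?thesis by (simp add: S_def q_def)
qed

lemma summable_mcoeff_sq:
  assumes "summable (\<lambda>n. (norm (A n))\<^sup>2)"
  shows "summable (\<lambda>n. (norm (mcoeff A n))\<^sup>2)"
proof (rule summableI_nonneg_bounded)
  show "(\<Sum>i<n. (norm (mcoeff A i))\<^sup>2) \<le> (\<Sum>n. (norm (A n))\<^sup>2) / (1 - norm mult0)\<^sup>2" for n
    by (rule order_trans[OF sum_mono2 sum_mcoeff_sq[OF assms, of n]]) auto
qed simp

text \<open>By \<open>sum_mcoeff\<close> the partial sums are those of the martingale series plus a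
  boundary term that vanishes in the limit, as \<open>mcoeff A\<close> tends to 0.\<close>

lemma AE_summable_bdry_iter:
  assumes A: "summable (\<lambda>n. (norm (A n))\<^sup>2)"
  shows "AE \<xi> in circle_measure. summable (\<lambda>n. A n * (bdry ^^ n) \<xi>)"
proof -
  from AE_convergent_mdiff[OF summable_mcoeff_sq[OF A]] AE_norm_circle show ?thesis
  proof eventually_elim
    case (elim \<xi>)
    have "(\<lambda>n. (norm (mcoeff A n))\<^sup>2) \<longlonglongrightarrow> 0" by (rule summable_LIMSEQ_zero[OF summable_mcoeff_sq[OF A]])
    from tendsto_real_sqrt[OF this] have b0: "(\<lambda>n. norm (mcoeff A n)) \<longlonglongrightarrow> 0" by simp
    have "(\<lambda>N. cnj mult0 * mcoeff A N * (bdry ^^ Suc N) \<xi>) \<longlonglongrightarrow> 0"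
    proof (rule Lim_null_comparison)
      show "eventually (\<lambda>N. norm (cnj mult0 * mcoeff A N * (bdry ^^ Suc N) \<xi>) \<le> norm mult0 * norm (mcoeff A N)) sequentially"
        by (simp add: norm_mult)
      show "(\<lambda>N. norm mult0 * norm (mcoeff A N)) \<longlonglongrightarrow> 0" using tendsto_mult_left[OF b0] by simp
    qed
    moreover obtain L where "(\<lambda>n. \<Sum>m<n. mcoeff A m * mdiff ((bdry ^^ m) \<xi>)) \<longlonglongrightarrow> L"
      using elim(1) by (auto simp: convergent_def)
    then have "(\<lambda>n. \<Sum>m<Suc n. mcoeff A m * mdiff ((bdry ^^ m) \<xi>)) \<longlonglongrightarrow> L"
      by (rule LIMSEQ_Suc)
    ultimately have "(\<lambda>N. \<Sum>n<Suc N. A n * (bdry ^^ n) \<xi>) \<longlonglongrightarrow> L + 0"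
      unfolding sum_mcoeff by (intro tendsto_add)
    then have "(\<lambda>N. \<Sum>n<N. A n * (bdry ^^ n) \<xi>) \<longlonglongrightarrow> L + 0"
      by (rule LIMSEQ_imp_Suc)
    then show ?case unfolding summable_def sums_def by blast
  qed
qed

end

subsection \<open>Covariances of the iterates\<close>

context inner_dynamics
begin

text \<open>Fatou's theorem for the Poisson integral in \<open>poisson_bdry_iter\<close>. It
  identifies iterates of the boundary map with boundary values of iterates.\<close>

lemma iter_nontangential:
  "AE \<xi> in circle_measure. has_nontangential_limit (f ^^ n) \<xi> ((bdry ^^ n) \<xi>)"
proof -
  have "integrable circle_measure (bdry ^^ n)"
    by (rule circle_integrable_bound[where B = 1]) (auto simp: norm_bdry_iter)
  from fatou_poisson[OF this] show ?thesis
  proof eventually_elim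
    case (elim \<xi>)
    then show ?case
      using has_nontangential_limit_cong[of "f ^^ n" "\<lambda>z. \<integral>\<^sub>C \<xi>. poisson_kernel z \<xi> *\<^sub>R (bdry ^^ n) \<xi>"]
        poisson_bdry_iter by simp
  qed
qed

text \<open>The Schwarz quotient of \<open>f ^^ k\<close>, factored along the orbit so that each
  factor obeys its own Harnack estimate.\<close>

definition quot_prod :: "nat \<Rightarrow> complex \<Rightarrow> complex" where
  "quot_prod k w = (\<Prod>i<k. quot ((f ^^ i) w))"

lemma iter_eq_quot_prod: "(f ^^ k) w = w * quot_prod k w"
  unfolding quot_prod_def
proof (induction k)
  case (Suc k)
  have "(f ^^ Suc k) w = (f ^^ k) w * quot ((f ^^ k) w)" using f_eq_quot[of "(f ^^ k) w"] by simp
  then show ?case using Suc by (simp add: mult.assoc)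
qed simp

lemma norm_quot_prod: "norm w < 1 \<Longrightarrow> norm (quot_prod k w) \<le> 1"
  unfolding quot_prod_def prod_norm[symmetric]
  by (intro prod_le_1) (auto intro: norm_quot_le iter_disc)

lemma quot_prod_holomorphic: "quot_prod k holomorphic_on unit_disc"
proof -
  have "quot \<circ> (f ^^ i) holomorphic_on unit_disc" for i
    by (rule holomorphic_on_compose_gen[OF iter_holomorphic quot_holomorphic]) (auto intro: iter_disc)
  then have "(\<lambda>w. \<Prod>i<k. quot ((f ^^ i) w)) holomorphic_on unit_disc"
    by (intro holomorphic_on_prod) (simp add: comp_def)
  then show ?thesis by (simp add: quot_prod_def[abs_def])
qed

lemma quot_prod_radial: "AE \<xi> in circle_measure. has_radial_limit (quot_prod k) \<xi> ((bdry ^^ k) \<xi> * cnj \<xi>)"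
  using iter_nontangential[of k] AE_norm_circle
proof eventually_elim
  case (elim \<xi>)
  then show ?case
    by (intro has_radial_limit_quotient[where h = "f ^^ k"] nontangential_imp_radial)
      (auto simp: iter_eq_quot_prod[of k])
qed

lemma poisson_quot_prod:
  assumes "norm z < 1"
  shows "(\<integral>\<^sub>C \<xi>. poisson_kernel z \<xi> *\<^sub>R ((bdry ^^ k) \<xi> * cnj \<xi>)) = quot_prod k z"
  by (rule poisson_bounded_holomorphic[OF quot_prod_holomorphic norm_quot_prod _ quot_prod_radial assms]) simp_all

text \<open>Applying \<open>bdry ^^ m\<close> moves the kernel from \<open>z\<close> to
  \<open>w = (f ^^ m) z\<close>. Against it the product of \<open>bdry ^^ k\<close> and the
  conjugate of the identity has mean \<open>quot_prod k w\<close>, and the product of the means is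
  that number times \<open>(norm w)\<^sup>2\<close>.\<close>

lemma covariance:
  assumes z: "norm z < 1"
  shows "(\<integral>\<^sub>C \<xi>. poisson_kernel z \<xi> *\<^sub>R (((bdry ^^ (m + k)) \<xi> - (f ^^ (m + k)) z) * cnj ((bdry ^^ m) \<xi> - (f ^^ m) z))) =
    quot_prod k ((f ^^ m) z) * (1 - (norm ((f ^^ m) z))\<^sup>2)"
proof -
  define w where "w = (f ^^ m) z"
  have w: "norm w < 1" unfolding w_def by (rule iter_disc[OF z])
  define v where "v = (f ^^ (m + k)) z"
  have v: "v = w * quot_prod k w"
  proof -
    have "f ^^ (m + k) = f ^^ (k + m)" by (simp add: add.commute)
    then have "v = (f ^^ k) w" unfolding v_def w_def by (simp only: funpow_add comp_apply)
    then show ?thesis by (simp add: iter_eq_quot_prod)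
  qed
  let ?P = "poisson_kernel z"
  have Pm [measurable]: "?P \<in> borel_measurable circle_measure" by simp
  have b: "integrable circle_measure (\<lambda>\<xi>. ?P \<xi> *\<^sub>R (bdry ^^ n) \<xi>)" "integrable circle_measure (\<lambda>\<xi>. ?P \<xi> *\<^sub>R cnj ((bdry ^^ n) \<xi>))"
      "integrable circle_measure (\<lambda>\<xi>. ?P \<xi> *\<^sub>R ((bdry ^^ n) \<xi> * cnj ((bdry ^^ m) \<xi>)))"
      "integrable circle_measure (\<lambda>\<xi>. ?P \<xi> *\<^sub>R (c::complex))" for n m c
    by (intro integrable_poisson_mult[OF z] circle_integrable_bound[where B = 1], simp, simp add: norm_bdry_iter,
        intro integrable_poisson_mult[OF z] circle_integrable_bound[where B = 1], simp, simp add: norm_bdry_iter,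
        intro integrable_poisson_mult[OF z] circle_integrable_bound[where B = 1], simp, simp add: norm_bdry_iter norm_mult,
        intro integrable_poisson_mult[OF z] circle_integrable_bound[where B = "norm c"], simp, simp)
  have sh: "(bdry ^^ (m + k)) \<xi> = (bdry ^^ k) ((bdry ^^ m) \<xi>)" for \<xi>
  proof -
    have "bdry ^^ (m + k) = bdry ^^ (k + m)" by (simp add: add.commute)
    then show ?thesis by (simp only: funpow_add comp_apply)
  qed
  have e1: "(\<integral>\<^sub>C \<xi>. ?P \<xi> *\<^sub>R ((bdry ^^ (m + k)) \<xi> * cnj ((bdry ^^ m) \<xi>))) = quot_prod k w"
  proof -
    have "(\<integral>\<^sub>C \<xi>. ?P \<xi> *\<^sub>R ((bdry ^^ (m + k)) \<xi> * cnj ((bdry ^^ m) \<xi>))) =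
        (\<integral>\<^sub>C \<xi>. poisson_kernel w \<xi> *\<^sub>R ((bdry ^^ k) \<xi> * cnj \<xi>))"
      unfolding sh w_def by (rule integral_poisson_iter[OF z]) simp
    then show ?thesis by (simp add: poisson_quot_prod[OF w])
  qed
  have e2: "(\<integral>\<^sub>C \<xi>. ?P \<xi> *\<^sub>R (bdry ^^ (m + k)) \<xi>) = v" unfolding v_def by (rule poisson_bdry_iter[OF z])
  have e3: "(\<integral>\<^sub>C \<xi>. ?P \<xi> *\<^sub>R cnj ((bdry ^^ m) \<xi>)) = cnj w"
  proof -
    have "(\<integral>\<^sub>C \<xi>. ?P \<xi> *\<^sub>R cnj ((bdry ^^ m) \<xi>)) = (\<integral>\<^sub>C \<xi>. cnj (?P \<xi> *\<^sub>R (bdry ^^ m) \<xi>))"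
      by simp
    also have "\<dots> = cnj w" unfolding Bochner_Integration.integral_cnj poisson_bdry_iter[OF z] w_def ..
    finally show ?thesis .
  qed
  have e4: "(\<integral>\<^sub>C \<xi>. ?P \<xi> *\<^sub>R (c::complex)) = c" for c
    using integral_poisson_kernel[OF z] integrable_poisson_kernel[OF z] by (subst integral_scaleR_left) auto
  have "(\<integral>\<^sub>C \<xi>. ?P \<xi> *\<^sub>R (((bdry ^^ (m + k)) \<xi> - v) * cnj ((bdry ^^ m) \<xi> - w))) =
      (\<integral>\<^sub>C \<xi>. ?P \<xi> *\<^sub>R ((bdry ^^ (m + k)) \<xi> * cnj ((bdry ^^ m) \<xi>)) - cnj w * (?P \<xi> *\<^sub>R (bdry ^^ (m + k)) \<xi>)
        - v * (?P \<xi> *\<^sub>R cnj ((bdry ^^ m) \<xi>)) + ?P \<xi> *\<^sub>R (v * cnj w))"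
    by (rule circle_integral_cong) (simp add: scaleR_conv_of_real algebra_simps)
  also have "\<dots> = quot_prod k w - cnj w * v - v * cnj w + v * cnj w"
  proof -
    have "integrable circle_measure (\<lambda>\<xi>. cnj w * (?P \<xi> *\<^sub>R (bdry ^^ (m + k)) \<xi>))"
      "integrable circle_measure (\<lambda>\<xi>. v * (?P \<xi> *\<^sub>R cnj ((bdry ^^ m) \<xi>)))"
      by (intro integrable_mult_right b)+
    then show ?thesis using b(3)[of "m + k" m] b(4)[of "v * cnj w"]
      by (simp only: Bochner_Integration.integral_add Bochner_Integration.integral_diff
          Bochner_Integration.integrable_diff integral_mult_right_zero e1 e2 e3 e4)
  qed
  also have "\<dots> = quot_prod k w * (1 - (norm w)\<^sup>2)"
    unfolding of_real_diff of_real_1 complex_norm_square v by (simp add: algebra_simps)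
  finally show ?thesis by (simp only: v_def w_def of_real_diff of_real_1)
qed

definition cov_bound :: "complex \<Rightarrow> nat \<Rightarrow> nat \<Rightarrow> real" where
  "cov_bound z m n = (\<Prod>i\<in>{min m n..<max m n}. norm (quot ((f ^^ i) z))) * (1 - (norm ((f ^^ min m n) z))\<^sup>2)"

lemma cov_bound_commute: "cov_bound z m n = cov_bound z n m"
  by (simp add: cov_bound_def min.commute max.commute)

lemma norm_covariance:
  assumes z: "norm z < 1"
  shows "norm (\<integral>\<^sub>C \<xi>. poisson_kernel z \<xi> *\<^sub>R (((bdry ^^ n) \<xi> - (f ^^ n) z) * cnj ((bdry ^^ m) \<xi> - (f ^^ m) z)))
    \<le> cov_bound z n m"
proof -
  have le: "norm (\<integral>\<^sub>C \<xi>. poisson_kernel z \<xi> *\<^sub>R (((bdry ^^ n) \<xi> - (f ^^ n) z) * cnj ((bdry ^^ m) \<xi> - (f ^^ m) z)))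
    = cov_bound z n m" if mn: "m \<le> n" for m n
  proof -
    obtain k where k: "n = m + k" using le_Suc_ex[OF mn] by blast
    have "norm (quot_prod k ((f ^^ m) z)) = (\<Prod>i\<in>{m..<n}. norm (quot ((f ^^ i) z)))"
    proof -
      have "(f ^^ i) ((f ^^ m) z) = (f ^^ (i + m)) z" for i by (simp only: funpow_add comp_apply)
      then have "norm (quot_prod k ((f ^^ m) z)) = (\<Prod>i<k. norm (quot ((f ^^ (i + m)) z)))"
        unfolding quot_prod_def prod_norm[symmetric] by simp
      also have "\<dots> = (\<Prod>i\<in>{0 + m..<k + m}. norm (quot ((f ^^ i) z)))"
        unfolding lessThan_atLeast0 by (rule prod.shift_bounds_nat_ivl[symmetric])
      finally show ?thesis by (simp add: k add.commute)
    qed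
    moreover have "norm (complex_of_real (1 - (norm ((f ^^ m) z))\<^sup>2)) = 1 - (norm ((f ^^ m) z))\<^sup>2"
      unfolding norm_of_real using iter_disc[OF z, of m] by (simp add: abs_square_le_1)
    ultimately show ?thesis
      unfolding k covariance[OF z] norm_mult cov_bound_def using k by (simp only: of_real_diff of_real_1) simp
  qed
  show ?thesis
  proof (cases "m \<le> n")
    case True
    show ?thesis by (rule eq_refl[OF le[OF True]])
  next
    case False
    let ?F = "\<lambda>\<xi>. poisson_kernel z \<xi> *\<^sub>R (((bdry ^^ m) \<xi> - (f ^^ m) z) * cnj ((bdry ^^ n) \<xi> - (f ^^ n) z))"
    have "(\<integral>\<^sub>C \<xi>. poisson_kernel z \<xi> *\<^sub>R (((bdry ^^ n) \<xi> - (f ^^ n) z) * cnj ((bdry ^^ m) \<xi> - (f ^^ m) z))) =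
        (\<integral>\<^sub>C \<xi>. cnj (?F \<xi>))"
      by (simp add: mult.commute)
    also have "\<dots> = cnj (\<integral>\<^sub>C \<xi>. ?F \<xi>)" by (rule Bochner_Integration.integral_cnj)
    finally show ?thesis using le[of n m] False by (simp only: complex_mod_cnj cov_bound_commute[of z n m])
  qed
qed

text \<open>A row of the covariance matrix contributes \<open>2 / harnack_const\<close> on either
  side of the diagonal and at most 1 on it.\<close>

definition var_const :: real where "var_const = 4 / harnack_const + 1"

lemma var_const_pos: "0 < var_const"
  using harnack_const by (simp add: var_const_def add_pos_pos)

text \<open>The bound has to be uniform in \<open>z\<close>, although near the circle the iterates
  may contract slowly for a long time. The factor \<open>1 - (norm ((f ^^ m) z))\<^sup>2\<close>
  compensates: it is small exactly as long as Harnack's estimate is weak.\<close>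

lemma sum_cov_bound:
  assumes z: "norm z < 1" and n: "n \<in> {M..<N}"
  shows "(\<Sum>m\<in>{M..<N}. cov_bound z n m) \<le> var_const"
proof -
  define t where "t i = norm ((f ^^ i) z)" for i
  define q where "q i = norm (quot ((f ^^ i) z))" for i
  define c where "c = harnack_const"
  have c: "0 < c" "c \<le> 1 / 2" using harnack_const by (auto simp: c_def)
  have t: "0 \<le> t i" "t i < 1" for i using iter_disc[OF z] by (auto simp: t_def)
  have q: "0 \<le> q i" "q i \<le> 1" "q i \<le> 1 - c * (1 - t i)" for i
    using norm_quot_le[OF iter_disc[OF z]] norm_quot_harnack[OF iter_disc[OF z]] by (auto simp: q_def t_def c_def)
  have ts: "t (Suc i) \<le> t i" for i
  proof -
    have "t (Suc i) = t i * q i" using f_eq_quot[of "(f ^^ i) z"] by (simp add: t_def q_def norm_mult)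
    then show ?thesis using t q by (simp add: mult_left_le)
  qed
  have tm: "t j \<le> t i" if "i \<le> j" for i j using lift_Suc_antimono_le[of t, OF ts that] .
  have sq: "1 - (t i)\<^sup>2 \<le> 2 * (1 - t i)" for i
  proof -
    have "1 - (t i)\<^sup>2 = (1 + t i) * (1 - t i)" by (simp add: power2_eq_square algebra_simps)
    also have "\<dots> \<le> 2 * (1 - t i)" using t[of i] by (intro mult_right_mono) auto
    finally show ?thesis .
  qed
  define Q where "Q m = (\<Prod>i\<in>{m..<n}. q i)" for m
  have Q: "0 \<le> Q m" "Q m \<le> 1" for m unfolding Q_def using q by (auto intro: prod_nonneg prod_le_1)
  \<comment> \<open>Harnack's estimate turns \<open>1 - t m\<close> into at most
    \<open>(1 - q m) / c\<close>, and multiplied by \<open>Q (Suc m)\<close> this is an increment of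
    \<open>Q\<close>. The sum telescopes, and \<open>Q\<close> lies between 0 and 1.\<close>
  have low: "(\<Sum>m\<in>{M..<n}. cov_bound z n m) \<le> 2 / c"
  proof -
    have "cov_bound z n m \<le> 2 / c * (Q (Suc m) - Q m)" if m: "m \<in> {M..<n}" for m
    proof -
      have Qm: "Q m = q m * Q (Suc m)" unfolding Q_def using m by (simp add: prod.atLeast_Suc_lessThan)
      have "cov_bound z n m = Q m * (1 - (t m)\<^sup>2)"
        using m by (simp add: cov_bound_def Q_def q_def t_def min_def max_def)
      also have "\<dots> \<le> Q (Suc m) * (2 * (1 - t m))"
      proof (rule mult_mono)
        show "Q m \<le> Q (Suc m)" unfolding Qm using q[of m] Q[of "Suc m"] by (simp add: mult_left_le_one_le)
        show "0 \<le> 1 - (t m)\<^sup>2" using t[of m] by (simp add: abs_square_le_1)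
      qed (use sq Q in auto)
      also have "\<dots> \<le> Q (Suc m) * (2 / c * (1 - q m))"
      proof (rule mult_left_mono[OF _ Q(1)])
        have "c * (1 - t m) \<le> 1 - q m" using q(3)[of m] by simp
        then show "2 * (1 - t m) \<le> 2 / c * (1 - q m)" using c by (simp add: field_simps)
      qed
      also have "\<dots> = 2 / c * (Q (Suc m) - Q m)"
      proof -
        have "x * (d * (1 - y)) = d * (x - y * x)" for x d y :: real by (simp add: algebra_simps)
        then show ?thesis unfolding Qm .
      qed
      finally show ?thesis .
    qed
    then have "(\<Sum>m\<in>{M..<n}. cov_bound z n m) \<le> (\<Sum>m\<in>{M..<n}. 2 / c * (Q (Suc m) - Q m))" by (intro sum_mono)
    also have "\<dots> = 2 / c * (Q n - Q M)"
      unfolding sum_distrib_left[symmetric] using n by (subst sum_Suc_diff') auto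
    also have "\<dots> \<le> 2 / c * 1" using c Q[of n] Q[of M] by (intro mult_left_mono) auto
    finally show ?thesis by simp
  qed
  \<comment> \<open>The moduli \<open>t i\<close> decrease along the orbit, so from index
    \<open>n\<close> on every quotient is at most \<open>1 - c * s\<close>. The geometric series
    sums to at most \<open>1 / (c * s)\<close>, and the factor \<open>2 * s\<close> in front cancels
    \<open>s\<close>.\<close>
  have high: "(\<Sum>m\<in>{Suc n..<N}. cov_bound z n m) \<le> 2 / c"
  proof -
    define s where "s = 1 - t n"
    have s: "0 < s" "s \<le> 1" using t[of n] by (auto simp: s_def)
    have cs: "0 < c * s" "c * s \<le> 1" using c s mult_mono[of c 1 s 1] by auto
    have "cov_bound z n m \<le> 2 * s * (1 - c * s) ^ (m - n)" if m: "m \<in> {Suc n..<N}" for m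
    proof -
      have "cov_bound z n m = (\<Prod>i\<in>{n..<m}. q i) * (1 - (t n)\<^sup>2)"
        using m by (simp add: cov_bound_def q_def t_def min_def max_def)
      also have "\<dots> \<le> (\<Prod>i\<in>{n..<m}. 1 - c * s) * (2 * s)"
      proof (rule mult_mono)
        show "(\<Prod>i\<in>{n..<m}. q i) \<le> (\<Prod>i\<in>{n..<m}. 1 - c * s)"
        proof (rule prod_mono, intro conjI q(1))
          fix i assume "i \<in> {n..<m}"
          then have "s \<le> 1 - t i" using tm[of n i] by (simp add: s_def)
          then have "c * s \<le> c * (1 - t i)" using c by (intro mult_left_mono) auto
          then show "q i \<le> 1 - c * s" using q(3)[of i] by linarith
        qed
        show "1 - (t n)\<^sup>2 \<le> 2 * s" using sq by (simp add: s_def)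
        show "0 \<le> 1 - (t n)\<^sup>2" using t[of n] by (simp add: abs_square_le_1)
        show "0 \<le> (\<Prod>i\<in>{n..<m}. 1 - c * s)" using cs by (intro prod_nonneg) auto
      qed
      finally show ?thesis by (simp add: mult_ac)
    qed
    then have "(\<Sum>m\<in>{Suc n..<N}. cov_bound z n m) \<le> (\<Sum>m\<in>{Suc n..<N}. 2 * s * (1 - c * s) ^ (m - n))" by (intro sum_mono)
    also have "\<dots> \<le> (\<Sum>m\<in>{n..<N}. 2 * s * (1 - c * s) ^ (m - n))"
      using s cs by (intro sum_mono2) auto
    also have "\<dots> = 2 * s * (\<Sum>k<N - n. (1 - c * s) ^ k)"
      unfolding sum_distrib_left[symmetric] using n
      by (intro arg_cong2[where f = "(*)"] refl sum.reindex_bij_witness[where i = "\<lambda>k. k + n" and j = "\<lambda>m. m - n"]) auto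
    also have "\<dots> \<le> 2 / c"
    proof -
      have "c * s * (\<Sum>k<N - n. (1 - c * s) ^ k) = 1 - (1 - c * s) ^ (N - n)"
        using one_diff_power_eq[of "1 - c * s" "N - n"] by simp
      also have "\<dots> \<le> 1" using cs by simp
      finally have "c * (s * (\<Sum>k<N - n. (1 - c * s) ^ k)) \<le> 1" by (simp only: mult.assoc)
      then have "s * (\<Sum>k<N - n. (1 - c * s) ^ k) \<le> 1 / c" using c by (simp add: field_simps)
      then show ?thesis by simp
    qed
    finally show ?thesis .
  qed
  have mid: "cov_bound z n n \<le> 1" using t[of n] by (simp add: cov_bound_def t_def)
  have "{M..<N} = {M..<n} \<union> insert n {Suc n..<N}" using n by auto
  then have "(\<Sum>m\<in>{M..<N}. cov_bound z n m) =
      (\<Sum>m\<in>{M..<n}. cov_bound z n m) + (cov_bound z n n + (\<Sum>m\<in>{Suc n..<N}. cov_bound z n m))"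
    by (simp only:) (subst sum.union_disjoint, auto)
  also have "\<dots> \<le> 2 / c + (1 + 2 / c)" using low mid high by linarith
  finally show ?thesis by (simp add: var_const_def c_def)
qed

text \<open>A Schur test for the covariance matrix of the iterates with respect to the Poisson kernel.\<close>

lemma variance_bound:
  assumes z: "norm z < 1"
  shows "(\<integral>\<^sub>C \<xi>. poisson_kernel z \<xi> * (norm (\<Sum>n\<in>{M..<N}. A n * ((bdry ^^ n) \<xi> - (f ^^ n) z)))\<^sup>2)
    \<le> var_const * (\<Sum>n\<in>{M..<N}. (norm (A n))\<^sup>2)"
proof -
  let ?I = "{M..<N}" and ?P = "poisson_kernel z"
  define X where "X n \<xi> = (bdry ^^ n) \<xi> - (f ^^ n) z" for n \<xi>
  have Xm [measurable]: "X n \<in> borel_measurable circle_measure" for n unfolding X_def by measurable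
  have XB: "norm (X n \<xi>) \<le> 2" if "norm \<xi> = 1" for n \<xi>
    unfolding X_def using norm_triangle_ineq4[of "(bdry ^^ n) \<xi>" "(f ^^ n) z"] norm_bdry_iter[OF that, of n] iter_disc[OF z, of n]
    by linarith
  have XX: "integrable circle_measure (\<lambda>\<xi>. ?P \<xi> *\<^sub>R (X n \<xi> * cnj (X m \<xi>)))" for n m
  proof (intro integrable_poisson_mult[OF z] circle_integrable_bound[where B = "2 * 2"])
    fix \<xi> :: complex assume "norm \<xi> = 1"
    from mult_mono[OF XB[OF this, of n] XB[OF this, of m]]
    show "norm (X n \<xi> * cnj (X m \<xi>)) \<le> 2 * 2" by (simp add: norm_mult)
  qed measurable
  have "complex_of_real (\<integral>\<^sub>C \<xi>. ?P \<xi> * (norm (\<Sum>n\<in>?I. A n * X n \<xi>))\<^sup>2) =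
      (\<integral>\<^sub>C \<xi>. complex_of_real (?P \<xi> * (norm (\<Sum>n\<in>?I. A n * X n \<xi>))\<^sup>2))"
    by (rule integral_complex_of_real[symmetric])
  also have "\<dots> = (\<integral>\<^sub>C \<xi>. (\<Sum>n\<in>?I. \<Sum>m\<in>?I. (A n * cnj (A m)) * (?P \<xi> *\<^sub>R (X n \<xi> * cnj (X m \<xi>)))))"
  proof (rule circle_integral_cong)
    fix \<xi>
    have "complex_of_real ((norm (\<Sum>n\<in>?I. A n * X n \<xi>))\<^sup>2) = (\<Sum>n\<in>?I. A n * X n \<xi>) * (\<Sum>m\<in>?I. cnj (A m) * cnj (X m \<xi>))"
      unfolding complex_norm_square by (simp add: cnj_sum)
    also have "\<dots> = (\<Sum>n\<in>?I. \<Sum>m\<in>?I. (A n * X n \<xi>) * (cnj (A m) * cnj (X m \<xi>)))" by (rule sum_product)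
    finally show "complex_of_real (?P \<xi> * (norm (\<Sum>n\<in>?I. A n * X n \<xi>))\<^sup>2) =
        (\<Sum>n\<in>?I. \<Sum>m\<in>?I. (A n * cnj (A m)) * (?P \<xi> *\<^sub>R (X n \<xi> * cnj (X m \<xi>))))"
      unfolding of_real_mult by (simp add: sum_distrib_left scaleR_conv_of_real mult_ac)
  qed
  also have "\<dots> = (\<Sum>n\<in>?I. \<Sum>m\<in>?I. (A n * cnj (A m)) * (\<integral>\<^sub>C \<xi>. ?P \<xi> *\<^sub>R (X n \<xi> * cnj (X m \<xi>))))"
    by (subst Bochner_Integration.integral_sum, intro Bochner_Integration.integrable_sum integrable_mult_right XX,
        subst Bochner_Integration.integral_sum, intro integrable_mult_right XX, simp only: integral_mult_right_zero)
  finally have eq: "complex_of_real (\<integral>\<^sub>C \<xi>. ?P \<xi> * (norm (\<Sum>n\<in>?I. A n * X n \<xi>))\<^sup>2) = \<dots>" .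
  have "(\<integral>\<^sub>C \<xi>. ?P \<xi> * (norm (\<Sum>n\<in>?I. A n * X n \<xi>))\<^sup>2) \<le>
      norm (complex_of_real (\<integral>\<^sub>C \<xi>. ?P \<xi> * (norm (\<Sum>n\<in>?I. A n * X n \<xi>))\<^sup>2))"
    unfolding norm_of_real by (rule abs_ge_self)
  also have "\<dots> \<le> (\<Sum>n\<in>?I. \<Sum>m\<in>?I. ((norm (A n))\<^sup>2 + (norm (A m))\<^sup>2) / 2 * cov_bound z n m)"
    unfolding eq
  proof (intro sum_norm_le)
    fix n m
    have "norm (A n) * norm (A m) \<le> ((norm (A n))\<^sup>2 + (norm (A m))\<^sup>2) / 2"
      using sum_squares_bound[of "norm (A n)" "norm (A m)"] by simp
    then show "norm ((A n * cnj (A m)) * (\<integral>\<^sub>C \<xi>. ?P \<xi> *\<^sub>R (X n \<xi> * cnj (X m \<xi>)))) \<le>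
        ((norm (A n))\<^sup>2 + (norm (A m))\<^sup>2) / 2 * cov_bound z n m"
      using norm_covariance[OF z, of n m] unfolding norm_mult complex_mod_cnj X_def
      by (intro mult_mono) auto
  qed
  also have "\<dots> = (\<Sum>n\<in>?I. \<Sum>m\<in>?I. (norm (A n))\<^sup>2 / 2 * cov_bound z n m) + (\<Sum>n\<in>?I. \<Sum>m\<in>?I. (norm (A m))\<^sup>2 / 2 * cov_bound z n m)"
    by (simp add: sum.distrib[symmetric] add_divide_distrib distrib_right)
  also have "(\<Sum>n\<in>?I. \<Sum>m\<in>?I. (norm (A m))\<^sup>2 / 2 * cov_bound z n m) = (\<Sum>n\<in>?I. \<Sum>m\<in>?I. (norm (A n))\<^sup>2 / 2 * cov_bound z n m)"
    by (subst sum.swap) (simp add: cov_bound_commute[of z])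
  also have "(\<Sum>n\<in>?I. \<Sum>m\<in>?I. (norm (A n))\<^sup>2 / 2 * cov_bound z n m) + \<dots> = (\<Sum>n\<in>?I. (norm (A n))\<^sup>2 * (\<Sum>m\<in>?I. cov_bound z n m))"
    by (simp add: sum.distrib[symmetric] sum_distrib_left mult.commute)
  also have "\<dots> \<le> (\<Sum>n\<in>?I. (norm (A n))\<^sup>2 * var_const)"
    by (intro sum_mono mult_left_mono sum_cov_bound[OF z]) auto
  also have "\<dots> = var_const * (\<Sum>n\<in>?I. (norm (A n))\<^sup>2)" by (simp add: sum_distrib_left mult.commute)
  finally show ?thesis by (simp add: X_def)
qed

end

subsection \<open>The sum in the Hardy space and in BMOA\<close>

text \<open>Expands the nonnegative Poisson mean of \<open>(norm (X \<xi> - \<mu>))\<^sup>2\<close>,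
  where \<mu> is the Poisson mean of \<open>X\<close>.\<close>

lemma poisson_jensen:
  fixes X :: "complex \<Rightarrow> complex"
  assumes z: "norm z < 1" and X: "integrable circle_measure X"
    and X2: "integrable circle_measure (\<lambda>\<xi>. (norm (X \<xi>))\<^sup>2)"
  shows "(norm (\<integral>\<^sub>C \<xi>. poisson_kernel z \<xi> *\<^sub>R X \<xi>))\<^sup>2 \<le>
    (\<integral>\<^sub>C \<xi>. poisson_kernel z \<xi> * (norm (X \<xi>))\<^sup>2)"
proof -
  define \<mu> where "\<mu> = (\<integral>\<^sub>C \<xi>. poisson_kernel z \<xi> *\<^sub>R X \<xi>)"
  note PX = integrable_poisson_mult[OF z X]
  have PX2: "integrable circle_measure (\<lambda>\<xi>. poisson_kernel z \<xi> * (norm (X \<xi>))\<^sup>2)"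
    using integrable_poisson_mult[OF z X2] by simp
  have "0 \<le> (\<integral>\<^sub>C \<xi>. poisson_kernel z \<xi> * (norm (- \<mu> + X \<xi>))\<^sup>2)"
    using poisson_kernel_nonneg[OF z] by simp
  also have "\<dots> = (\<integral>\<^sub>C \<xi>. (norm \<mu>)\<^sup>2 * poisson_kernel z \<xi> + Re ((- 2 * cnj \<mu>) * (poisson_kernel z \<xi> *\<^sub>R X \<xi>))
      + poisson_kernel z \<xi> * (norm (X \<xi>))\<^sup>2)"
    by (rule circle_integral_cong)
      (simp only: cmod_power2, simp add: power2_eq_square algebra_simps)
  also have "\<dots> = (norm \<mu>)\<^sup>2 + Re ((- 2 * cnj \<mu>) * \<mu>) + (\<integral>\<^sub>C \<xi>. poisson_kernel z \<xi> * (norm (X \<xi>))\<^sup>2)"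
  proof -
    have i: "integrable circle_measure (\<lambda>\<xi>. (- 2 * cnj \<mu>) * (poisson_kernel z \<xi> *\<^sub>R X \<xi>))"
      using PX by (rule integrable_mult_right)
    have "integrable circle_measure (\<lambda>\<xi>. Re ((- 2 * cnj \<mu>) * (poisson_kernel z \<xi> *\<^sub>R X \<xi>)))"
      using i by (rule integrable_Re)
    moreover have "(\<integral>\<^sub>C \<xi>. Re ((- 2 * cnj \<mu>) * (poisson_kernel z \<xi> *\<^sub>R X \<xi>))) = Re ((- 2 * cnj \<mu>) * \<mu>)"
      using integral_Re[OF i] by (simp only: integral_mult_right_zero \<mu>_def[symmetric])
    ultimately show ?thesis
      using PX2 integrable_poisson_kernel[OF z] integral_poisson_kernel[OF z]
      by (simp del: times_complex.simps scaleR_complex.simps)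
  qed
  also have "Re ((- 2 * cnj \<mu>) * \<mu>) = - 2 * (norm \<mu>)\<^sup>2"
    by (simp only: cmod_power2) (simp add: power2_eq_square)
  finally show ?thesis by (simp add: \<mu>_def)
qed

lemma poisson_kernel_symmetric:
  assumes "norm \<xi> = 1" "norm \<eta> = 1"
  shows "poisson_kernel (of_real r * \<xi>) \<eta> = poisson_kernel (of_real r * \<eta>) \<xi>"
proof -
  have "(norm (\<eta> - of_real r * \<xi>))\<^sup>2 = (norm (\<xi> - of_real r * \<eta>))\<^sup>2"
  proof -
    have "(Re \<xi>)\<^sup>2 + (Im \<xi>)\<^sup>2 = 1" "(Re \<eta>)\<^sup>2 + (Im \<eta>)\<^sup>2 = 1"
      using assms by (simp_all add: cmod_power2[symmetric])
    moreover have "(norm (\<eta> - of_real r * \<xi>))\<^sup>2 - (norm (\<xi> - of_real r * \<eta>))\<^sup>2 =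
        (1 - r\<^sup>2) * (((Re \<eta>)\<^sup>2 + (Im \<eta>)\<^sup>2) - ((Re \<xi>)\<^sup>2 + (Im \<xi>)\<^sup>2))"
      unfolding cmod_power2 by (simp add: power2_eq_square algebra_simps)
    ultimately show ?thesis by simp
  qed
  then show ?thesis using assms by (simp add: poisson_kernel_def norm_mult)
qed

text \<open>Jensen bounds the square of \<open>G\<close> on the circle of radius \<open>r\<close> by
  a Poisson mean. After exchanging integrals the symmetry \<open>poisson_kernel_symmetric\<close>
  lets each boundary point be weighted by the total mass of a Poisson kernel, which is 1.\<close>

lemma poisson_L2_contraction:
  fixes h :: "complex \<Rightarrow> complex"
  assumes h: "integrable circle_measure h" and h2: "integrable circle_measure (\<lambda>\<xi>. (norm (h \<xi>))\<^sup>2)"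
    and G: "\<And>z. norm z < 1 \<Longrightarrow> (\<integral>\<^sub>C \<eta>. poisson_kernel z \<eta> *\<^sub>R h \<eta>) = G z"
  shows "H2_norm_sq G \<le> ennreal (\<integral>\<^sub>C \<xi>. (norm (h \<xi>))\<^sup>2)"
  unfolding H2_norm_sq_def
proof (rule SUP_least)
  fix r :: real assume "r \<in> {0..<1}"
  then have r: "0 \<le> r" "r < 1" by auto
  have hm [measurable]: "h \<in> borel_measurable circle_measure" by (rule borel_measurable_integrable[OF h])
  interpret pair_sigma_finite circle_measure circle_measure
    by (intro pair_sigma_finite.intro circle.sigma_finite_measure_axioms)
  define K where "K \<xi> \<eta> = ennreal (poisson_kernel (of_real r * \<xi>) \<eta> * (norm (h \<eta>))\<^sup>2)" for \<xi> \<eta>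
  have Km: "case_prod K \<in> borel_measurable (circle_measure \<Otimes>\<^sub>M circle_measure)"
  proof -
    have [measurable]: "(\<lambda>p. fst p :: complex) \<in> borel_measurable (circle_measure \<Otimes>\<^sub>M circle_measure)"
      "(\<lambda>p. snd p :: complex) \<in> borel_measurable (circle_measure \<Otimes>\<^sub>M circle_measure)"
      by (rule measurable_compose[OF measurable_fst borel_measurable_circleI], simp)
        (rule measurable_compose[OF measurable_snd borel_measurable_circleI], simp)
    have [measurable]: "(\<lambda>p. h (snd p)) \<in> borel_measurable (circle_measure \<Otimes>\<^sub>M circle_measure)"
      by (rule measurable_compose[OF measurable_snd hm])
    show ?thesis unfolding K_def case_prod_beta poisson_kernel_def by measurable
  qed
  have rz: "norm (of_real r * \<xi>) < 1" if "norm \<xi> = 1" for \<xi> :: complex using r that by (simp add: norm_mult)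
  have "(\<integral>\<^sup>+\<xi>. ennreal ((norm (G (of_real r * \<xi>)))\<^sup>2) \<partial>circle_measure) \<le> (\<integral>\<^sup>+\<xi>. \<integral>\<^sup>+\<eta>. K \<xi> \<eta> \<partial>circle_measure \<partial>circle_measure)"
  proof (rule circle_nn_integral_mono)
    fix \<xi> :: complex assume "norm \<xi> = 1"
    then have z: "norm (of_real r * \<xi>) < 1" by (intro rz) (simp add: space_circle_measure)
    have "(norm (G (of_real r * \<xi>)))\<^sup>2 \<le> (\<integral>\<^sub>C \<eta>. poisson_kernel (of_real r * \<xi>) \<eta> * (norm (h \<eta>))\<^sup>2)"
      using poisson_jensen[OF z h h2] unfolding G[OF z] .
    moreover have "(\<integral>\<^sup>+\<eta>. K \<xi> \<eta> \<partial>circle_measure) = ennreal (\<integral>\<^sub>C \<eta>. poisson_kernel (of_real r * \<xi>) \<eta> * (norm (h \<eta>))\<^sup>2)"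
      unfolding K_def using integrable_poisson_mult[OF z h2] poisson_kernel_nonneg[OF z]
      by (intro nn_integral_eq_integral) auto
    ultimately show "ennreal ((norm (G (of_real r * \<xi>)))\<^sup>2) \<le> (\<integral>\<^sup>+\<eta>. K \<xi> \<eta> \<partial>circle_measure)"
      by (simp add: ennreal_leI)
  qed
  also have "\<dots> = (\<integral>\<^sup>+\<eta>. \<integral>\<^sup>+\<xi>. K \<xi> \<eta> \<partial>circle_measure \<partial>circle_measure)"
    by (rule Fubini'[OF Km, symmetric])
  also have "\<dots> = (\<integral>\<^sup>+\<eta>. ennreal ((norm (h \<eta>))\<^sup>2) \<partial>circle_measure)"
  proof (rule circle_nn_integral_cong)
    fix \<eta> :: complex assume e: "norm \<eta> = 1"
    have "(\<integral>\<^sup>+\<xi>. K \<xi> \<eta> \<partial>circle_measure) = (\<integral>\<^sup>+\<xi>. ennreal (poisson_kernel (of_real r * \<eta>) \<xi>) * ennreal ((norm (h \<eta>))\<^sup>2) \<partial>circle_measure)"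
    proof (rule circle_nn_integral_cong)
      fix \<xi> :: complex assume x: "norm \<xi> = 1"
      show "K \<xi> \<eta> = ennreal (poisson_kernel (of_real r * \<eta>) \<xi>) * ennreal ((norm (h \<eta>))\<^sup>2)"
        unfolding K_def poisson_kernel_symmetric[OF x e] using poisson_kernel_nonneg[OF rz[OF e]]
        by (simp add: ennreal_mult)
    qed
    also have "\<dots> = (\<integral>\<^sup>+\<xi>. ennreal (poisson_kernel (of_real r * \<eta>) \<xi>) \<partial>circle_measure) * ennreal ((norm (h \<eta>))\<^sup>2)"
      by (rule nn_integral_multc) simp
    also have "\<dots> = ennreal ((norm (h \<eta>))\<^sup>2)" by (simp add: nn_integral_poisson_kernel[OF rz[OF e]])
    finally show "(\<integral>\<^sup>+\<xi>. K \<xi> \<eta> \<partial>circle_measure) = ennreal ((norm (h \<eta>))\<^sup>2)" .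
  qed
  also have "\<dots> = ennreal (\<integral>\<^sub>C \<xi>. (norm (h \<xi>))\<^sup>2)"
    by (rule nn_integral_eq_integral[OF h2]) simp
  finally show "(\<integral>\<^sup>+\<xi>. ennreal ((norm (G (of_real r * \<xi>)))\<^sup>2) \<partial>circle_measure) \<le> \<dots>" .
qed

lemma circle_integrable_of_square:
  fixes h :: "complex \<Rightarrow> complex"
  assumes m: "h \<in> borel_measurable circle_measure" and i: "integrable circle_measure (\<lambda>\<xi>. (norm (h \<xi>))\<^sup>2)"
  shows "integrable circle_measure h"
proof (rule Bochner_Integration.integrable_bound[OF _ m])
  show "integrable circle_measure (\<lambda>\<xi>. 1 + (norm (h \<xi>))\<^sup>2)" using i by simp
  show "AE \<xi> in circle_measure. norm (h \<xi>) \<le> norm (1 + (norm (h \<xi>))\<^sup>2)"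
  proof (rule AE_circleI)
    fix \<xi>
    have "2 * norm (h \<xi>) \<le> 1 + (norm (h \<xi>))\<^sup>2" using sum_squares_bound[of 1 "norm (h \<xi>)"] by simp
    then have "norm (h \<xi>) \<le> 1 + (norm (h \<xi>))\<^sup>2" using norm_ge_zero[of "h \<xi>"] by linarith
    then show "norm (h \<xi>) \<le> norm (1 + (norm (h \<xi>))\<^sup>2)" by simp
  qed
qed

text \<open>Indices start at 0, so that every shifted sequence \<open>\<lambda>n. A (n + N)\<close>
  is again an instance; the unboundedness proof applies the results to such tails.\<close>

locale iterate_series_l2 = inner_dynamics +
  fixes A :: "nat \<Rightarrow> complex"
  assumes A_l2: "summable (\<lambda>n. (norm (A n))\<^sup>2)"
begin

section \<open>Partial sums, the sum and its tails, in the disc and on the circle\<close>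

definition psum :: "nat \<Rightarrow> complex \<Rightarrow> complex" where "psum N z = (\<Sum>n<N. A n * (f ^^ n) z)"
definition psum_bdry :: "nat \<Rightarrow> complex \<Rightarrow> complex" where "psum_bdry N \<xi> = (\<Sum>n<N. A n * (bdry ^^ n) \<xi>)"
definition Fsum :: "complex \<Rightarrow> complex" where "Fsum z = (\<Sum>n. A n * (f ^^ n) z)"
definition Fsum_bdry :: "complex \<Rightarrow> complex" where "Fsum_bdry \<xi> = (\<Sum>n. A n * (bdry ^^ n) \<xi>)"
definition tail :: "nat \<Rightarrow> real" where "tail M = (\<Sum>n. (norm (A (n + M)))\<^sup>2)"

lemma tail_nonneg: "0 \<le> tail M"
  unfolding tail_def by (intro suminf_nonneg summable_ignore_initial_segment A_l2) simp

lemma tail_ge: "(\<Sum>n\<in>{M..<N}. (norm (A n))\<^sup>2) \<le> tail M"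
proof -
  have "(\<Sum>n\<in>{M..<N}. (norm (A n))\<^sup>2) = (\<Sum>n<N - M. (norm (A (n + M)))\<^sup>2)"
    by (rule sum.reindex_bij_witness[where i = "\<lambda>k. k + M" and j = "\<lambda>m. m - M"]) auto
  also have "\<dots> \<le> tail M"
    unfolding tail_def by (intro sum_le_suminf summable_ignore_initial_segment A_l2) auto
  finally show ?thesis .
qed

lemma tail_tendsto: "tail \<longlonglongrightarrow> 0"
proof -
  have "(\<lambda>M. (\<Sum>n. (norm (A n))\<^sup>2) - (\<Sum>n<M. (norm (A n))\<^sup>2)) \<longlonglongrightarrow> (\<Sum>n. (norm (A n))\<^sup>2) - (\<Sum>n. (norm (A n))\<^sup>2)"
    by (intro tendsto_intros summable_LIMSEQ A_l2)
  then show ?thesis by (simp add: tail_def[abs_def] suminf_minus_initial_segment[OF A_l2])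
qed

lemma A_bounded: obtains K where "\<And>n. norm (A n) \<le> K" "0 \<le> K"
proof -
  have "norm (A n) \<le> sqrt (tail 0)" for n
    using tail_ge[of n "Suc n"] tail_ge[of 0 "Suc n"] sum_mono2[of "{0..<Suc n}" "{n}" "\<lambda>n. (norm (A n))\<^sup>2"]
    by (intro real_le_rsqrt) simp
  then show ?thesis using that[of "sqrt (tail 0)"] tail_nonneg[of 0] by simp
qed

text \<open>The orbit never leaves the disc of radius \<open>r\<close>, where Harnack's estimate
  gives one contraction factor for all steps. Bounded coefficients therefore suffice for locally
  uniform convergence.\<close>

lemma norm_iter_geometric:
  assumes z: "norm z < 1" and r: "norm z \<le> r" "r < 1"
  shows "norm ((f ^^ n) z) \<le> (1 - harnack_const * (1 - r)) ^ n * norm z"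
proof (induction n)
  case (Suc n)
  let ?w = "(f ^^ n) z" and ?\<rho> = "1 - harnack_const * (1 - r)"
  have w: "norm ?w < 1" by (rule iter_disc[OF z])
  have \<rho>: "0 \<le> ?\<rho>" "?\<rho> \<le> 1"
    using harnack_const r mult_mono[of harnack_const 1 "1 - r" 1] norm_ge_zero[of z] by (auto simp: mult_nonneg_nonneg)
  have "norm ?w \<le> ?\<rho> ^ n * norm z" by (rule Suc)
  also have "\<dots> \<le> 1 * norm z" using \<rho> by (intro mult_right_mono power_le_one) auto
  finally have "norm ?w \<le> r" using r by simp
  then have "harnack_const * (1 - r) \<le> harnack_const * (1 - norm ?w)"
    using harnack_const by (intro mult_left_mono) auto
  then have q: "norm (quot ?w) \<le> ?\<rho>" using norm_quot_harnack[OF w] by linarith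
  have "norm ((f ^^ Suc n) z) = norm (quot ?w) * norm ?w" using f_eq_quot[of ?w] by (simp add: norm_mult)
  also have "\<dots> \<le> ?\<rho> * (?\<rho> ^ n * norm z)" using q Suc \<rho> by (intro mult_mono) auto
  finally show ?case by (simp add: mult_ac)
qed simp

lemma psum_holomorphic: "psum N holomorphic_on unit_disc"
  unfolding psum_def[abs_def] by (intro holomorphic_intros iter_holomorphic)

lemma psum_uniform_limit:
  assumes r: "0 \<le> r" "r < 1"
  shows "uniform_limit (cball 0 r) psum Fsum sequentially"
proof -
  obtain K where K: "\<And>n. norm (A n) \<le> K" "0 \<le> K" using A_bounded by blast
  let ?\<rho> = "1 - harnack_const * (1 - r)"
  have \<rho>: "0 \<le> ?\<rho>" "?\<rho> < 1"
    using harnack_const r mult_mono[of harnack_const 1 "1 - r" 1] by auto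
  show ?thesis
    unfolding psum_def[abs_def] Fsum_def[abs_def]
  proof (rule Weierstrass_m_test)
    show "summable (\<lambda>n. K * ?\<rho> ^ n)" using \<rho> by (intro summable_mult summable_geometric) simp
    fix n z assume "z \<in> cball (0::complex) r"
    then have z: "norm z \<le> r" "norm z < 1" using r by auto
    have "norm ((f ^^ n) z) \<le> ?\<rho> ^ n * 1"
      using norm_iter_geometric[OF z(2,1) r(2), of n] z \<rho> mult_left_mono[of "norm z" 1 "?\<rho> ^ n"] by simp
    then show "norm (A n * (f ^^ n) z) \<le> K * ?\<rho> ^ n"
      unfolding norm_mult using K by (intro mult_mono) auto
  qed
qed

lemma psum_tendsto: "norm z < 1 \<Longrightarrow> (\<lambda>N. psum N z) \<longlonglongrightarrow> Fsum z"
  by (rule tendsto_uniform_limitI[OF psum_uniform_limit[of "norm z"]]) auto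

lemma Fsum_holomorphic: "Fsum holomorphic_on unit_disc"
proof (rule holomorphic_uniform_sequence[OF open_ball psum_holomorphic])
  fix x :: complex assume "x \<in> unit_disc"
  then have x: "norm x < 1" by simp
  define d where "d = (1 - norm x) / 2"
  have d: "0 < d" using x by (simp add: d_def)
  have sub: "cball x d \<subseteq> cball 0 ((1 + norm x) / 2)"
  proof
    fix y assume "y \<in> cball x d"
    then have "norm (y - x) \<le> d" by (simp add: dist_norm norm_minus_commute)
    then show "y \<in> cball 0 ((1 + norm x) / 2)"
      using norm_triangle_ineq[of "y - x" x] by (simp add: d_def)
  qed
  moreover have "cball 0 ((1 + norm x) / 2) \<subseteq> (unit_disc :: complex set)" using x by auto
  moreover have "uniform_limit (cball 0 ((1 + norm x) / 2)) psum Fsum sequentially"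
    using x by (intro psum_uniform_limit) auto
  ultimately show "\<exists>d>0. cball x d \<subseteq> unit_disc \<and> uniform_limit (cball x d) psum Fsum sequentially"
    using d uniform_limit_on_subset by blast
qed

lemma psum_bdry_measurable [measurable]: "psum_bdry N \<in> borel_measurable circle_measure"
  unfolding psum_bdry_def by measurable

lemma Fsum_bdry_measurable [measurable]: "Fsum_bdry \<in> borel_measurable circle_measure"
  unfolding Fsum_bdry_def by measurable

lemma AE_sums_bdry: "AE \<xi> in circle_measure. (\<lambda>n. A n * (bdry ^^ n) \<xi>) sums Fsum_bdry \<xi>"
  using AE_summable_bdry_iter[OF A_l2] by eventually_elim (simp add: Fsum_bdry_def summable_sums)

text \<open>Fatou's lemma carries the variance bound from finite blocks to the infinite tail.
  Uniformity in \<open>z\<close> yields the BMOA estimate, the choice \<open>z = 0\<close> the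
  square-integrability of the boundary sum.\<close>

lemma nn_variance:
  assumes z: "norm z < 1"
  shows "(\<integral>\<^sup>+\<xi>. ennreal ((norm ((Fsum_bdry \<xi> - psum_bdry M \<xi>) - (Fsum z - psum M z)))\<^sup>2 * poisson_kernel z \<xi>) \<partial>circle_measure)
    \<le> ennreal (var_const * tail M)"
proof -
  define X where "X k \<xi> = (\<Sum>n\<in>{M..<M + k}. A n * ((bdry ^^ n) \<xi> - (f ^^ n) z))" for k \<xi>
  have Xm [measurable]: "X k \<in> borel_measurable circle_measure" for k unfolding X_def by measurable
  have X: "X k \<xi> = (psum_bdry (M + k) \<xi> - psum_bdry M \<xi>) - (psum (M + k) z - psum M z)" for k \<xi>
    unfolding X_def psum_bdry_def psum_def
    using sum_diff_nat_ivl[of 0 M "M + k" "\<lambda>n. A n * (bdry ^^ n) \<xi>"] sum_diff_nat_ivl[of 0 M "M + k" "\<lambda>n. A n * (f ^^ n) z"]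
    by (simp add: atLeast0LessThan right_diff_distrib sum_subtractf)
  let ?u = "\<lambda>k \<xi>. ennreal ((norm (X k \<xi>))\<^sup>2 * poisson_kernel z \<xi>)"
  have XB: "norm (X k \<xi>) \<le> (\<Sum>n\<in>{M..<M + k}. norm (A n) * 2)" if "norm \<xi> = 1" for k \<xi>
    unfolding X_def
  proof (rule sum_norm_le)
    fix n
    have "norm ((bdry ^^ n) \<xi> - (f ^^ n) z) \<le> 2"
      using norm_triangle_ineq4[of "(bdry ^^ n) \<xi>" "(f ^^ n) z"] norm_bdry_iter[OF that, of n] iter_disc[OF z, of n]
      by linarith
    then show "norm (A n * ((bdry ^^ n) \<xi> - (f ^^ n) z)) \<le> norm (A n) * 2"
      unfolding norm_mult by (intro mult_left_mono) auto
  qed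
  have Xi: "integrable circle_measure (\<lambda>\<xi>. (norm (X k \<xi>))\<^sup>2)" for k
    by (rule circle_integrable_bound[where B = "(\<Sum>n\<in>{M..<M + k}. norm (A n) * 2)\<^sup>2"])
      (use XB in \<open>auto intro!: power_mono\<close>)
  have lim: "AE \<xi> in circle_measure. ennreal ((norm ((Fsum_bdry \<xi> - psum_bdry M \<xi>) - (Fsum z - psum M z)))\<^sup>2 * poisson_kernel z \<xi>)
      = liminf (\<lambda>k. ?u k \<xi>)"
    using AE_sums_bdry
  proof eventually_elim
    case (elim \<xi>)
    then have "(\<lambda>N. psum_bdry N \<xi>) \<longlonglongrightarrow> Fsum_bdry \<xi>" by (simp add: psum_bdry_def sums_def)
    from LIMSEQ_ignore_initial_segment[OF this, of M]
      LIMSEQ_ignore_initial_segment[OF psum_tendsto[OF z], of M]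
    have "(\<lambda>k. ?u k \<xi>) \<longlonglongrightarrow> ennreal ((norm ((Fsum_bdry \<xi> - psum_bdry M \<xi>) - (Fsum z - psum M z)))\<^sup>2 * poisson_kernel z \<xi>)"
      unfolding X by (intro tendsto_ennrealI tendsto_intros) (simp_all add: add.commute)
    from lim_imp_Liminf[OF _ this] show ?case by simp
  qed
  have "(\<integral>\<^sup>+\<xi>. ennreal ((norm ((Fsum_bdry \<xi> - psum_bdry M \<xi>) - (Fsum z - psum M z)))\<^sup>2 * poisson_kernel z \<xi>) \<partial>circle_measure)
      = (\<integral>\<^sup>+\<xi>. liminf (\<lambda>k. ?u k \<xi>) \<partial>circle_measure)"
    by (rule nn_integral_cong_AE[OF lim])
  also have "\<dots> \<le> liminf (\<lambda>k. integral\<^sup>N circle_measure (?u k))"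
    by (rule nn_integral_liminf) measurable
  also have "\<dots> \<le> ennreal (var_const * tail M)"
  proof (rule Liminf_le)
    show "eventually (\<lambda>k. integral\<^sup>N circle_measure (?u k) \<le> ennreal (var_const * tail M)) sequentially"
    proof (rule always_eventually, rule allI)
      fix k
      have "integral\<^sup>N circle_measure (?u k) = ennreal (\<integral>\<^sub>C \<xi>. poisson_kernel z \<xi> * (norm (X k \<xi>))\<^sup>2)"
        unfolding mult.commute[of "(norm _)\<^sup>2"]
        using integrable_poisson_mult[OF z Xi[of k]] poisson_kernel_nonneg[OF z]
        by (intro nn_integral_eq_integral) auto
      also have "(\<integral>\<^sub>C \<xi>. poisson_kernel z \<xi> * (norm (X k \<xi>))\<^sup>2) \<le> var_const * (\<Sum>n\<in>{M..<M + k}. (norm (A n))\<^sup>2)"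
        unfolding X_def by (rule variance_bound[OF z])
      also have "\<dots> \<le> var_const * tail M" using var_const_pos tail_ge by (intro mult_left_mono) auto
      finally show "integral\<^sup>N circle_measure (?u k) \<le> ennreal (var_const * tail M)" by (simp add: ennreal_leI)
    qed
  qed simp
  finally show ?thesis .
qed

lemma psum_0 [simp]: "psum N 0 = 0" by (simp add: psum_def)
lemma Fsum_0 [simp]: "Fsum 0 = 0" by (simp add: Fsum_def)

lemma L2_tail:
  shows "integrable circle_measure (\<lambda>\<xi>. (norm (Fsum_bdry \<xi> - psum_bdry M \<xi>))\<^sup>2)"
    and "(\<integral>\<^sub>C \<xi>. (norm (Fsum_bdry \<xi> - psum_bdry M \<xi>))\<^sup>2) \<le> var_const * tail M"
proof -
  have "(\<integral>\<^sup>+\<xi>. ennreal ((norm (Fsum_bdry \<xi> - psum_bdry M \<xi>))\<^sup>2) \<partial>circle_measure) =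
      (\<integral>\<^sup>+\<xi>. ennreal ((norm ((Fsum_bdry \<xi> - psum_bdry M \<xi>) - (Fsum 0 - psum M 0)))\<^sup>2 * poisson_kernel 0 \<xi>) \<partial>circle_measure)"
    by (intro circle_nn_integral_cong) (simp add: space_circle_measure)
  also have "\<dots> \<le> ennreal (var_const * tail M)" by (rule nn_variance) simp
  finally have le: "(\<integral>\<^sup>+\<xi>. ennreal ((norm (Fsum_bdry \<xi> - psum_bdry M \<xi>))\<^sup>2) \<partial>circle_measure) \<le> ennreal (var_const * tail M)" .
  show i: "integrable circle_measure (\<lambda>\<xi>. (norm (Fsum_bdry \<xi> - psum_bdry M \<xi>))\<^sup>2)"
    by (rule integrableI_nonneg) (use le in \<open>auto intro: le_less_trans\<close>)
  have "ennreal (\<integral>\<^sub>C \<xi>. (norm (Fsum_bdry \<xi> - psum_bdry M \<xi>))\<^sup>2) \<le> ennreal (var_const * tail M)"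
    using nn_integral_eq_integral[OF i] le by simp
  then show "(\<integral>\<^sub>C \<xi>. (norm (Fsum_bdry \<xi> - psum_bdry M \<xi>))\<^sup>2) \<le> var_const * tail M"
    using var_const_pos tail_nonneg[of M] by (subst (asm) ennreal_le_iff) auto
qed

lemma integrable_diff: "integrable circle_measure (\<lambda>\<xi>. Fsum_bdry \<xi> - psum_bdry M \<xi>)"
  by (rule circle_integrable_of_square[OF _ L2_tail(1)]) measurable

lemma integrable_Fsum_bdry: "integrable circle_measure Fsum_bdry"
  using integrable_diff[of 0] by (simp add: psum_bdry_def)

lemma norm_psum_bdry: "norm \<xi> = 1 \<Longrightarrow> norm (psum_bdry N \<xi>) \<le> (\<Sum>n<N. norm (A n))"
  unfolding psum_bdry_def by (rule sum_norm_le) (simp add: norm_mult norm_bdry_iter)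

lemma poisson_psum:
  assumes z: "norm z < 1"
  shows "(\<integral>\<^sub>C \<xi>. poisson_kernel z \<xi> *\<^sub>R psum_bdry N \<xi>) = psum N z"
proof -
  have i: "integrable circle_measure (\<lambda>\<xi>. poisson_kernel z \<xi> *\<^sub>R (bdry ^^ n) \<xi>)" for n
    by (intro integrable_poisson_mult[OF z] circle_integrable_bound[where B = 1]) (auto simp: norm_bdry_iter)
  have "(\<integral>\<^sub>C \<xi>. poisson_kernel z \<xi> *\<^sub>R psum_bdry N \<xi>) =
      (\<integral>\<^sub>C \<xi>. (\<Sum>n<N. A n * (poisson_kernel z \<xi> *\<^sub>R (bdry ^^ n) \<xi>)))"
    by (simp add: psum_bdry_def scaleR_sum_right)
  also have "\<dots> = (\<Sum>n<N. A n * (\<integral>\<^sub>C \<xi>. poisson_kernel z \<xi> *\<^sub>R (bdry ^^ n) \<xi>))"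
    by (subst Bochner_Integration.integral_sum, intro integrable_mult_right i)
      (simp only: integral_mult_right_zero)
  finally show ?thesis by (simp only: poisson_bdry_iter[OF z] psum_def)
qed

text \<open>For fixed \<open>z\<close> the kernel is bounded, so the Poisson integral is continuous
  in mean square: those of the partial sums, which are \<open>psum M z\<close>, converge to both
  sides.\<close>

lemma poisson_Fsum:
  assumes z: "norm z < 1"
  shows "(\<integral>\<^sub>C \<xi>. poisson_kernel z \<xi> *\<^sub>R Fsum_bdry \<xi>) = Fsum z"
proof -
  let ?D = "(\<integral>\<^sub>C \<xi>. poisson_kernel z \<xi> *\<^sub>R Fsum_bdry \<xi>)"
  define C where "C = 2 / (1 - norm z) * var_const"
  have C: "0 \<le> C" using z var_const_pos by (simp add: C_def)
  have "(norm (?D - psum M z))\<^sup>2 \<le> C * tail M" for M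
  proof -
    let ?X = "\<lambda>\<xi>. Fsum_bdry \<xi> - psum_bdry M \<xi>"
    have pi: "integrable circle_measure (psum_bdry M)"
      by (rule circle_integrable_bound[OF _ norm_psum_bdry]) measurable
    have "?D - psum M z = (\<integral>\<^sub>C \<xi>. poisson_kernel z \<xi> *\<^sub>R ?X \<xi>)"
      using integrable_poisson_mult[OF z pi] integrable_poisson_mult[OF z integrable_Fsum_bdry]
      by (simp add: scaleR_diff_right poisson_psum[OF z])
    then have "(norm (?D - psum M z))\<^sup>2 \<le> (\<integral>\<^sub>C \<xi>. poisson_kernel z \<xi> * (norm (?X \<xi>))\<^sup>2)"
      using poisson_jensen[OF z integrable_diff L2_tail(1)] by simp
    also have "\<dots> \<le> (\<integral>\<^sub>C \<xi>. 2 / (1 - norm z) * (norm (?X \<xi>))\<^sup>2)"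
    proof (rule circle_integral_mono)
      fix \<xi> :: complex assume "norm \<xi> = 1"
      from poisson_kernel_abs_le[OF z this]
      show "poisson_kernel z \<xi> * (norm (?X \<xi>))\<^sup>2 \<le> 2 / (1 - norm z) * (norm (?X \<xi>))\<^sup>2"
        by (intro mult_right_mono) auto
    qed (use integrable_poisson_mult[OF z L2_tail(1)] L2_tail(1) in \<open>simp_all\<close>)
    also have "\<dots> = 2 / (1 - norm z) * (\<integral>\<^sub>C \<xi>. (norm (?X \<xi>))\<^sup>2)" by simp
    also have "\<dots> \<le> 2 / (1 - norm z) * (var_const * tail M)"
      using z by (intro mult_left_mono L2_tail(2)) auto
    finally show ?thesis by (simp only: C_def mult.assoc)
  qed
  moreover have "(\<lambda>M. (norm (?D - psum M z))\<^sup>2) \<longlonglongrightarrow> (norm (?D - Fsum z))\<^sup>2"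
    by (intro tendsto_intros psum_tendsto z)
  moreover have "(\<lambda>M. C * tail M) \<longlonglongrightarrow> C * 0" by (intro tendsto_intros tail_tendsto)
  ultimately have "(norm (?D - Fsum z))\<^sup>2 \<le> C * 0"
    by (intro LIMSEQ_le[where X = "\<lambda>M. (norm (?D - psum M z))\<^sup>2"]) auto
  then show ?thesis by simp
qed

section \<open>Boundary values of the sum and its approximation in BMOA\<close>

lemma AE_Fsum_nontangential:
  "AE \<xi> in circle_measure. has_nontangential_limit Fsum \<xi> (Fsum_bdry \<xi>)"
  using fatou_poisson[OF integrable_Fsum_bdry]
proof eventually_elim
  case (elim \<xi>)
  then show ?case
    using has_nontangential_limit_cong[of Fsum "\<lambda>z. \<integral>\<^sub>C \<xi>. poisson_kernel z \<xi> *\<^sub>R Fsum_bdry \<xi>"]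
      poisson_Fsum by simp
qed

lemma AE_psum_nontangential:
  "AE \<xi> in circle_measure. has_nontangential_limit (psum N) \<xi> (psum_bdry N \<xi>)"
proof -
  have "AE \<xi> in circle_measure. \<forall>n. has_nontangential_limit (f ^^ n) \<xi> ((bdry ^^ n) \<xi>)"
    unfolding AE_all_countable using iter_nontangential by blast
  then show ?thesis
    unfolding psum_def[abs_def] psum_bdry_def
    by eventually_elim (intro has_nontangential_limit_sum has_nontangential_limit_cmult, blast)
qed

lemma AE_diff_nontangential:
  "AE \<xi> in circle_measure. has_nontangential_limit (\<lambda>z. Fsum z - psum N z) \<xi> (Fsum_bdry \<xi> - psum_bdry N \<xi>)"
  using AE_Fsum_nontangential AE_psum_nontangential
  by eventually_elim (rule has_nontangential_limit_diff)

lemma BMOA_norm_sq_diff: "BMOA_norm_sq (\<lambda>z. Fsum z - psum N z) \<le> ennreal (var_const * tail N)"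
  unfolding BMOA_norm_sq_def
proof (rule SUP_least)
  fix z :: complex assume "z \<in> unit_disc"
  then have z: "norm z < 1" by simp
  have "AE \<xi> in circle_measure. boundary_value (\<lambda>z. Fsum z - psum N z) \<xi> = Fsum_bdry \<xi> - psum_bdry N \<xi>"
    using AE_diff_nontangential AE_norm_circle by eventually_elim (rule boundary_value_eq)
  note bv = this
  have "(\<integral>\<^sup>+\<xi>. ennreal ((norm (boundary_value (\<lambda>z. Fsum z - psum N z) \<xi> - (Fsum z - psum N z)))\<^sup>2 * poisson_kernel z \<xi>) \<partial>circle_measure)
      = (\<integral>\<^sup>+\<xi>. ennreal ((norm ((Fsum_bdry \<xi> - psum_bdry N \<xi>) - (Fsum z - psum N z)))\<^sup>2 * poisson_kernel z \<xi>) \<partial>circle_measure)"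
    by (rule nn_integral_cong_AE) (use bv in \<open>eventually_elim, simp\<close>)
  also have "\<dots> \<le> ennreal (var_const * tail N)" by (rule nn_variance[OF z])
  finally show "(\<integral>\<^sup>+\<xi>. ennreal ((norm (boundary_value (\<lambda>z. Fsum z - psum N z) \<xi> - (Fsum z - psum N z)))\<^sup>2 * poisson_kernel z \<xi>) \<partial>circle_measure)
      \<le> ennreal (var_const * tail N)" .
qed

lemma diff_BMOA: "(\<lambda>z. Fsum z - psum N z) \<in> BMOA"
  unfolding BMOA_def
proof (intro CollectI conjI)
  show "(\<lambda>z. Fsum z - psum N z) holomorphic_on unit_disc"
    by (intro holomorphic_intros Fsum_holomorphic psum_holomorphic)
  show "AE \<xi> in circle_measure. \<exists>w. has_nontangential_limit (\<lambda>z. Fsum z - psum N z) \<xi> w"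
    using AE_diff_nontangential by eventually_elim blast
  show "BMOA_norm_sq (\<lambda>z. Fsum z - psum N z) < \<infinity>"
    using BMOA_norm_sq_diff[of N] by (auto intro: le_less_trans)
qed

lemma psum_Hinf: "psum N \<in> Hinf"
  unfolding Hinf_def
proof (intro CollectI conjI psum_holomorphic)
  show "bounded (psum N ` unit_disc)"
    unfolding bounded_iff
  proof (intro exI ballI)
    fix w assume "w \<in> psum N ` unit_disc"
    then obtain z where z: "norm z < 1" "w = psum N z" by auto
    show "norm w \<le> (\<Sum>n<N. norm (A n) * 1)"
      unfolding z(2) psum_def
      by (intro sum_norm_le) (auto simp: norm_mult intro!: mult_left_le less_imp_le[OF iter_disc[OF z(1)]])
  qed
qed

lemma Fsum_BMOA_closure: "Fsum \<in> BMOA_closure Hinf"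
  unfolding BMOA_closure_def
proof (intro CollectI conjI allI impI)
  show "Fsum \<in> BMOA" using diff_BMOA[of 0] by (simp add: psum_def)
  fix e :: real assume e: "e > 0"
  have "(\<lambda>N. sqrt (var_const * tail N)) \<longlonglongrightarrow> sqrt (var_const * 0)"
    by (intro tendsto_intros tail_tendsto)
  then have "eventually (\<lambda>N. sqrt (var_const * tail N) < e) sequentially"
    using e by (intro order_tendstoD) auto
  then obtain N where N: "sqrt (var_const * tail N) < e" by (auto simp: eventually_sequentially)
  have "BMOA_norm (\<lambda>z. Fsum z - psum N z) \<le> sqrt (var_const * tail N)"
    unfolding BMOA_norm_def
  proof (rule real_sqrt_le_mono)
    show "enn2real (BMOA_norm_sq (\<lambda>z. Fsum z - psum N z)) \<le> var_const * tail N"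
      using enn2real_mono[OF BMOA_norm_sq_diff[of N]] var_const_pos tail_nonneg[of N] by simp
  qed
  then show "\<exists>h\<in>Hinf. (\<lambda>z. Fsum z - h z) \<in> BMOA \<and> BMOA_norm (\<lambda>z. Fsum z - h z) < e"
    using N psum_Hinf diff_BMOA by (intro bexI[of _ "psum N"]) auto
qed

section \<open>Convergence in the Hardy space\<close>

lemma H2_norm_sq_diff: "H2_norm_sq (\<lambda>z. Fsum z - psum N z) \<le> ennreal (var_const * tail N)"
proof -
  have pi: "integrable circle_measure (psum_bdry N)"
    by (rule circle_integrable_bound[OF _ norm_psum_bdry]) measurable
  have "H2_norm_sq (\<lambda>z. Fsum z - psum N z) \<le> ennreal (\<integral>\<^sub>C \<xi>. (norm (Fsum_bdry \<xi> - psum_bdry N \<xi>))\<^sup>2)"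
  proof (rule poisson_L2_contraction[OF integrable_diff L2_tail(1)])
    fix z :: complex assume z: "norm z < 1"
    show "(\<integral>\<^sub>C \<eta>. poisson_kernel z \<eta> *\<^sub>R (Fsum_bdry \<eta> - psum_bdry N \<eta>)) = Fsum z - psum N z"
      using integrable_poisson_mult[OF z pi] integrable_poisson_mult[OF z integrable_Fsum_bdry]
      by (simp add: scaleR_diff_right poisson_psum[OF z] poisson_Fsum[OF z])
  qed
  also have "\<dots> \<le> ennreal (var_const * tail N)" by (intro ennreal_leI L2_tail(2))
  finally show ?thesis .
qed

lemma H2_norm_sq_bounded:
  assumes "\<And>z. norm z < 1 \<Longrightarrow> norm (G z) \<le> B"
  shows "H2_norm_sq G \<le> ennreal (B\<^sup>2)"
  unfolding H2_norm_sq_def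
proof (rule SUP_least)
  fix r :: real assume r: "r \<in> {0..<1}"
  have "(\<integral>\<^sup>+\<xi>. ennreal ((norm (G (of_real r * \<xi>)))\<^sup>2) \<partial>circle_measure) \<le> (\<integral>\<^sup>+\<xi>. ennreal (B\<^sup>2) \<partial>circle_measure)"
    by (intro circle_nn_integral_mono ennreal_leI power_mono assms) (use r in \<open>auto simp: norm_mult\<close>)
  then show "(\<integral>\<^sup>+\<xi>. ennreal ((norm (G (of_real r * \<xi>)))\<^sup>2) \<partial>circle_measure) \<le> ennreal (B\<^sup>2)"
    by (simp add: space_circle_measure emeasure_circle_measure_space)
qed

lemma H2_sums_Fsum: "H2_sums (\<lambda>n z. A n * (f ^^ n) z) Fsum"
  unfolding H2_sums_def
proof (intro conjI allI)
  fix n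
  have "H2_norm_sq (\<lambda>z. A n * (f ^^ n) z) \<le> ennreal ((norm (A n) * 1)\<^sup>2)"
    by (rule H2_norm_sq_bounded) (auto simp: norm_mult intro!: mult_left_le less_imp_le[OF iter_disc])
  then show "(\<lambda>z. A n * (f ^^ n) z) \<in> H2"
    unfolding H2_def by (auto intro!: holomorphic_intros iter_holomorphic intro: le_less_trans)
next
  have "H2_norm_sq Fsum \<le> ennreal (var_const * tail 0)" using H2_norm_sq_diff[of 0] by (simp add: psum_def)
  then show "Fsum \<in> H2" unfolding H2_def by (auto intro: Fsum_holomorphic le_less_trans)
next
  have "(\<lambda>N. ennreal (var_const * tail N)) \<longlonglongrightarrow> ennreal (var_const * 0)"
    by (intro tendsto_ennrealI tendsto_intros tail_tendsto)
  then have "(\<lambda>N. ennreal (var_const * tail N)) \<longlonglongrightarrow> 0" by simp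
  then have "(\<lambda>N. H2_norm_sq (\<lambda>z. Fsum z - psum N z)) \<longlonglongrightarrow> 0"
    by (rule tendsto_sandwich[rotated 2, OF tendsto_const]) (use H2_norm_sq_diff in auto)
  then show "(\<lambda>N. H2_norm_sq (\<lambda>z. Fsum z - (\<Sum>n<N. A n * (f ^^ n) z))) \<longlonglongrightarrow> 0"
    by (simp add: psum_def)
qed

end

subsection \<open>Riesz products\<close>

context inner_dynamics
begin

text \<open>Chosen so that the bound \<open>4 * riesz_step / (1 - norm mult0)\<close> in
  \<open>riesz_first_moment\<close> is half the conditional variance
  \<open>1 - (norm mult0)\<^sup>2\<close> of \<open>mdiff\<close>. Being at most 1/8, it also keeps
  the factors of the product positive, as \<open>mdiff\<close> is bounded by 2.\<close>

definition riesz_step :: real where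
  "riesz_step = (1 - norm mult0) * (1 - (norm mult0)\<^sup>2) / 8"

lemma riesz_step: "0 < riesz_step" "riesz_step \<le> 1 / 8"
proof -
  have q: "0 \<le> norm mult0" "norm mult0 < 1" using norm_mult0 by auto
  then have q2: "0 < 1 - (norm mult0)\<^sup>2" "1 - (norm mult0)\<^sup>2 \<le> 1" by (auto simp: abs_square_less_1)
  then show "0 < riesz_step" using q by (simp add: riesz_step_def)
  have "(1 - norm mult0) * (1 - (norm mult0)\<^sup>2) \<le> 1 * 1" using q q2 by (intro mult_mono) auto
  then show "riesz_step \<le> 1 / 8" by (simp add: riesz_step_def)
qed

text \<open>The factors with \<open>n < K\<close> of the Riesz product
  \<open>\<Prod>n. 1 + riesz_step * Re (u n * (mdiff \<circ> bdry ^^ n))\<close>.\<close>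

fun riesz :: "(nat \<Rightarrow> complex) \<Rightarrow> nat \<Rightarrow> complex \<Rightarrow> real" where
  "riesz u 0 \<xi> = 1"
| "riesz u (Suc K) \<xi> = (1 + riesz_step * Re (u 0 * mdiff \<xi>)) * riesz (\<lambda>n. u (Suc n)) K (bdry \<xi>)"

lemma riesz_measurable [measurable]: "riesz u K \<in> borel_measurable circle_measure"
proof (induction K arbitrary: u)
  case 0
  then show ?case by (simp add: fun_eq_iff[symmetric] riesz.simps(1)[abs_def])
next
  case (Suc K)
  have [measurable]: "(\<lambda>\<xi>. riesz (\<lambda>n. u (Suc n)) K (bdry \<xi>)) \<in> borel_measurable circle_measure"
    by (rule measurable_compose[OF bdry_measurable Suc])
  have "(\<lambda>\<xi>. (1 + riesz_step * Re (u 0 * mdiff \<xi>)) * riesz (\<lambda>n. u (Suc n)) K (bdry \<xi>)) \<in> borel_measurable circle_measure"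
    by measurable
  then show ?case by (simp add: riesz.simps(2)[abs_def])
qed

lemma riesz_factor_bounds:
  assumes "norm c \<le> 1" "norm \<xi> = 1"
  shows "0 \<le> 1 + riesz_step * Re (c * mdiff \<xi>)" "1 + riesz_step * Re (c * mdiff \<xi>) \<le> 2"
proof -
  have "\<bar>Re (c * mdiff \<xi>)\<bar> \<le> norm c * norm (mdiff \<xi>)"
    using abs_Re_le_cmod[of "c * mdiff \<xi>"] by (simp add: norm_mult)
  also have "\<dots> \<le> 1 * 2" using assms norm_mdiff by (intro mult_mono) auto
  finally have "\<bar>Re (c * mdiff \<xi>)\<bar> \<le> 2" by simp
  then have "\<bar>riesz_step * Re (c * mdiff \<xi>)\<bar> \<le> 1 / 8 * 2"
    unfolding abs_mult using riesz_step by (intro mult_mono) auto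
  then show "0 \<le> 1 + riesz_step * Re (c * mdiff \<xi>)" "1 + riesz_step * Re (c * mdiff \<xi>) \<le> 2"
    by linarith+
qed

lemma riesz_bounds:
  assumes "\<And>n. norm (u n) \<le> 1" "norm \<xi> = 1"
  shows "0 \<le> riesz u K \<xi> \<and> riesz u K \<xi> \<le> 2 ^ K"
  using assms
proof (induction K arbitrary: u \<xi>)
  case (Suc K)
  have IH: "0 \<le> riesz (\<lambda>n. u (Suc n)) K (bdry \<xi>) \<and> riesz (\<lambda>n. u (Suc n)) K (bdry \<xi>) \<le> 2 ^ K"
    by (rule Suc.IH) (use Suc.prems in auto)
  note fb = riesz_factor_bounds[OF Suc.prems(1)[of 0] Suc.prems(2)]
  have "(1 + riesz_step * Re (u 0 * mdiff \<xi>)) * riesz (\<lambda>n. u (Suc n)) K (bdry \<xi>) \<le> 2 * 2 ^ K"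
    using IH fb by (intro mult_mono) auto
  moreover have "0 \<le> (1 + riesz_step * Re (u 0 * mdiff \<xi>)) * riesz (\<lambda>n. u (Suc n)) K (bdry \<xi>)"
    using IH fb by (intro mult_nonneg_nonneg) auto
  ultimately show ?case by simp
qed simp

lemma integral_cnj_mdiff:
  assumes h: "integrable circle_measure (h :: complex \<Rightarrow> complex)"
  shows "(\<integral>\<^sub>C \<xi>. cnj (mdiff \<xi>) * h (bdry \<xi>)) = 0"
proof -
  have "integrable circle_measure (\<lambda>\<xi>. cnj (h \<xi>))" using h by (simp only: complex_integrable_cnj)
  from integral_mdiff[OF this]
  have "(\<integral>\<^sub>C \<xi>. cnj (cnj (mdiff \<xi>) * h (bdry \<xi>))) = 0" by simp
  then show ?thesis unfolding Bochner_Integration.integral_cnj by simp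
qed

lemma integrable_riesz_mult:
  fixes h :: "complex \<Rightarrow> complex"
  assumes "\<And>n. norm (u n) \<le> 1" "integrable circle_measure h"
  shows "integrable circle_measure (\<lambda>\<xi>. of_real (riesz u K \<xi>) * h \<xi>)"
  by (rule circle_integrable_mult_bounded[OF assms(2), where B = "2 ^ K"])
    (use riesz_bounds[OF assms(1)] in auto)

text \<open>A factor has conditional mean 1 given \<open>bdry\<close>: the real part is half the sum
  of two conjugate terms, both orthogonal to functions of \<open>bdry\<close>.\<close>

lemma integral_riesz_factor:
  assumes h: "integrable circle_measure (h :: complex \<Rightarrow> complex)"
  shows "(\<integral>\<^sub>C \<xi>. of_real (1 + riesz_step * Re (c * mdiff \<xi>)) * h (bdry \<xi>)) = (\<integral>\<^sub>C \<xi>. h \<xi>)"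
proof -
  let ?d = "complex_of_real (riesz_step / 2)"
  note hb = integrable_comp_bdry[OF h]
  have i: "integrable circle_measure (\<lambda>\<xi>. mdiff \<xi> * h (bdry \<xi>))" "integrable circle_measure (\<lambda>\<xi>. cnj (mdiff \<xi>) * h (bdry \<xi>))"
    by (rule circle_integrable_mult_bounded[OF hb, of _ 2]; simp add: norm_mdiff)+
  have "(\<integral>\<^sub>C \<xi>. of_real (1 + riesz_step * Re (c * mdiff \<xi>)) * h (bdry \<xi>)) =
      (\<integral>\<^sub>C \<xi>. h (bdry \<xi>) + (?d * c) * (mdiff \<xi> * h (bdry \<xi>)) + (?d * cnj c) * (cnj (mdiff \<xi>) * h (bdry \<xi>)))"
  proof (rule circle_integral_cong)
    fix \<xi>
    have "complex_of_real (Re (c * mdiff \<xi>)) = (c * mdiff \<xi> + cnj (c * mdiff \<xi>)) / 2"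
      by (simp only: complex_add_cnj) simp
    note R = this
    show "of_real (1 + riesz_step * Re (c * mdiff \<xi>)) * h (bdry \<xi>) =
        h (bdry \<xi>) + (?d * c) * (mdiff \<xi> * h (bdry \<xi>)) + (?d * cnj c) * (cnj (mdiff \<xi>) * h (bdry \<xi>))"
      by (simp only: of_real_add of_real_mult R) (simp add: field_simps)
  qed
  also have "\<dots> = (\<integral>\<^sub>C \<xi>. h (bdry \<xi>))"
    using hb i integral_mdiff[OF h] integral_cnj_mdiff[OF h] by simp
  finally show ?thesis using integral_bdry(1)[OF borel_measurable_integrable[OF h]] by simp
qed

lemma riesz_Suc_iter: "(bdry ^^ Suc K) \<xi> = (bdry ^^ K) (bdry \<xi>)"
  by (simp only: funpow_Suc_right comp_apply)

text \<open>Removing the factors one by one shows that under the Riesz weight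
  \<open>bdry ^^ K\<close> still has normalized Lebesgue measure as its distribution. Whatever comes
  after the product is therefore seen without distortion.\<close>

lemma integral_riesz:
  assumes u: "\<And>n. norm (u n) \<le> 1" and h: "integrable circle_measure (h :: complex \<Rightarrow> complex)"
  shows "(\<integral>\<^sub>C \<xi>. of_real (riesz u K \<xi>) * h ((bdry ^^ K) \<xi>)) = (\<integral>\<^sub>C \<xi>. h \<xi>)"
  using u
proof (induction K arbitrary: u)
  case (Suc K)
  let ?W = "riesz (\<lambda>n. u (Suc n)) K"
  have "integrable circle_measure (\<lambda>\<xi>. h ((bdry ^^ K) \<xi>))"
    using integral_bdry_iter(2)[OF borel_measurable_integrable[OF h]] h by simp
  then have i: "integrable circle_measure (\<lambda>\<xi>. of_real (?W \<xi>) * h ((bdry ^^ K) \<xi>))"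
    by (rule integrable_riesz_mult[rotated]) (rule Suc.prems)
  have "(\<integral>\<^sub>C \<xi>. of_real (riesz u (Suc K) \<xi>) * h ((bdry ^^ Suc K) \<xi>)) =
      (\<integral>\<^sub>C \<xi>. of_real (1 + riesz_step * Re (u 0 * mdiff \<xi>)) * (of_real (?W (bdry \<xi>)) * h ((bdry ^^ K) (bdry \<xi>))))"
    by (simp only: riesz.simps riesz_Suc_iter of_real_mult mult.assoc)
  also have "\<dots> = (\<integral>\<^sub>C \<xi>. of_real (?W \<xi>) * h ((bdry ^^ K) \<xi>))"
    by (rule integral_riesz_factor[OF i])
  also have "\<dots> = (\<integral>\<^sub>C \<xi>. h \<xi>)" by (rule Suc.IH) (rule Suc.prems)
  finally show ?case .
qed simp

lemma integral_riesz_one: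
  assumes "\<And>n. norm (u n) \<le> 1"
  shows "(\<integral>\<^sub>C \<xi>. riesz u K \<xi>) = 1"
proof -
  have "complex_of_real (\<integral>\<^sub>C \<xi>. riesz u K \<xi>) = 1"
    using integral_riesz[of u "\<lambda>_. 1" K] assms by simp
  then show ?thesis using of_real_eq_1_iff by blast
qed

lemma integrable_riesz: "(\<And>n. norm (u n) \<le> 1) \<Longrightarrow> integrable circle_measure (riesz u K)"
  by (rule circle_integrable_bound[where B = "2 ^ K"]) (use riesz_bounds in auto)

text \<open>Split \<xi> into \<open>mdiff \<xi>\<close> and \<open>cnj mult0 * bdry \<xi>\<close>.
  The second part reproduces the moment of the shorter product with a factor
  \<open>norm mult0\<close>; the first meets only the linear term of the first factor and adds at
  most \<open>4 * riesz_step\<close>. The bound is the fixed point of this recursion.\<close>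

lemma riesz_first_moment:
  assumes "\<And>n. norm (u n) \<le> 1"
  shows "norm (\<integral>\<^sub>C \<xi>. \<xi> * of_real (riesz u K \<xi>)) \<le> 4 * riesz_step / (1 - norm mult0)"
  using assms
proof (induction K arbitrary: u)
  case 0
  then show ?case using integral_circle_power[of 1] riesz_step norm_mult0 by simp
next
  case (Suc K)
  let ?W = "\<lambda>\<xi>. complex_of_real (riesz (\<lambda>n. u (Suc n)) K \<xi>)"
  let ?g = "\<lambda>\<xi>. 1 + riesz_step * Re (u 0 * mdiff \<xi>)"
  have u': "norm (u (Suc n)) \<le> 1" for n by (rule Suc.prems)
  have Wi: "integrable circle_measure ?W" using integrable_riesz[OF u'] by simp
  have xW: "integrable circle_measure (\<lambda>\<xi>. \<xi> * ?W \<xi>)"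
    by (rule circle_integrable_mult_bounded[OF Wi, of _ 1]) simp_all
  note Wb = integrable_comp_bdry[OF Wi] and xWb = integrable_comp_bdry[OF xW]
  have gm [measurable]: "?g \<in> borel_measurable circle_measure" by measurable
  have i1: "integrable circle_measure (\<lambda>\<xi>. of_real (?g \<xi>) * (bdry \<xi> * ?W (bdry \<xi>)))"
    by (rule circle_integrable_mult_bounded[OF xWb, of _ 2])
      (measurable, use riesz_factor_bounds[OF Suc.prems[of 0]] in \<open>simp only: norm_of_real abs_of_nonneg\<close>)
  have i2: "integrable circle_measure (\<lambda>\<xi>. mdiff \<xi> * ?W (bdry \<xi>))"
    by (rule circle_integrable_mult_bounded[OF Wb, of _ 2]) (simp_all add: norm_mdiff)
  let ?e = "\<lambda>\<xi>. mdiff \<xi> * of_real (riesz_step * Re (u 0 * mdiff \<xi>))"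
  have eb: "norm (?e \<xi>) \<le> 4 * riesz_step" if "norm \<xi> = 1" for \<xi>
  proof -
    have "\<bar>Re (u 0 * mdiff \<xi>)\<bar> \<le> norm (u 0) * norm (mdiff \<xi>)"
      using abs_Re_le_cmod[of "u 0 * mdiff \<xi>"] by (simp add: norm_mult)
    also have "\<dots> \<le> 1 * 2" using Suc.prems norm_mdiff[OF that] by (intro mult_mono) auto
    finally have "norm (mdiff \<xi>) * (riesz_step * \<bar>Re (u 0 * mdiff \<xi>)\<bar>) \<le> 2 * (riesz_step * 2)"
      using norm_mdiff[OF that] riesz_step by (intro mult_mono) auto
    then show ?thesis using riesz_step unfolding norm_mult norm_of_real abs_mult by simp
  qed
  have i3: "integrable circle_measure (\<lambda>\<xi>. ?e \<xi> * ?W (bdry \<xi>))"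
    by (rule circle_integrable_mult_bounded[OF Wb _ eb]) measurable
  have "(\<integral>\<^sub>C \<xi>. \<xi> * of_real (riesz u (Suc K) \<xi>)) =
      (\<integral>\<^sub>C \<xi>. cnj mult0 * (of_real (?g \<xi>) * (bdry \<xi> * ?W (bdry \<xi>))) + mdiff \<xi> * ?W (bdry \<xi>) + ?e \<xi> * ?W (bdry \<xi>))"
  proof (rule circle_integral_cong)
    fix \<xi>
    have "\<xi> = mdiff \<xi> + cnj mult0 * bdry \<xi>" by (simp add: mdiff_def)
    then have "\<xi> * of_real (riesz u (Suc K) \<xi>) = (mdiff \<xi> + cnj mult0 * bdry \<xi>) * (of_real (?g \<xi>) * ?W (bdry \<xi>))"
      by (simp only: riesz.simps of_real_mult)
    then show "\<xi> * of_real (riesz u (Suc K) \<xi>) = cnj mult0 * (of_real (?g \<xi>) * (bdry \<xi> * ?W (bdry \<xi>))) + mdiff \<xi> * ?W (bdry \<xi>) + ?e \<xi> * ?W (bdry \<xi>)"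
      by (simp add: algebra_simps)
  qed
  also have "\<dots> = cnj mult0 * (\<integral>\<^sub>C \<xi>. \<xi> * ?W \<xi>) + (\<integral>\<^sub>C \<xi>. ?e \<xi> * ?W (bdry \<xi>))"
    using integral_riesz_factor[OF xW, of "u 0"] integral_mdiff[OF Wi]
    by (subst Bochner_Integration.integral_add[OF Bochner_Integration.integrable_add[OF integrable_mult_right[OF i1] i2] i3],
        subst Bochner_Integration.integral_add[OF integrable_mult_right[OF i1] i2]) simp
  finally have eq: "(\<integral>\<^sub>C \<xi>. \<xi> * of_real (riesz u (Suc K) \<xi>)) = \<dots>" .
  have "norm (\<integral>\<^sub>C \<xi>. \<xi> * of_real (riesz u (Suc K) \<xi>)) \<le> norm mult0 * (4 * riesz_step / (1 - norm mult0)) + 4 * riesz_step"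
    unfolding eq
  proof (rule norm_triangle_mono)
    show "norm (cnj mult0 * (\<integral>\<^sub>C \<xi>. \<xi> * ?W \<xi>)) \<le> norm mult0 * (4 * riesz_step / (1 - norm mult0))"
      unfolding norm_mult complex_mod_cnj by (intro mult_left_mono Suc.IH u') simp
    have "norm (\<integral>\<^sub>C \<xi>. ?e \<xi> * ?W (bdry \<xi>)) \<le> (\<integral>\<^sub>C \<xi>. norm (?e \<xi> * ?W (bdry \<xi>)))"
      by (rule integral_norm_bound)
    also have "\<dots> \<le> (\<integral>\<^sub>C \<xi>. 4 * riesz_step * riesz (\<lambda>n. u (Suc n)) K (bdry \<xi>))"
    proof (rule circle_integral_mono)
      show "integrable circle_measure (\<lambda>\<xi>. norm (?e \<xi> * ?W (bdry \<xi>)))" using i3 by (rule integrable_norm)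
      show "integrable circle_measure (\<lambda>\<xi>. 4 * riesz_step * riesz (\<lambda>n. u (Suc n)) K (bdry \<xi>))"
        using integral_bdry(2)[of "riesz (\<lambda>n. u (Suc n)) K"] integrable_riesz[OF u'] by simp
      fix \<xi> :: complex assume x: "norm \<xi> = 1"
      have "0 \<le> riesz (\<lambda>n. u (Suc n)) K (bdry \<xi>)" using riesz_bounds[of "\<lambda>n. u (Suc n)" "bdry \<xi>" K] u' by simp
      then show "norm (?e \<xi> * ?W (bdry \<xi>)) \<le> 4 * riesz_step * riesz (\<lambda>n. u (Suc n)) K (bdry \<xi>)"
        using eb[OF x] riesz_step unfolding norm_mult[of _ "?W _"] norm_of_real by (intro mult_mono) auto
    qed
    also have "\<dots> = 4 * riesz_step"
      using integral_bdry(1)[of "riesz (\<lambda>n. u (Suc n)) K"] integral_riesz_one[of "\<lambda>n. u (Suc n)" K] u' by simp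
    finally show "norm (\<integral>\<^sub>C \<xi>. ?e \<xi> * ?W (bdry \<xi>)) \<le> 4 * riesz_step" .
  qed
  also have "\<dots> = 4 * riesz_step / (1 - norm mult0)" using norm_mult0 by (simp add: field_simps)
  finally show ?case .
qed

text \<open>\<open>riesz_step\<close> times the lower bound
  \<open>(1 - (norm mult0)\<^sup>2) / 4\<close> for the weighted mean square of a rotated real part
  of \<open>mdiff\<close>.\<close>

definition riesz_gain :: real where "riesz_gain = riesz_step * (1 - (norm mult0)\<^sup>2) / 4"

lemma riesz_gain: "0 < riesz_gain" "riesz_gain \<le> 1"
proof -
  have q2: "0 < 1 - (norm mult0)\<^sup>2" "1 - (norm mult0)\<^sup>2 \<le> 1" using norm_mult0 by (auto simp: abs_square_less_1)
  then show "0 < riesz_gain" using riesz_step by (simp add: riesz_gain_def)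
  have "riesz_step * (1 - (norm mult0)\<^sup>2) \<le> 1 / 8 * 1" using riesz_step q2 by (intro mult_mono) auto
  then show "riesz_gain \<le> 1" by (simp add: riesz_gain_def)
qed

text \<open>With \<open>y = c * mdiff \<xi>\<close>, the square of the real part is half of
  \<open>y * cnj y\<close> plus half the real part of \<open>y\<^sup>2\<close>. The first
  contributes \<open>(1 - (norm mult0)\<^sup>2) / 2\<close>; the second involves the first moment of
  the weight and, by the choice of \<open>riesz_step\<close>, destroys at most half of this.\<close>

lemma riesz_gain_step:
  assumes u: "\<And>n. norm (u n) \<le> 1" and c: "norm c = 1"
  shows "riesz_gain \<le> riesz_step * (\<integral>\<^sub>C \<xi>. (Re (c * mdiff \<xi>))\<^sup>2 * riesz u K (bdry \<xi>))"
proof -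
  let ?W = "\<lambda>\<xi>. complex_of_real (riesz u K \<xi>)"
  have Wi: "integrable circle_measure ?W" using integrable_riesz[OF u] by simp
  note Wb = integrable_comp_bdry[OF Wi]
  have i1: "integrable circle_measure (\<lambda>\<xi>. (mdiff \<xi> * cnj (mdiff \<xi>)) * ?W (bdry \<xi>))"
  proof (rule circle_integrable_mult_bounded[OF Wb, of _ "2 * 2"])
    show "norm (mdiff \<xi> * cnj (mdiff \<xi>)) \<le> 2 * 2" if "norm \<xi> = 1" for \<xi>
      using norm_mdiff[OF that] unfolding norm_mult complex_mod_cnj by (intro mult_mono) auto
  qed measurable
  have i2: "integrable circle_measure (\<lambda>\<xi>. mdiff \<xi> ^ 2 * ?W (bdry \<xi>))"
  proof (rule circle_integrable_mult_bounded[OF Wb, of _ "2 ^ 2"])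
    show "norm (mdiff \<xi> ^ 2) \<le> 2 ^ 2" if "norm \<xi> = 1" for \<xi>
      using norm_mdiff[OF that] unfolding norm_power by (intro power_mono) auto
  qed measurable
  have "(\<integral>\<^sub>C \<xi>. (Re (c * mdiff \<xi>))\<^sup>2 * riesz u K (bdry \<xi>)) =
      (\<integral>\<^sub>C \<xi>. Re ((mdiff \<xi> * cnj (mdiff \<xi>)) * ?W (bdry \<xi>)) / 2 + Re (c\<^sup>2 * (mdiff \<xi> ^ 2 * ?W (bdry \<xi>))) / 2)"
  proof (rule circle_integral_cong)
    fix \<xi>
    define y where "y = c * mdiff \<xi>"
    have "y * cnj y = mdiff \<xi> * cnj (mdiff \<xi>)"
      using circle_cnj[OF c] by (simp add: y_def mult_ac)
    moreover have "(Re y)\<^sup>2 = Re (y * cnj y) / 2 + Re (y\<^sup>2) / 2" by (simp add: power2_eq_square field_simps)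
    ultimately have "(Re (c * mdiff \<xi>))\<^sup>2 = Re (mdiff \<xi> * cnj (mdiff \<xi>)) / 2 + Re (c\<^sup>2 * mdiff \<xi> ^ 2) / 2"
      by (simp only: y_def power_mult_distrib)
    moreover have "Re (x * complex_of_real r) = Re x * r" for x r by simp
    ultimately show "(Re (c * mdiff \<xi>))\<^sup>2 * riesz u K (bdry \<xi>) =
        Re ((mdiff \<xi> * cnj (mdiff \<xi>)) * ?W (bdry \<xi>)) / 2 + Re (c\<^sup>2 * (mdiff \<xi> ^ 2 * ?W (bdry \<xi>))) / 2"
      by (simp only: mult.assoc[symmetric]) (simp only: distrib_right times_divide_eq_left)
  qed
  also have "\<dots> = Re (\<integral>\<^sub>C \<xi>. (mdiff \<xi> * cnj (mdiff \<xi>)) * ?W (bdry \<xi>)) / 2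
      + Re (c\<^sup>2 * (\<integral>\<^sub>C \<xi>. mdiff \<xi> ^ 2 * ?W (bdry \<xi>))) / 2"
    using i1 integrable_mult_right[OF i2, of "c\<^sup>2"]
    by (subst Bochner_Integration.integral_add) (simp_all del: times_complex.simps)
  also have "(\<integral>\<^sub>C \<xi>. (mdiff \<xi> * cnj (mdiff \<xi>)) * ?W (bdry \<xi>)) = of_real (1 - (norm mult0)\<^sup>2)"
    unfolding integral_mdiff_norm[OF Wi] using integral_riesz_one[OF u] by (simp add: scaleR_conv_of_real)
  also have "(\<integral>\<^sub>C \<xi>. mdiff \<xi> ^ 2 * ?W (bdry \<xi>)) = cnj second_coeff * (\<integral>\<^sub>C \<xi>. \<xi> * ?W \<xi>)"
    by (rule integral_mdiff_square[OF Wi])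
  finally have eq: "(\<integral>\<^sub>C \<xi>. (Re (c * mdiff \<xi>))\<^sup>2 * riesz u K (bdry \<xi>)) =
      (1 - (norm mult0)\<^sup>2) / 2 + Re (c\<^sup>2 * (cnj second_coeff * (\<integral>\<^sub>C \<xi>. \<xi> * ?W \<xi>))) / 2"
    by (simp only: Re_complex_of_real)
  have "norm (c\<^sup>2 * (cnj second_coeff * (\<integral>\<^sub>C \<xi>. \<xi> * ?W \<xi>))) \<le> 1 * (1 * (4 * riesz_step / (1 - norm mult0)))"
    unfolding norm_mult norm_power complex_mod_cnj c using norm_second_coeff riesz_first_moment[of u K] u
    by (intro mult_mono) auto
  also have "\<dots> = (1 - (norm mult0)\<^sup>2) / 2"
  proof -
    have "1 * (1 * (4 * (x * y / 8) / x)) = y / 2" if "x \<noteq> 0" for x y :: real using that by simp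
    then show ?thesis unfolding riesz_step_def using norm_mult0 by (metis diff_gt_0_iff_gt less_irrefl)
  qed
  finally have "- ((1 - (norm mult0)\<^sup>2) / 2) \<le> Re (c\<^sup>2 * (cnj second_coeff * (\<integral>\<^sub>C \<xi>. \<xi> * ?W \<xi>)))"
    using abs_Re_le_cmod[of "c\<^sup>2 * (cnj second_coeff * (\<integral>\<^sub>C \<xi>. \<xi> * ?W \<xi>))"] by linarith
  then have "(1 - (norm mult0)\<^sup>2) / 4 \<le> (\<integral>\<^sub>C \<xi>. (Re (c * mdiff \<xi>))\<^sup>2 * riesz u K (bdry \<xi>))"
    unfolding eq by linarith
  from mult_left_mono[OF this, of riesz_step] show ?thesis using riesz_step by (simp add: riesz_gain_def)
qed

text \<open>In the term of index 0 the constant part of the first factor averages out and the linear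
  part gives the gain. In the remaining terms the first factor has conditional mean 1, which leaves
  the same correlation for the shifted sequence.\<close>

lemma riesz_correlation:
  "riesz_gain * (\<Sum>m<K. norm (b m)) \<le>
    Re (\<integral>\<^sub>C \<xi>. of_real (riesz (\<lambda>n. sgn (b n)) K \<xi>) * (\<Sum>m<K. b m * mdiff ((bdry ^^ m) \<xi>)))"
proof (induction K arbitrary: b)
  case (Suc K)
  define u where "u n = sgn (b n)" for n
  have u: "norm (u n) \<le> 1" for n by (simp add: u_def norm_sgn)
  let ?V = "riesz (\<lambda>n. u (Suc n)) K"
  let ?W = "\<lambda>\<xi>. complex_of_real (?V \<xi>)"
  let ?g = "\<lambda>\<xi>. 1 + riesz_step * Re (u 0 * mdiff \<xi>)"
  define Y where "Y \<xi> = (\<Sum>m<K. b (Suc m) * mdiff ((bdry ^^ m) \<xi>))" for \<xi>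
  have Wi: "integrable circle_measure ?W" using integrable_riesz[of "\<lambda>n. u (Suc n)"] u by simp
  note Wb = integrable_comp_bdry[OF Wi]
  have Yi: "integrable circle_measure Y"
  proof (rule circle_integrable_bound[where B = "\<Sum>m<K. norm (b (Suc m)) * 2"])
    show "Y \<in> borel_measurable circle_measure" unfolding Y_def by measurable
    show "norm (Y \<xi>) \<le> (\<Sum>m<K. norm (b (Suc m)) * 2)" if "norm \<xi> = 1" for \<xi>
      unfolding Y_def
      by (intro sum_norm_le) (auto simp: norm_mult intro!: mult_left_mono norm_mdiff norm_bdry_iter[OF that])
  qed
  have WY: "integrable circle_measure (\<lambda>\<xi>. ?W \<xi> * Y \<xi>)"
    by (rule integrable_riesz_mult[OF _ Yi]) (rule u)
  have i1: "integrable circle_measure (\<lambda>\<xi>. of_real (?g \<xi>) * (?W (bdry \<xi>) * Y (bdry \<xi>)))"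
    by (rule circle_integrable_mult_bounded[OF integrable_comp_bdry[OF WY], of _ 2])
      (measurable, use riesz_factor_bounds[OF u[of 0]] in \<open>simp only: norm_of_real abs_of_nonneg\<close>)
  have i2: "integrable circle_measure (\<lambda>\<xi>. mdiff \<xi> * ?W (bdry \<xi>))"
    by (rule circle_integrable_mult_bounded[OF Wb, of _ 2]) (simp_all add: norm_mdiff)
  let ?e = "\<lambda>\<xi>. mdiff \<xi> * of_real (Re (u 0 * mdiff \<xi>))"
  have i3: "integrable circle_measure (\<lambda>\<xi>. ?e \<xi> * ?W (bdry \<xi>))"
  proof (rule circle_integrable_mult_bounded[OF Wb, of _ "2 * (1 * 2)"])
    fix \<xi> :: complex assume x: "norm \<xi> = 1"
    have "\<bar>Re (u 0 * mdiff \<xi>)\<bar> \<le> norm (u 0) * norm (mdiff \<xi>)"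
      using abs_Re_le_cmod[of "u 0 * mdiff \<xi>"] by (simp add: norm_mult)
    also have "\<dots> \<le> 1 * 2" using u norm_mdiff[OF x] by (intro mult_mono) auto
    finally show "norm (?e \<xi>) \<le> 2 * (1 * 2)"
      unfolding norm_mult norm_of_real using norm_mdiff[OF x] by (intro mult_mono) auto
  qed measurable
  have "(\<integral>\<^sub>C \<xi>. of_real (riesz u (Suc K) \<xi>) * (\<Sum>m<Suc K. b m * mdiff ((bdry ^^ m) \<xi>))) =
      (\<integral>\<^sub>C \<xi>. of_real (?g \<xi>) * (?W (bdry \<xi>) * Y (bdry \<xi>)) + b 0 * (mdiff \<xi> * ?W (bdry \<xi>))
        + (of_real riesz_step * b 0) * (?e \<xi> * ?W (bdry \<xi>)))"
  proof (rule circle_integral_cong)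
    fix \<xi>
    have "(\<Sum>m<Suc K. b m * mdiff ((bdry ^^ m) \<xi>)) = b 0 * mdiff \<xi> + Y (bdry \<xi>)"
      unfolding sum.lessThan_Suc_shift riesz_Suc_iter Y_def by simp
    then show "of_real (riesz u (Suc K) \<xi>) * (\<Sum>m<Suc K. b m * mdiff ((bdry ^^ m) \<xi>)) =
        of_real (?g \<xi>) * (?W (bdry \<xi>) * Y (bdry \<xi>)) + b 0 * (mdiff \<xi> * ?W (bdry \<xi>))
        + (of_real riesz_step * b 0) * (?e \<xi> * ?W (bdry \<xi>))"
      by (simp add: algebra_simps)
  qed
  also have "\<dots> = (\<integral>\<^sub>C \<xi>. ?W \<xi> * Y \<xi>) + (of_real riesz_step * b 0) * (\<integral>\<^sub>C \<xi>. ?e \<xi> * ?W (bdry \<xi>))"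
    using integral_riesz_factor[OF WY, of "u 0"] integral_mdiff[OF Wi]
    by (subst Bochner_Integration.integral_add[OF Bochner_Integration.integrable_add[OF i1 integrable_mult_right[OF i2]] integrable_mult_right[OF i3]],
        subst Bochner_Integration.integral_add[OF i1 integrable_mult_right[OF i2]]) simp
  finally have eq: "(\<integral>\<^sub>C \<xi>. of_real (riesz u (Suc K) \<xi>) * (\<Sum>m<Suc K. b m * mdiff ((bdry ^^ m) \<xi>))) = \<dots>" .
  have IH: "riesz_gain * (\<Sum>m<K. norm (b (Suc m))) \<le> Re (\<integral>\<^sub>C \<xi>. ?W \<xi> * Y \<xi>)"
    using Suc[of "\<lambda>n. b (Suc n)"] by (simp only: u_def Y_def)
  have "riesz_gain * norm (b 0) \<le> Re ((of_real riesz_step * b 0) * (\<integral>\<^sub>C \<xi>. ?e \<xi> * ?W (bdry \<xi>)))"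
  proof (cases "b 0 = 0")
    case False
    then have c: "norm (u 0) = 1" by (simp add: u_def norm_sgn)
    have Re_scale: "p * (q * Re x) = Re (of_real (p * q) * x)" for p q x by simp
    \<comment> \<open>Why the phases of the product are signs of the coefficients: the coefficient
      and the factor rotate \<open>mdiff\<close> by the same angle, so the real part of their
      product is \<open>norm (b 0)\<close> times a square.\<close>
    have b0: "b 0 = of_real (norm (b 0)) * u 0" using False by (simp add: u_def sgn_eq)
    have "riesz_gain * norm (b 0) \<le> norm (b 0) * (riesz_step * (\<integral>\<^sub>C \<xi>. (Re (u 0 * mdiff \<xi>))\<^sup>2 * ?V (bdry \<xi>)))"
      using mult_left_mono[OF riesz_gain_step[of "\<lambda>n. u (Suc n)" "u 0" K], of "norm (b 0)"] u c by (simp add: mult.commute)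
    also have "(\<integral>\<^sub>C \<xi>. (Re (u 0 * mdiff \<xi>))\<^sup>2 * ?V (bdry \<xi>)) = (\<integral>\<^sub>C \<xi>. Re (u 0 * (?e \<xi> * ?W (bdry \<xi>))))"
    proof (rule circle_integral_cong)
      fix \<xi>
      have "u 0 * (?e \<xi> * ?W (bdry \<xi>)) = (u 0 * mdiff \<xi>) * of_real (Re (u 0 * mdiff \<xi>) * ?V (bdry \<xi>))"
        by (simp add: mult_ac)
      moreover have "Re (x * complex_of_real r) = Re x * r" for x r by simp
      ultimately have "Re (u 0 * (?e \<xi> * ?W (bdry \<xi>))) = Re (u 0 * mdiff \<xi>) * (Re (u 0 * mdiff \<xi>) * ?V (bdry \<xi>))"
        by (simp only:)
      then show "(Re (u 0 * mdiff \<xi>))\<^sup>2 * ?V (bdry \<xi>) = Re (u 0 * (?e \<xi> * ?W (bdry \<xi>)))"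
        by (simp only: power2_eq_square mult.assoc)
    qed
    also have "\<dots> = Re (u 0 * (\<integral>\<^sub>C \<xi>. ?e \<xi> * ?W (bdry \<xi>)))"
      using integral_Re[OF integrable_mult_right[OF i3, of "u 0"]] by (simp only: integral_mult_right_zero)
    also have "norm (b 0) * (riesz_step * Re (u 0 * (\<integral>\<^sub>C \<xi>. ?e \<xi> * ?W (bdry \<xi>)))) =
        Re (of_real (norm (b 0) * riesz_step) * (u 0 * (\<integral>\<^sub>C \<xi>. ?e \<xi> * ?W (bdry \<xi>))))"
      by (rule Re_scale)
    also have "of_real (norm (b 0) * riesz_step) * (u 0 * (\<integral>\<^sub>C \<xi>. ?e \<xi> * ?W (bdry \<xi>))) =
        (of_real riesz_step * (of_real (norm (b 0)) * u 0)) * (\<integral>\<^sub>C \<xi>. ?e \<xi> * ?W (bdry \<xi>))"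
      by (simp only: of_real_mult mult_ac)
    finally show ?thesis by (simp only: b0[symmetric])
  qed simp
  then show ?case
    using IH eq unfolding sum.lessThan_Suc_shift[of "\<lambda>m. norm (b m)"] u_def[symmetric]
    by (simp only: plus_complex.sel distrib_left)
qed simp

end

subsection \<open>Unboundedness near every boundary point\<close>

context inner_dynamics
begin

lemma integral_riesz_real:
  assumes u: "\<And>n. norm (u n) \<le> 1" and h: "integrable circle_measure (h :: complex \<Rightarrow> real)"
  shows "(\<integral>\<^sub>C \<xi>. riesz u K \<xi> * h ((bdry ^^ K) \<xi>)) = (\<integral>\<^sub>C \<xi>. h \<xi>)"
proof -
  have "integrable circle_measure (\<lambda>\<xi>. complex_of_real (h \<xi>))" using h by simp
  from integral_riesz[where u = u and K = K, OF u this]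
  have "complex_of_real (\<integral>\<^sub>C \<xi>. riesz u K \<xi> * h ((bdry ^^ K) \<xi>)) = complex_of_real (\<integral>\<^sub>C \<xi>. h \<xi>)"
    by (simp only: of_real_mult[symmetric] integral_complex_of_real)
  then show ?thesis by (simp only: of_real_eq_iff)
qed

lemma integrable_riesz_mult_real:
  fixes h :: "complex \<Rightarrow> real"
  assumes "\<And>n. norm (u n) \<le> 1" "integrable circle_measure h"
  shows "integrable circle_measure (\<lambda>\<xi>. riesz u K \<xi> * h \<xi>)"
proof -
  have "integrable circle_measure (\<lambda>\<xi>. complex_of_real (h \<xi>))" using assms(2) by simp
  from integrable_Re[OF integrable_riesz_mult[where u = u and K = K, OF assms(1) this]] show ?thesis by simp
qed

end

context iterate_series_l2
begin

definition tail_series :: "nat \<Rightarrow> complex \<Rightarrow> complex" where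
  "tail_series N \<xi> = (\<Sum>n. A (n + N) * (bdry ^^ n) \<xi>)"

lemma shifted: "iterate_series_l2 f (\<lambda>n. A (n + N))"
  by unfold_locales (rule summable_ignore_initial_segment[OF A_l2])

lemma AE_split: "AE \<xi> in circle_measure. Fsum_bdry \<xi> = psum_bdry N \<xi> + tail_series N ((bdry ^^ N) \<xi>)"
  using AE_sums_bdry
proof eventually_elim
  case (elim \<xi>)
  have "(\<lambda>n. A (n + N) * (bdry ^^ (n + N)) \<xi>) = (\<lambda>n. A (n + N) * (bdry ^^ n) ((bdry ^^ N) \<xi>))"
    by (simp only: funpow_add comp_apply)
  with suminf_split_initial_segment[OF sums_summable[OF elim], of N]
  show ?case
    by (simp only: Fsum_bdry_def psum_bdry_def tail_series_def add.commute)
qed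

lemma tail_antimono: "tail N \<le> tail 0"
  unfolding tail_def by (simp add: suminf_minus_initial_segment[OF A_l2] sum_nonneg)

text \<open>The point is the uniformity in \<open>N\<close>, obtained by estimating the modulus by 1
  plus its square and the square by the tail of the coefficients.\<close>

lemma tail_series_integrable: "integrable circle_measure (tail_series N)"
  and tail_series_L1: "(\<integral>\<^sub>C \<xi>. norm (tail_series N \<xi>)) \<le> 1 + var_const * tail 0"
proof -
  interpret S: iterate_series_l2 f "\<lambda>n. A (n + N)" by (rule shifted)
  have eq: "tail_series N = S.Fsum_bdry" by (simp add: fun_eq_iff tail_series_def S.Fsum_bdry_def)
  show i: "integrable circle_measure (tail_series N)" unfolding eq by (rule S.integrable_Fsum_bdry)
  have i2: "integrable circle_measure (\<lambda>\<xi>. (norm (tail_series N \<xi>))\<^sup>2)"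
    using S.L2_tail(1)[of 0] by (simp add: eq S.psum_bdry_def)
  have "(\<integral>\<^sub>C \<xi>. norm (tail_series N \<xi>)) \<le> (\<integral>\<^sub>C \<xi>. 1 + (norm (tail_series N \<xi>))\<^sup>2)"
  proof (rule circle_integral_mono)
    fix \<xi>
    have "2 * norm (tail_series N \<xi>) \<le> 1 + (norm (tail_series N \<xi>))\<^sup>2"
      using sum_squares_bound[of 1 "norm (tail_series N \<xi>)"] by simp
    then show "norm (tail_series N \<xi>) \<le> 1 + (norm (tail_series N \<xi>))\<^sup>2"
      using norm_ge_zero[of "tail_series N \<xi>"] by linarith
  qed (use i i2 in auto)
  also have "\<dots> = 1 + (\<integral>\<^sub>C \<xi>. (norm (tail_series N \<xi>))\<^sup>2)" using i2 by simp
  also have "(\<integral>\<^sub>C \<xi>. (norm (tail_series N \<xi>))\<^sup>2) \<le> var_const * tail N"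
    using S.L2_tail(2)[of 0] by (simp add: eq S.psum_bdry_def S.tail_def tail_def)
  also have "\<dots> \<le> var_const * tail 0" using var_const_pos tail_antimono by (intro mult_left_mono) auto
  finally show "(\<integral>\<^sub>C \<xi>. norm (tail_series N \<xi>)) \<le> 1 + var_const * tail 0" by simp
qed

abbreviation "Fweight k \<equiv> riesz (\<lambda>n. sgn (mcoeff A n)) (Suc k)"

lemma sgn_le: "norm (sgn (mcoeff A n)) \<le> 1"
  by (simp add: norm_sgn)

text \<open>Up to a function \<open>r\<close> of \<open>bdry ^^ Suc k\<close> the sum is the
  martingale sum that \<open>riesz_correlation\<close> treats. Under the weight that iterate is
  still uniformly distributed, so the remainder costs only its integral, bounded independently of
  \<open>k\<close>. The second estimate allows later errors proportional to the weighted mean of the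
  modulus to be absorbed.\<close>

lemma riesz_Fsum:
  obtains R where "\<And>k. riesz_gain * (\<Sum>m<Suc k. norm (mcoeff A m)) - R \<le> (\<integral>\<^sub>C \<xi>. Fweight k \<xi> * Re (Fsum_bdry \<xi>))"
    and "\<And>k. (\<integral>\<^sub>C \<xi>. Fweight k \<xi> * norm (Fsum_bdry \<xi>)) \<le> 2 * (\<Sum>m<Suc k. norm (mcoeff A m)) + R"
proof -
  obtain \<beta> where \<beta>: "\<And>k. norm (mcoeff A k) \<le> \<beta>"
  proof -
    have "Bseq (\<lambda>n. (norm (mcoeff A n))\<^sup>2)"
      by (rule convergent_imp_Bseq[OF convergentI[OF summable_LIMSEQ_zero[OF summable_mcoeff_sq[OF A_l2]]]])
    then obtain K where K: "\<And>n. (norm (mcoeff A n))\<^sup>2 \<le> K" unfolding Bseq_def by auto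
    then have "norm (mcoeff A n) \<le> sqrt K" for n by (intro real_le_rsqrt)
    then show ?thesis using that by blast
  qed
  define R where "R = 1 + var_const * tail 0 + \<beta>"
  have *: "riesz_gain * (\<Sum>m<Suc k. norm (mcoeff A m)) - R \<le> (\<integral>\<^sub>C \<xi>. Fweight k \<xi> * Re (Fsum_bdry \<xi>)) \<and>
      (\<integral>\<^sub>C \<xi>. Fweight k \<xi> * norm (Fsum_bdry \<xi>)) \<le> 2 * (\<Sum>m<Suc k. norm (mcoeff A m)) + R" for k
  proof -
    define B where "B = (\<Sum>m<Suc k. norm (mcoeff A m))"
    define Q where "Q \<xi> = (\<Sum>m<Suc k. mcoeff A m * mdiff ((bdry ^^ m) \<xi>))" for \<xi>
    \<comment> \<open>The second summand is the boundary term of \<open>sum_mcoeff\<close>; its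
      coefficient is bounded by \<beta>.\<close>
    define r where "r \<eta> = tail_series (Suc k) \<eta> + cnj mult0 * mcoeff A k * \<eta>" for \<eta>
    have Qm [measurable]: "Q \<in> borel_measurable circle_measure" unfolding Q_def by measurable
    have QB: "norm (Q \<xi>) \<le> 2 * B" if "norm \<xi> = 1" for \<xi>
      unfolding Q_def B_def sum_distrib_left
    proof (rule sum_norm_le)
      fix m
      show "norm (mcoeff A m * mdiff ((bdry ^^ m) \<xi>)) \<le> 2 * norm (mcoeff A m)"
        using mult_left_mono[OF norm_mdiff[OF norm_bdry_iter[OF that, of m]], of "norm (mcoeff A m)"]
        by (simp add: norm_mult mult.commute)
    qed
    have Qi: "integrable circle_measure Q" by (rule circle_integrable_bound[OF Qm QB])
    have idi: "integrable circle_measure (\<lambda>\<eta>. \<eta> :: complex)"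
      by (rule circle_integrable_bound[where B = 1]) auto
    have ri: "integrable circle_measure r"
      unfolding r_def using tail_series_integrable idi by simp
    have rb: "(\<integral>\<^sub>C \<xi>. norm (r \<xi>)) \<le> R"
    proof -
      have "(\<integral>\<^sub>C \<xi>. norm (r \<xi>)) \<le> (\<integral>\<^sub>C \<xi>. norm (tail_series (Suc k) \<xi>) + \<beta>)"
      proof (rule circle_integral_mono)
        fix \<xi> :: complex assume x: "norm \<xi> = 1"
        have "norm mult0 * norm (mcoeff A k) \<le> 1 * \<beta>" using norm_mult0 \<beta> by (intro mult_mono) auto
        then have "norm (cnj mult0 * mcoeff A k * \<xi>) \<le> \<beta>" using x by (simp add: norm_mult)
        then show "norm (r \<xi>) \<le> norm (tail_series (Suc k) \<xi>) + \<beta>"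
          unfolding r_def by (intro norm_triangle_le) simp
      qed (use ri tail_series_integrable in auto)
      also have "\<dots> = (\<integral>\<^sub>C \<xi>. norm (tail_series (Suc k) \<xi>)) + \<beta>"
        using tail_series_integrable by simp
      finally show ?thesis using tail_series_L1[of "Suc k"] by (simp add: R_def)
    qed
    have W0: "0 \<le> Fweight k \<xi>" if "norm \<xi> = 1" for \<xi>
      using riesz_bounds[of "\<lambda>n. sgn (mcoeff A n)" \<xi> "Suc k"] sgn_le that by blast
    have rTi: "integrable circle_measure (\<lambda>\<xi>. r ((bdry ^^ Suc k) \<xi>))"
      using integral_bdry_iter(2)[OF borel_measurable_integrable[OF ri]] ri by blast
    have Wr: "(\<integral>\<^sub>C \<xi>. Fweight k \<xi> * norm (r ((bdry ^^ Suc k) \<xi>))) \<le> R"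
      using integral_riesz_real[where u = "\<lambda>n. sgn (mcoeff A n)" and K = "Suc k", OF sgn_le integrable_norm[OF ri]] rb by (simp only:)
    have AEF: "AE \<xi> in circle_measure. Fsum_bdry \<xi> = Q \<xi> + r ((bdry ^^ Suc k) \<xi>)"
      using AE_split[of "Suc k"]
    proof eventually_elim
      case (elim \<xi>)
      then show ?case unfolding psum_bdry_def sum_mcoeff Q_def r_def by (simp only: add_ac)
    qed
    note WQi = integrable_riesz_mult_real[where u = "\<lambda>n. sgn (mcoeff A n)" and K = "Suc k", OF sgn_le integrable_Re[OF Qi]]
    note Wri = integrable_riesz_mult_real[where u = "\<lambda>n. sgn (mcoeff A n)" and K = "Suc k", OF sgn_le integrable_norm[OF rTi]]
    note WF = integrable_riesz_mult_real[where u = "\<lambda>n. sgn (mcoeff A n)" and K = "Suc k", OF sgn_le integrable_Re[OF integrable_Fsum_bdry]]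
    note WFn = integrable_riesz_mult_real[where u = "\<lambda>n. sgn (mcoeff A n)" and K = "Suc k", OF sgn_le integrable_norm[OF integrable_Fsum_bdry]]
    have "riesz_gain * B \<le> Re (\<integral>\<^sub>C \<xi>. of_real (Fweight k \<xi>) * Q \<xi>)"
      unfolding B_def Q_def by (rule riesz_correlation)
    also have "\<dots> = (\<integral>\<^sub>C \<xi>. Fweight k \<xi> * Re (Q \<xi>))"
      using integral_Re[OF integrable_riesz_mult[where u = "\<lambda>n. sgn (mcoeff A n)" and K = "Suc k", OF sgn_le Qi]] by (simp del: riesz.simps)
    also have "\<dots> \<le> (\<integral>\<^sub>C \<xi>. Fweight k \<xi> * Re (Fsum_bdry \<xi>) + Fweight k \<xi> * norm (r ((bdry ^^ Suc k) \<xi>)))"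
    proof (rule integral_mono_AE[OF WQi Bochner_Integration.integrable_add[OF WF Wri]])
      show "AE \<xi> in circle_measure. Fweight k \<xi> * Re (Q \<xi>) \<le> Fweight k \<xi> * Re (Fsum_bdry \<xi>) + Fweight k \<xi> * norm (r ((bdry ^^ Suc k) \<xi>))"
        using AEF AE_norm_circle
      proof eventually_elim
        case (elim \<xi>)
        have "Re (Q \<xi>) \<le> Re (Fsum_bdry \<xi>) + norm (r ((bdry ^^ Suc k) \<xi>))"
          unfolding elim(1) using abs_Re_le_cmod[of "r ((bdry ^^ Suc k) \<xi>)"] by (simp del: funpow.simps)
        from mult_left_mono[OF this W0[OF elim(2)]] show ?case by (simp only: distrib_left)
      qed
    qed
    also have "\<dots> = (\<integral>\<^sub>C \<xi>. Fweight k \<xi> * Re (Fsum_bdry \<xi>)) + (\<integral>\<^sub>C \<xi>. Fweight k \<xi> * norm (r ((bdry ^^ Suc k) \<xi>)))"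
      by (rule Bochner_Integration.integral_add[OF WF Wri])
    finally have 1: "riesz_gain * B - R \<le> (\<integral>\<^sub>C \<xi>. Fweight k \<xi> * Re (Fsum_bdry \<xi>))"
      using Wr by linarith
    have Wi: "integrable circle_measure (\<lambda>\<xi>. Fweight k \<xi> * (2 * B))"
      using integrable_riesz[where u = "\<lambda>n. sgn (mcoeff A n)" and K = "Suc k", OF sgn_le] by (intro integrable_mult_left)
    have "(\<integral>\<^sub>C \<xi>. Fweight k \<xi> * norm (Fsum_bdry \<xi>)) \<le>
        (\<integral>\<^sub>C \<xi>. Fweight k \<xi> * (2 * B) + Fweight k \<xi> * norm (r ((bdry ^^ Suc k) \<xi>)))"
    proof (rule integral_mono_AE[OF WFn Bochner_Integration.integrable_add[OF Wi Wri]])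
      show "AE \<xi> in circle_measure. Fweight k \<xi> * norm (Fsum_bdry \<xi>) \<le> Fweight k \<xi> * (2 * B) + Fweight k \<xi> * norm (r ((bdry ^^ Suc k) \<xi>))"
        using AEF AE_norm_circle
      proof eventually_elim
        case (elim \<xi>)
        have "norm (Fsum_bdry \<xi>) \<le> 2 * B + norm (r ((bdry ^^ Suc k) \<xi>))"
          unfolding elim(1) by (intro norm_triangle_le add_right_mono QB elim)
        from mult_left_mono[OF this W0[OF elim(2)]] show ?case by (simp only: distrib_left)
      qed
    qed
    also have "\<dots> = (\<integral>\<^sub>C \<xi>. Fweight k \<xi> * (2 * B)) + (\<integral>\<^sub>C \<xi>. Fweight k \<xi> * norm (r ((bdry ^^ Suc k) \<xi>)))"
      by (rule Bochner_Integration.integral_add[OF Wi Wri])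
    also have "(\<integral>\<^sub>C \<xi>. Fweight k \<xi> * (2 * B)) = 2 * B"
      using integral_riesz_one[where u = "\<lambda>n. sgn (mcoeff A n)" and K = "Suc k", OF sgn_le] by (simp only: integral_mult_left_zero mult_1_left)
    finally have 2: "(\<integral>\<^sub>C \<xi>. Fweight k \<xi> * norm (Fsum_bdry \<xi>)) \<le> 2 * B + R"
      using Wr by linarith
    from 1 2 show ?thesis unfolding B_def ..
  qed
  show ?thesis by (rule that[of R]) (use * in blast)+
qed

lemma iter_tendsto_0: "norm z < 1 \<Longrightarrow> (\<lambda>n. norm ((f ^^ n) z)) \<longlonglongrightarrow> 0"
proof -
  assume z: "norm z < 1"
  let ?\<rho> = "1 - harnack_const * (1 - norm z)"
  have \<rho>: "0 \<le> ?\<rho>" "?\<rho> < 1"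
    using harnack_const z mult_mono[of harnack_const 1 "1 - norm z" 1] by auto
  have "(\<lambda>n. ?\<rho> ^ n * norm z) \<longlonglongrightarrow> 0 * norm z"
    using \<rho> by (intro tendsto_mult LIMSEQ_power_zero tendsto_const) simp
  then have "(\<lambda>n. ?\<rho> ^ n * norm z) \<longlonglongrightarrow> 0" by simp
  then show ?thesis
    by (rule tendsto_sandwich[rotated 2, OF tendsto_const]) (use norm_iter_geometric[OF z order_refl z] in auto)
qed

text \<open>The weight \<open>Fweight \<circ> bdry ^^ N\<close> with respect to the Poisson kernel of a point close to the
  arc: the Poisson kernel localizes, and \<open>bdry ^^ N\<close> carries it to almost normalized Lebesgue measure.\<close>

lemma not_bounded_near:
  assumes x0: "norm \<xi>0 = 1" and \<rho>: "0 < \<rho>"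
    and bdd: "AE \<xi> in circle_measure. norm (\<xi> - \<xi>0) < \<rho> \<longrightarrow> norm (Fsum_bdry \<xi>) \<le> M"
  shows "summable (\<lambda>n. norm (A n))"
proof -
  \<comment> \<open>The bound has to be nonnegative to survive in the estimate away from
    \<xi>0.\<close>
  define M' where "M' = max M 0"
  \<comment> \<open>The lower and the upper estimate below each lose
    \<open>2 * \<kappa> * B\<close>. Together this is half of the main term
    \<open>riesz_gain * B\<close>.\<close>
  define \<kappa> where "\<kappa> = riesz_gain / 8"
  have \<kappa>: "0 < \<kappa>" "\<kappa> \<le> 1" using riesz_gain by (auto simp: \<kappa>_def)
  \<comment> \<open>The point \<open>z\<close> is at distance \<open>d\<close> from \<xi>0. The
    bound \<open>\<rho> / 2\<close> keeps it at least that far from the circle points outside the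
    \<rho>-disc, and the last bound makes the kernel at most \<kappa> there.\<close>
  define d where "d = min (1 / 2) (min (\<rho> / 2) (\<kappa> * (\<rho> / 2)\<^sup>2 / 2))"
  have d: "0 < d" "d \<le> 1 / 2" "d \<le> \<rho> / 2" "2 * d / (\<rho> / 2)\<^sup>2 \<le> \<kappa>"
  proof -
    show "0 < d" "d \<le> 1 / 2" "d \<le> \<rho> / 2" using \<rho> \<kappa> by (auto simp: d_def)
    have "d \<le> \<kappa> * (\<rho> / 2)\<^sup>2 / 2" by (simp add: d_def)
    then show "2 * d / (\<rho> / 2)\<^sup>2 \<le> \<kappa>" using \<rho> by (simp add: field_simps)
  qed
  define z where "z = of_real (1 - d) * \<xi>0"
  have nz: "norm z = 1 - d" using d x0 unfolding z_def norm_mult norm_of_real by simp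
  have z: "norm z < 1" using nz d by simp
  have far: "poisson_kernel z \<xi> \<le> \<kappa>" if x: "norm \<xi> = 1" and "\<not> norm (\<xi> - \<xi>0) < \<rho>" for \<xi>
  proof -
    have "norm (z - \<xi>0) = d"
    proof -
      have "z - \<xi>0 = - of_real d * \<xi>0" by (simp add: z_def algebra_simps)
      then show ?thesis using d x0 by (simp add: norm_mult)
    qed
    then have "\<rho> / 2 \<le> norm (\<xi> - z)"
      using that d norm_triangle_ineq[of "\<xi> - z" "z - \<xi>0"] by simp
    then have "poisson_kernel z \<xi> \<le> 2 * (1 - norm z) / (\<rho> / 2)\<^sup>2"
      using \<rho> by (intro poisson_kernel_upper z) auto
    then show ?thesis using d nz by simp
  qed
  \<comment> \<open>By Harnack's bounds the kernel at \<open>w = (f ^^ N) z\<close> then differs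
    from 1 by at most \<kappa>. Both \<open>z\<close> and \<open>N\<close> are fixed before the
    length \<open>k\<close> of the product varies.\<close>
  obtain N where N: "norm ((f ^^ N) z) < \<kappa> / 4"
    using order_tendstoD(2)[OF iter_tendsto_0[OF z], of "\<kappa> / 4"] \<kappa> by (auto simp: eventually_sequentially)
  define w where "w = (f ^^ N) z"
  have w: "norm w < 1" unfolding w_def by (rule iter_disc[OF z])
  have near1: "\<bar>poisson_kernel w \<xi> - 1\<bar> \<le> \<kappa>" if x: "norm \<xi> = 1" for \<xi>
  proof -
    define t where "t = norm w"
    have t: "0 \<le> t" "t < \<kappa> / 4" "t < 1 / 2" using N \<kappa> by (auto simp: w_def t_def)
    have tt: "t * \<kappa> \<le> t * 1" using t \<kappa> by (intro mult_left_mono) auto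
    have tt0: "0 \<le> \<kappa> * t" using t \<kappa> by simp
    have "(1 + t) / (1 - t) \<le> 1 + \<kappa>" using t tt by (simp add: divide_simps) (simp add: algebra_simps)
    moreover have "1 - \<kappa> \<le> (1 - t) / (1 + t)"
    proof -
      have "(1 - \<kappa>) * (1 + t) = 1 + t - \<kappa> - \<kappa> * t" by (simp add: algebra_simps)
      also have "\<dots> \<le> 1 - t" using t tt0 by linarith
      finally show ?thesis using t by (simp add: pos_le_divide_eq)
    qed
    ultimately show ?thesis using poisson_kernel_le[OF w x] poisson_kernel_ge[OF w x] by (simp add: t_def abs_le_iff)
  qed
  interpret S: iterate_series_l2 f "\<lambda>n. A (n + N)" by (rule shifted)
  have eq: "S.Fsum_bdry = tail_series N" by (simp add: fun_eq_iff tail_series_def S.Fsum_bdry_def)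
  obtain R where R1: "\<And>k. riesz_gain * (\<Sum>m<Suc k. norm (mcoeff (\<lambda>n. A (n + N)) m)) - R \<le> (\<integral>\<^sub>C \<xi>. S.Fweight k \<xi> * Re (tail_series N \<xi>))"
    and R2: "\<And>k. (\<integral>\<^sub>C \<xi>. S.Fweight k \<xi> * norm (tail_series N \<xi>)) \<le> 2 * (\<Sum>m<Suc k. norm (mcoeff (\<lambda>n. A (n + N)) m)) + R"
    using S.riesz_Fsum unfolding eq by blast
  define L where "L = (\<Sum>n<N. norm (A n))"
  have L0: "0 \<le> L" unfolding L_def by (rule sum_nonneg) simp
  define b where "b = mcoeff (\<lambda>n. A (n + N))"
  define X where "X = 2 * (M' + L) + \<kappa> * L + R + 2 * \<kappa> * R"
  define Cst where "Cst = 2 * X / riesz_gain"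
  have bound: "(\<Sum>m<Suc k. norm (b m)) \<le> Cst" for k
  proof -
    define B where "B = (\<Sum>m<Suc k. norm (b m))"
    let ?W = "S.Fweight k" and ?g = "tail_series N" and ?P = "poisson_kernel z"
    have W0: "0 \<le> ?W \<xi>" if "norm \<xi> = 1" for \<xi>
      using riesz_bounds[of "\<lambda>n. sgn (mcoeff (\<lambda>n. A (n + N)) n)" \<xi> "Suc k"] S.sgn_le that by blast
    note Wint = integrable_riesz[where u = "\<lambda>n. sgn (mcoeff (\<lambda>n. A (n + N)) n)" and K = "Suc k", OF S.sgn_le]
    note Wone = integral_riesz_one[where u = "\<lambda>n. sgn (mcoeff (\<lambda>n. A (n + N)) n)" and K = "Suc k", OF S.sgn_le]
    note G1 = integrable_riesz_mult_real[where u = "\<lambda>n. sgn (mcoeff (\<lambda>n. A (n + N)) n)" and K = "Suc k", OF S.sgn_le integrable_Re[OF tail_series_integrable[of N]]]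
    note G2 = integrable_riesz_mult_real[where u = "\<lambda>n. sgn (mcoeff (\<lambda>n. A (n + N)) n)" and K = "Suc k", OF S.sgn_le integrable_norm[OF tail_series_integrable[of N]]]
    note WT = integral_bdry_iter[OF borel_measurable_integrable[OF Wint], of N]
    note G1T = integral_bdry_iter[OF borel_measurable_integrable[OF G1], of N]
    note G2T = integral_bdry_iter[OF borel_measurable_integrable[OF G2], of N]
    let ?T = "bdry ^^ N"
    have iP1: "integrable circle_measure (\<lambda>\<xi>. ?P \<xi> * (?W (?T \<xi>) * Re (?g (?T \<xi>))))"
      using integrable_poisson_mult[OF z iffD2[OF G1T(2) G1]] unfolding real_scaleR_def .
    have iPW: "integrable circle_measure (\<lambda>\<xi>. ?P \<xi> * ?W (?T \<xi>))"
      using integrable_poisson_mult[OF z iffD2[OF WT(2) Wint]] unfolding real_scaleR_def .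
    \<comment> \<open>Transport by \<open>bdry ^^ N\<close> replaces the kernel at \<open>z\<close>
      by the one at \<open>w\<close>, and this one by 1 at the cost of \<kappa> times the weighted
      mean of the modulus.\<close>
    have lower: "riesz_gain * B - R - \<kappa> * (2 * B + R) \<le> (\<integral>\<^sub>C \<xi>. ?P \<xi> * (?W (?T \<xi>) * Re (?g (?T \<xi>))))"
    proof -
      have "riesz_gain * B - R - \<kappa> * (2 * B + R) \<le>
          (\<integral>\<^sub>C \<xi>. ?W \<xi> * Re (?g \<xi>)) - \<kappa> * (\<integral>\<^sub>C \<xi>. ?W \<xi> * norm (?g \<xi>))"
        using R1[of k] mult_left_mono[OF R2[of k], of \<kappa>] \<kappa> unfolding B_def b_def by linarith
      also have "\<dots> = (\<integral>\<^sub>C \<xi>. ?W \<xi> * Re (?g \<xi>) - \<kappa> * (?W \<xi> * norm (?g \<xi>)))"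
        using Bochner_Integration.integral_diff[OF G1 integrable_mult_right[OF G2, of \<kappa>]]
        by (simp only: integral_mult_right_zero)
      also have "\<dots> \<le> (\<integral>\<^sub>C \<xi>. poisson_kernel w \<xi> * (?W \<xi> * Re (?g \<xi>)))"
      proof (rule circle_integral_mono[OF Bochner_Integration.integrable_diff[OF G1 integrable_mult_right[OF G2, of \<kappa>]]])
        show "integrable circle_measure (\<lambda>\<xi>. poisson_kernel w \<xi> * (?W \<xi> * Re (?g \<xi>)))"
          using integrable_poisson_mult[OF w G1] unfolding real_scaleR_def .
        fix \<xi> :: complex assume x: "norm \<xi> = 1"
        have "\<bar>(poisson_kernel w \<xi> - 1) * (?W \<xi> * Re (?g \<xi>))\<bar> \<le> \<kappa> * (?W \<xi> * norm (?g \<xi>))"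
          unfolding abs_mult using near1[OF x] W0[OF x] abs_Re_le_cmod[of "?g \<xi>"] \<kappa>
          by (intro mult_mono) auto
        then show "?W \<xi> * Re (?g \<xi>) - \<kappa> * (?W \<xi> * norm (?g \<xi>)) \<le> poisson_kernel w \<xi> * (?W \<xi> * Re (?g \<xi>))"
          unfolding left_diff_distrib by linarith
      qed
      also have "\<dots> = (\<integral>\<^sub>C \<xi>. ?P \<xi> * (?W (?T \<xi>) * Re (?g (?T \<xi>))))"
        using integral_poisson_iter[OF z borel_measurable_integrable[OF G1], of N] unfolding real_scaleR_def w_def ..
      finally show ?thesis .
    qed
    have PW: "(\<integral>\<^sub>C \<xi>. ?P \<xi> * ?W (?T \<xi>)) \<le> 2"
    proof -
      have "(\<integral>\<^sub>C \<xi>. ?P \<xi> * ?W (?T \<xi>)) = (\<integral>\<^sub>C \<xi>. poisson_kernel w \<xi> * ?W \<xi>)"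
        using integral_poisson_iter[OF z borel_measurable_integrable[OF Wint], of N] unfolding real_scaleR_def w_def .
      also have "\<dots> \<le> (\<integral>\<^sub>C \<xi>. 2 * ?W \<xi>)"
      proof (rule circle_integral_mono)
        show "integrable circle_measure (\<lambda>\<xi>. poisson_kernel w \<xi> * ?W \<xi>)"
          using integrable_poisson_mult[OF w Wint] unfolding real_scaleR_def .
        show "integrable circle_measure (\<lambda>\<xi>. 2 * ?W \<xi>)" using Wint by (rule integrable_mult_right)
        fix \<xi> :: complex assume x: "norm \<xi> = 1"
        show "poisson_kernel w \<xi> * ?W \<xi> \<le> 2 * ?W \<xi>"
          using near1[OF x] \<kappa> by (intro mult_right_mono W0 x) linarith
      qed
      also have "\<dots> = 2" by (simp only: integral_mult_right_zero Wone mult_1_right)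
      finally show ?thesis .
    qed
    \<comment> \<open>Near \<xi>0 the sum is at most \<open>M'\<close>; elsewhere the kernel is at
      most \<kappa> and the sum at most \<open>L\<close> plus the modulus of the tail. Only the last
      term of \<open>?U\<close> has an integral that can grow with \<open>B\<close>.\<close>
    let ?U = "\<lambda>\<xi>. (M' + L) * (?P \<xi> * ?W (?T \<xi>)) + \<kappa> * L * ?W (?T \<xi>) + \<kappa> * (?W (?T \<xi>) * norm (?g (?T \<xi>)))"
    have iU1: "integrable circle_measure (\<lambda>\<xi>. (M' + L) * (?P \<xi> * ?W (?T \<xi>)))" by (rule integrable_mult_right[OF iPW])
    have iU2: "integrable circle_measure (\<lambda>\<xi>. \<kappa> * L * ?W (?T \<xi>))" by (rule integrable_mult_right[OF iffD2[OF WT(2) Wint]])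
    have iU3: "integrable circle_measure (\<lambda>\<xi>. \<kappa> * (?W (?T \<xi>) * norm (?g (?T \<xi>))))"
      by (rule integrable_mult_right[OF iffD2[OF G2T(2) G2]])
    have "(\<integral>\<^sub>C \<xi>. ?P \<xi> * (?W (?T \<xi>) * Re (?g (?T \<xi>)))) \<le> (\<integral>\<^sub>C \<xi>. ?U \<xi>)"
    proof (rule integral_mono_AE[OF iP1 Bochner_Integration.integrable_add[OF Bochner_Integration.integrable_add[OF iU1 iU2] iU3]])
      show "AE \<xi> in circle_measure. ?P \<xi> * (?W (?T \<xi>) * Re (?g (?T \<xi>))) \<le> ?U \<xi>"
        using AE_split[of N] bdd AE_norm_circle
      proof eventually_elim
        case (elim \<xi>)
        define p where "p = ?P \<xi>"
        define v where "v = ?W (?T \<xi>)"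
        define y where "y = norm (?g (?T \<xi>))"
        have p: "0 \<le> p" unfolding p_def by (rule poisson_kernel_nonneg[OF z])
        have v: "0 \<le> v" unfolding v_def by (rule W0[OF norm_bdry_iter[OF elim(3)]])
        have s: "norm (psum_bdry N \<xi>) \<le> L" unfolding L_def by (rule norm_psum_bdry[OF elim(3)])
        have Re_g: "Re (?g (?T \<xi>)) \<le> norm (Fsum_bdry \<xi>) + L"
        proof -
          have "?g (?T \<xi>) = Fsum_bdry \<xi> - psum_bdry N \<xi>" using elim(1) by simp
          then have "norm (?g (?T \<xi>)) \<le> norm (Fsum_bdry \<xi>) + L"
            using norm_triangle_ineq4[of "Fsum_bdry \<xi>" "psum_bdry N \<xi>"] s by simp
          then show ?thesis using complex_Re_le_cmod[of "?g (?T \<xi>)"] by linarith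
        qed
        have Fg: "norm (Fsum_bdry \<xi>) \<le> L + y"
          unfolding elim(1) y_def using norm_triangle_ineq[of "psum_bdry N \<xi>" "?g (?T \<xi>)"] s by linarith
        have pF: "p * norm (Fsum_bdry \<xi>) \<le> p * M' + \<kappa> * (L + y)"
        proof (cases "norm (\<xi> - \<xi>0) < \<rho>")
          case True
          then have "norm (Fsum_bdry \<xi>) \<le> M'" using elim(2) by (simp add: M'_def)
          then have "p * norm (Fsum_bdry \<xi>) \<le> p * M'" using p by (intro mult_left_mono)
          moreover have "0 \<le> \<kappa> * (L + y)" using \<kappa> L0 by (simp add: y_def)
          ultimately show ?thesis by linarith
        next
          case False
          then have "p \<le> \<kappa>" unfolding p_def by (intro far elim)
          then have "p * norm (Fsum_bdry \<xi>) \<le> \<kappa> * (L + y)" using Fg \<kappa> by (intro mult_mono) auto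
          moreover have "0 \<le> p * M'" using p by (simp add: M'_def)
          ultimately show ?thesis by linarith
        qed
        have "p * Re (?g (?T \<xi>)) \<le> p * (norm (Fsum_bdry \<xi>) + L)" using Re_g p by (rule mult_left_mono)
        also have "\<dots> \<le> (M' + L) * p + \<kappa> * L + \<kappa> * y" using pF by (simp add: algebra_simps)
        finally have "v * (p * Re (?g (?T \<xi>))) \<le> v * ((M' + L) * p + \<kappa> * L + \<kappa> * y)"
          using v by (rule mult_left_mono)
        then show ?case unfolding p_def[symmetric] v_def[symmetric] y_def[symmetric] by (simp add: algebra_simps)
      qed
    qed
    also have "\<dots> = (M' + L) * (\<integral>\<^sub>C \<xi>. ?P \<xi> * ?W (?T \<xi>)) + \<kappa> * L * (\<integral>\<^sub>C \<xi>. ?W (?T \<xi>))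
        + \<kappa> * (\<integral>\<^sub>C \<xi>. ?W (?T \<xi>) * norm (?g (?T \<xi>)))"
      by (simp only: Bochner_Integration.integral_add[OF Bochner_Integration.integrable_add[OF iU1 iU2] iU3]
          Bochner_Integration.integral_add[OF iU1 iU2] integral_mult_right_zero)
    also have "\<dots> \<le> (M' + L) * 2 + \<kappa> * L * 1 + \<kappa> * (2 * B + R)"
    proof (intro add_mono mult_left_mono)
      show "(\<integral>\<^sub>C \<xi>. ?P \<xi> * ?W (?T \<xi>)) \<le> 2" by (rule PW)
      show "(\<integral>\<^sub>C \<xi>. ?W (?T \<xi>)) \<le> 1" unfolding WT(1) Wone by simp
      show "(\<integral>\<^sub>C \<xi>. ?W (?T \<xi>) * norm (?g (?T \<xi>))) \<le> 2 * B + R"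
        unfolding G2T(1) B_def b_def by (rule R2)
    qed (use \<kappa> L0 in \<open>auto simp: M'_def\<close>)
    finally have "riesz_gain * B - R - \<kappa> * (2 * B + R) \<le> (M' + L) * 2 + \<kappa> * L * 1 + \<kappa> * (2 * B + R)"
      using lower by linarith
    \<comment> \<open>All terms free of \<open>B\<close> are collected in \<open>X\<close>; the
      others are absorbed on the left, which leaves half of \<open>riesz_gain * B\<close>.\<close>
    then have "riesz_gain * B - 4 * (\<kappa> * B) \<le> X"
      by (simp add: X_def algebra_simps)
    moreover have "4 * (\<kappa> * B) = riesz_gain * B / 2" by (simp add: \<kappa>_def)
    ultimately have "riesz_gain * B \<le> 2 * X" by linarith
    then have "B \<le> Cst" unfolding Cst_def using riesz_gain by (simp add: field_simps)
    then show ?thesis by (simp only: B_def)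
  qed
  have sb: "summable (\<lambda>n. norm (b n))"
  proof (rule summableI_nonneg_bounded)
    show "(\<Sum>m<n. norm (b m)) \<le> Cst" for n
      using bound[of n] by (simp add: order_trans[rotated])
  qed simp
  \<comment> \<open>The recursion for \<open>mcoeff\<close>, solved for the original coefficients,
    carries absolute summability back to them.\<close>
  have "summable (\<lambda>n. norm (A (Suc n + N)))"
  proof (rule summable_comparison_test')
    show "summable (\<lambda>n. norm (b (Suc n)) + norm (b n))"
      by (intro summable_add sb iffD2[OF summable_Suc_iff sb])
    fix n
    have "A (Suc n + N) = b (Suc n) - cnj mult0 * b n" by (simp add: b_def)
    then have "norm (A (Suc n + N)) \<le> norm (b (Suc n)) + norm mult0 * norm (b n)"
      using norm_triangle_ineq4[of "b (Suc n)" "cnj mult0 * b n"] by (simp add: norm_mult)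
    also have "norm mult0 * norm (b n) \<le> norm (b n)" using norm_mult0 by (intro mult_left_le_one_le) auto
    finally show "norm (norm (A (Suc n + N))) \<le> norm (b (Suc n)) + norm (b n)" by simp
  qed
  then have "summable (\<lambda>n. norm (A (n + Suc N)))" by simp
  then show ?thesis using summable_iff_shift[of "\<lambda>n. norm (A n)" "Suc N"] by blast
qed

end

subsection \<open>Arcs and the main result\<close>

text \<open>The disc is centred at the midpoint of the arc. An arc is at most three times its chord,
  so a chord below a sixth of the parameter length keeps the parameter within half that length of
  the midpoint.\<close>

lemma arc_contains_disc:
  assumes "circle_arc I"
  obtains \<xi>0 \<rho> where "norm \<xi>0 = 1" "0 < \<rho>" "\<And>\<xi>. norm \<xi> = 1 \<Longrightarrow> norm (\<xi> - \<xi>0) < \<rho> \<Longrightarrow> \<xi> \<in> I"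
proof -
  obtain J s t where J: "is_interval J" "s \<in> J" "t \<in> J" "s < t" and I: "I = cis ` J"
    using assms unfolding circle_arc_def by blast
  define \<theta> where "\<theta> = (s + t) / 2"
  have "\<xi> \<in> I" if x: "norm \<xi> = 1" and c: "norm (\<xi> - cis \<theta>) < (t - s) / 6" for \<xi>
  proof -
    define \<tau> where "\<tau> = Arg (\<xi> / cis \<theta>)"
    have \<tau>: "- pi < \<tau>" "\<tau> \<le> pi" unfolding \<tau>_def using Arg_bounded by blast+
    have "norm (\<xi> / cis \<theta>) = 1" using x by (simp add: norm_divide)
    then have "cis \<tau> = \<xi> / cis \<theta>"
      unfolding \<tau>_def by (subst cis_Arg) (auto simp: sgn_eq)
    then have \<xi>: "\<xi> = cis (\<theta> + \<tau>)" by (simp add: cis_mult[symmetric])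
    have "\<bar>\<tau>\<bar> / 2 / 3 \<le> sin (\<bar>\<tau>\<bar> / 2)" by (rule sin_ge_third) (use \<tau> in auto)
    also have "\<dots> \<le> \<bar>sin (\<tau> / 2)\<bar>"
      using abs_ge_self[of "sin (\<bar>\<tau>\<bar> / 2)"] abs_sin_half_abs[of \<tau>] by simp
    also have "\<dots> = norm (\<xi> - cis \<theta>) / 2" unfolding \<xi> norm_cis_diff by simp
    finally have "\<bar>\<tau>\<bar> < (t - s) / 2" using c by linarith
    then have "- ((t - s) / 2) < \<tau>" "\<tau> < (t - s) / 2" by linarith+
    then have "\<theta> + \<tau> \<in> {s..t}" by (simp add: \<theta>_def field_simps)
    then have "\<theta> + \<tau> \<in> J" using J mem_is_interval_1_I[OF J(1-3)] by simp
    then show ?thesis unfolding \<xi> I by blast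
  qed
  then show ?thesis using that[of "cis \<theta>" "(t - s) / 6"] J(4) by simp
qed

context iterate_series_l2
begin

text \<open>Almost every point of the arc carries a nontangential limit, so a supremum below
  infinity would bound the boundary sum almost everywhere near one point, against
  \<open>not_bounded_near\<close>.\<close>

lemma sup_arc_infinite:
  assumes A: "\<not> summable (\<lambda>n. norm (A n))" and I: "circle_arc I"
  shows "(SUP \<xi>\<in>{\<xi> \<in> I. \<exists>w. has_nontangential_limit Fsum \<xi> w}. ereal (norm (boundary_value Fsum \<xi>))) = \<infinity>"
    (is "(SUP \<xi>\<in>?S. ?h \<xi>) = \<infinity>")
proof (rule ccontr)
  assume ne: "(SUP \<xi>\<in>?S. ?h \<xi>) \<noteq> \<infinity>"
  obtain M where M: "(SUP \<xi>\<in>?S. ?h \<xi>) \<le> ereal M"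
    using ne by (cases "SUP \<xi>\<in>?S. ?h \<xi>") auto
  obtain \<xi>0 \<rho> where arc: "norm \<xi>0 = 1" "0 < \<rho>" "\<And>\<xi>. norm \<xi> = 1 \<Longrightarrow> norm (\<xi> - \<xi>0) < \<rho> \<Longrightarrow> \<xi> \<in> I"
    using arc_contains_disc[OF I] by blast
  have "AE \<xi> in circle_measure. norm (\<xi> - \<xi>0) < \<rho> \<longrightarrow> norm (Fsum_bdry \<xi>) \<le> M"
    using AE_Fsum_nontangential AE_norm_circle
  proof eventually_elim
    case (elim \<xi>)
    show ?case
    proof
      assume "norm (\<xi> - \<xi>0) < \<rho>"
      then have "\<xi> \<in> ?S" using arc(3) elim by blast
      then have "?h \<xi> \<le> ereal M" using M by (intro order_trans[OF SUP_upper M])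
      then show "norm (Fsum_bdry \<xi>) \<le> M" using boundary_value_eq[OF elim(2,1)] by simp
    qed
  qed
  from not_bounded_near[OF arc(1,2) this] A show False by contradiction
qed

end

text \<open>Holds at every point, also where the series diverges: the two \<open>sums\<close>
  predicates coincide, hence so do the values that \<open>The\<close> selects.\<close>

lemma iterate_series_eq_suminf:
  assumes "A 0 = 0" "\<And>n. A (Suc n) = a (Suc n)"
  shows "iterate_series a f = (\<lambda>z. \<Sum>n. A n * (f ^^ n) z)"
proof
  fix z
  have "(\<lambda>n. a (Suc n) * (f ^^ Suc n) z) sums s \<longleftrightarrow> (\<lambda>n. A n * (f ^^ n) z) sums s" for s
    using sums_Suc_iff[of "\<lambda>n. A n * (f ^^ n) z" s] assms by (simp del: funpow.simps(2))
  then have "(sums) (\<lambda>n. a (Suc n) * (f ^^ Suc n) z) = (sums) (\<lambda>n. A n * (f ^^ n) z)"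
    by (rule ext)
  from arg_cong[OF this, of The] show "iterate_series a f z = (\<Sum>n. A n * (f ^^ n) z)"
    unfolding iterate_series_def suminf_def .
qed

theorem corollary1p6:
  fixes f :: "complex \<Rightarrow> complex" and a :: "nat \<Rightarrow> complex"
  assumes "inner_function f"
    and "f 0 = 0"
    and "\<not> is_rotation f"
    and "summable (\<lambda>n. (norm (a (Suc n)))\<^sup>2)"
    and "\<not> summable (\<lambda>n. norm (a (Suc n)))"
  shows "H2_sums (\<lambda>n z. a (Suc n) * (f ^^ Suc n) z) (iterate_series a f)
    \<and> iterate_series a f \<in> BMOA_closure Hinf
    \<and> (AE \<xi> in circle_measure.
          has_nontangential_limit (iterate_series a f) \<xi> (boundary_value (iterate_series a f) \<xi>)
        \<and> has_radial_limit (iterate_series a f) \<xi> (boundary_value (iterate_series a f) \<xi>)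
        \<and> (\<forall>n. has_radial_limit (f ^^ Suc n) \<xi> (radial_limit (f ^^ Suc n) \<xi>))
        \<and> (\<lambda>n. a (Suc n) * radial_limit (f ^^ Suc n) \<xi>) sums boundary_value (iterate_series a f) \<xi>)
    \<and> (\<forall>I. circle_arc I \<longrightarrow>
          (SUP \<xi>\<in>{\<xi> \<in> I. \<exists>w. has_nontangential_limit (iterate_series a f) \<xi> w}.
             ereal (norm (boundary_value (iterate_series a f) \<xi>))) = \<infinity>)"
proof -
  \<comment> \<open>Index 0 belongs to the identity map, the zeroth iterate; the coefficient 0
    removes it from the series.\<close>
  define A where "A n = (if n = 0 then 0 else a n)" for n
  have A [simp]: "A 0 = 0" "A (Suc n) = a (Suc n)" for n by (auto simp: A_def)
  interpret iterate_series_l2 f A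
  proof
    show "summable (\<lambda>n. (norm (A n))\<^sup>2)"
      using assms(4) by (subst summable_Suc_iff[symmetric]) simp
  qed (use assms in auto)
  have F: "iterate_series a f = Fsum"
    using iterate_series_eq_suminf[of A a f] by (simp add: Fsum_def[abs_def])
  have psum_Suc: "(\<Sum>n<N. a (Suc n) * (f ^^ Suc n) z) = (\<Sum>n<Suc N. A n * (f ^^ n) z)" for N z
    by (subst sum.lessThan_Suc_shift) (simp del: funpow.simps(2))
  have "H2_sums (\<lambda>n z. a (Suc n) * (f ^^ Suc n) z) Fsum"
    unfolding H2_sums_def
  proof (intro conjI allI)
    note H = H2_sums_Fsum[unfolded H2_sums_def]
    show "(\<lambda>z. a (Suc n) * (f ^^ Suc n) z) \<in> H2" for n
      using H[THEN conjunct1, rule_format, of "Suc n"] by (simp only: A)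
    show "Fsum \<in> H2" using H by blast
    show "(\<lambda>N. H2_norm_sq (\<lambda>z. Fsum z - (\<Sum>n<N. a (Suc n) * (f ^^ Suc n) z))) \<longlonglongrightarrow> 0"
      unfolding psum_Suc using H[THEN conjunct2, THEN conjunct2] by (rule LIMSEQ_Suc)
  qed
  moreover have "Fsum \<in> BMOA_closure Hinf" by (rule Fsum_BMOA_closure)
  moreover have "AE \<xi> in circle_measure.
          has_nontangential_limit Fsum \<xi> (boundary_value Fsum \<xi>)
        \<and> has_radial_limit Fsum \<xi> (boundary_value Fsum \<xi>)
        \<and> (\<forall>n. has_radial_limit (f ^^ Suc n) \<xi> (radial_limit (f ^^ Suc n) \<xi>))
        \<and> (\<lambda>n. a (Suc n) * radial_limit (f ^^ Suc n) \<xi>) sums boundary_value Fsum \<xi>"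
  proof -
    have "AE \<xi> in circle_measure. \<forall>n. has_nontangential_limit (f ^^ n) \<xi> ((bdry ^^ n) \<xi>)"
      unfolding AE_all_countable using iter_nontangential by blast
    with AE_Fsum_nontangential AE_sums_bdry AE_norm_circle show ?thesis
    proof eventually_elim
      case (elim \<xi>)
      have bv: "boundary_value Fsum \<xi> = Fsum_bdry \<xi>" by (rule boundary_value_eq[OF elim(3,1)])
      have r: "has_radial_limit (f ^^ n) \<xi> ((bdry ^^ n) \<xi>)" for n
        by (rule nontangential_imp_radial[OF elim(3)]) (use elim(4) in blast)
      have rl: "radial_limit (f ^^ n) \<xi> = (bdry ^^ n) \<xi>" for n by (rule radial_limit_eq[OF r])
      have "(\<lambda>n. a (Suc n) * (bdry ^^ Suc n) \<xi>) sums Fsum_bdry \<xi>"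
        using sums_Suc_iff[of "\<lambda>n. A n * (bdry ^^ n) \<xi>" "Fsum_bdry \<xi>"] elim(2) by (simp del: funpow.simps(2))
      then show ?case
        unfolding bv rl using elim(1) nontangential_imp_radial[OF elim(3,1)] r by blast
    qed
  qed
  moreover have "\<not> summable (\<lambda>n. norm (A n))"
    using assms(5) by (subst summable_Suc_iff[symmetric]) simp
  ultimately show ?thesis unfolding F using sup_arc_infinite by blast
qed

end
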